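(* The set of all products $\psi(X_{J_1})\cdots\psi(X_{J_m})$ with $J_1\subset\dots\subset J_m$ (nonempty order ideals in $P$, $m\ge0$) projects to a basis of the symplectic Plücker algebra $\mathbb C[\Theta]/I$.
   Context: Fix $n\ge 1$. Let $(N,\lessdot)$ be the totally ordered set $\{1\lessdot\dots\lessdot n\lessdot -n\lessdot\dots\lessdot -1\}$. Let $P$ be the set of integer pairs $(i,j)$ with $1\le i\le n$, $i\le|j|\le n$, partially ordered by $(i_1,j_1)\preceq(i_2,j_2)$ iff $i_1\le i_2$ and ($j_1\lessdot j_2$ or $j_1=j_2$). Let $A=\{(i,i):1\le i\le n\}$ and fix $O$ with $A\subset O\subset P$. $\mathcal J$ is the set of order ideals (lower sets) of $P$, and $\mathcal J_k=\{J\in\mathcal J:|J\cap A|=k\}$ for $k\in[1,n]$. For $J\in\mathcal J$ put $M_O(J)=(J\cap O)\cup\max_\prec(J)$, where $\max_\prec(J)$ is the set of maximal elements. For $(i,j)\in P$ let $s_{i,j}$ be the permutation of $N$ exchanging $i$ and $j$ ($s_{i,i}=\mathrm{id}$). For $M\subset P$ let $w_M$ be the product of all $s_{i,j}$, $(i,j)\in M$, ordered first by $i$ increasing from left to right and then by $j$ $\lessdot$-increasing from left to right (composition of maps, rightmost factor applied first). Put $w^{O,J}=w_O^{-1}w_{M_O(J)}$. Let $S=\mathbb C[X_{i_1,\dots,i_k}]$ with variables for $k\in[1,n]$, $i_1\lessdot\dots\lessdot i_k$ in $N$, with the convention $X_{i_1,\dots,i_k}=(-1)^\sigma X_{i_{\sigma(1)},\dots,i_{\sigma(k)}}$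 (zero if subscripts repeat). $I_{\mathrm A}\subset S$ is the kernel of the map to $\mathbb C[z_{i,j}]_{i\in[1,n],j\in N}$ sending $X_{i_1,\dots,i_k}$ to the determinant $|z_{i,j}|_{i=1,\dots,k;\,j=i_1,\dots,i_k}$. $\mathfrak L\subset S$ is the span of all $X_{i_1,\dots,i_k,1,-1}+\dots+X_{i_1,\dots,i_k,n,-n}$, $k\in[0,n-2]$, $i_1\lessdot\dots\lessdot i_k$. A tuple in $N$ is admissible if its elements are distinct and for each $l\in[1,n]$ at most $l$ of them have absolute value $\le l$. $\Theta$ (resp. $\Theta'$) is the set of admissible (resp. non-admissible) tuples $(i_1\lessdot\dots\lessdot i_k)$, $k\in[1,n]$; $\mathbb C[\Theta]\subset S$ is generated by the variables with subscripts in $\Theta$. For each tuple in $\Theta'$ there is a unique linear combination $R$ of variables of $\mathbb C[\Theta]$ with $X_{i_1,\dots,i_k}-R\in\mathfrak L$; $\rho_1:S\to\mathbb C[\Theta]$ is the homomorphism sending such $X_{i_1,\dots,i_k}$ to $R$ and fixing the variables of $\mathbb C[\Theta]$. Put $I=\rho_1(I_{\mathrm A})$; then $\mathbb C[\Theta]/I\cong S/(I_{\mathrm A}+\langle\mathfrak L\rangle)$. $\mathbb C[\mathcal J]$ is the polynomial ring in variables $X_J$, $J\in\mathcal J$ nonempty, and $\psi:\mathbb C[\mathcal J]\to\mathbb C[\Theta]$ is the homomorphism with $\psi(X_J)=X_{w^{O,J}(1),\dots,w^{O,J}(k)}$ for $J\in\mathcal J_k$ (these tuples are admissible). *)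

theory Defs
  imports
    "Jordan_Normal_Form.VS_Connect"
    "Jordan_Normal_Form.Determinant"
    "HOL-Library.Poly_Mapping"
    "HOL-Algebra.QuotRing"
    "HOL-Combinatorics.Permutations"
begin

section \<open>Complex polynomial rings in a set of variables\<close>

type_synonym 'v cpoly = "('v \<Rightarrow>\<^sub>0 nat) \<Rightarrow>\<^sub>0 complex"

definition cvar :: "'v \<Rightarrow> 'v cpoly" where
  "cvar v = Poly_Mapping.single (Poly_Mapping.single v 1) 1"

definition cconst :: "complex \<Rightarrow> 'v cpoly" where
  "cconst c = Poly_Mapping.single 0 c"

text \<open>The \<^typ>\<open>complex\<close>-algebra of polynomials involving only variables from \<open>V\<close>.\<close>

definition cpoly_alg :: "'v set \<Rightarrow> (complex, 'v cpoly) module" where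
  "cpoly_alg V =
    \<lparr>carrier = {p. \<forall>m \<in> Poly_Mapping.keys p. Poly_Mapping.keys m \<subseteq> V},
     mult = (*), one = 1, zero = 0, add = (+), smult = (\<lambda>c p. cconst c * p)\<rparr>"

text \<open>The homomorphism of \<^typ>\<open>complex\<close>-algebras that maps each variable \<open>v\<close> to \<open>f v\<close>.\<close>

definition cpoly_hom :: "('v \<Rightarrow> 'w cpoly) \<Rightarrow> 'v cpoly \<Rightarrow> 'w cpoly" where
  "cpoly_hom f p =
    (\<Sum>m \<in> Poly_Mapping.keys p. cconst (Poly_Mapping.lookup p m) *
      (\<Prod>v \<in> Poly_Mapping.keys m. f v ^ Poly_Mapping.lookup m v))"

lemma cconst_one: "cconst 1 = 1"
  by (simp add: cconst_def flip: single_one)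

lemma cpoly_hom_cvar: "cpoly_hom f (cvar v) = f v"
  by (simp add: cpoly_hom_def cvar_def cconst_one)

lemma keys_uminus_cpoly: "Poly_Mapping.keys (- p) = Poly_Mapping.keys (p :: 'v cpoly)"
  by (auto simp: in_keys_iff)

lemma vectorspace_cpoly_alg: "vectorspace (class_ring :: complex ring) (cpoly_alg V)"
proof -
  let ?C = "{p :: 'a cpoly. \<forall>m \<in> Poly_Mapping.keys p. Poly_Mapping.keys m \<subseteq> V}"
  have add: "p + q \<in> ?C" if "p \<in> ?C" "q \<in> ?C" for p q
    using that Poly_Mapping.keys_add[of p q] by blast
  have smult: "cconst c * p \<in> ?C" if "p \<in> ?C" for c p
    using that Poly_Mapping.keys_mult[of "cconst c" p]
    by (fastforce simp: cconst_def split: if_splits)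
  have uminus: "- p \<in> ?C" if "p \<in> ?C" for p
    using that by (simp add: keys_uminus_cpoly)
  have cconst_add: "cconst (c + d) = (cconst c + cconst d :: 'a cpoly)" for c d
    by (simp add: cconst_def single_add)
  have cconst_mult: "cconst (c * d) = (cconst c * cconst d :: 'a cpoly)" for c d
    by (simp add: cconst_def mult_single)
  have zero: "0 \<in> ?C" by simp
  have "abelian_group (cpoly_alg V)"
  proof (rule abelian_groupI)
    fix p assume "p \<in> carrier (cpoly_alg V)"
    then have "p \<in> ?C" by (simp add: cpoly_alg_def)
    from uminus[OF this]
    show "\<exists>q \<in> carrier (cpoly_alg V). q \<oplus>\<^bsub>cpoly_alg V\<^esub> p = \<zero>\<^bsub>cpoly_alg V\<^esub>"
      by (intro bexI[of _ "- p"]) (simp_all add: cpoly_alg_def)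
  qed (unfold cpoly_alg_def ring_record_simps,
      (rule add zero | assumption | simp only: ac_simps add_0 add_0_right)+)
  then have "module (class_ring :: complex ring) (cpoly_alg V)"
    by (intro moduleI class_cring.is_cring; unfold cpoly_alg_def ring_record_simps module.simps)
      (erule smult | assumption |
        simp only: cconst_add cconst_mult cconst_one distrib_left distrib_right mult.assoc mult_1)+
  then show ?thesis
    by (intro vectorspace.intro class_field.field_axioms)
qed

abbreviation cspan :: "'v set \<Rightarrow> 'v cpoly set \<Rightarrow> 'v cpoly set" where
  "cspan V \<equiv> LinearCombinations.module.span (class_ring :: complex ring) (cpoly_alg V)"

text \<open>The quotient algebra by an ideal \<open>I\<close>; a scalar \<open>c\<close> acts as multiplication by its class.\<close>

definition quot_alg :: "(complex, 'v cpoly) module \<Rightarrow> 'v cpoly set \<Rightarrow> (complex, 'v cpoly set) module"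
  where
  "quot_alg R I = ring.extend (R Quot I)
    \<lparr>smult = (\<lambda>c X. (I +>\<^bsub>R\<^esub> cconst c) \<otimes>\<^bsub>R Quot I\<^esub> X)\<rparr>"


section \<open>The poset, its order ideals and the associated permutations\<close>

definition N_set :: "nat \<Rightarrow> int set" where
  "N_set n = {1..int n} \<union> {- int n..-1}"

text \<open>On nonzero integers: \<open>1, 2, 3, \<dots>\<close> in this order, followed by \<open>\<dots>, -3, -2, -1\<close>.\<close>

definition N_less :: "int \<Rightarrow> int \<Rightarrow> bool" where
  "N_less i j \<longleftrightarrow> (0 < i \<and> j < 0) \<or> ((0 < i \<longleftrightarrow> 0 < j) \<and> i < j)"

definition P_set :: "nat \<Rightarrow> (int \<times> int) set" where
  "P_set n = {(i, j). 1 \<le> i \<and> i \<le> int n \<and> i \<le> \<bar>j\<bar> \<and> \<bar>j\<bar> \<le> int n}"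

definition P_le :: "int \<times> int \<Rightarrow> int \<times> int \<Rightarrow> bool" where
  "P_le p q \<longleftrightarrow> fst p \<le> fst q \<and> (N_less (snd p) (snd q) \<or> snd p = snd q)"

definition A_set :: "nat \<Rightarrow> (int \<times> int) set" where
  "A_set n = {(i, i) | i. 1 \<le> i \<and> i \<le> int n}"

definition order_ideals :: "nat \<Rightarrow> (int \<times> int) set set" where
  "order_ideals n = {J. J \<subseteq> P_set n \<and> (\<forall>p \<in> J. \<forall>q \<in> P_set n. P_le q p \<longrightarrow> q \<in> J)}"

definition maximal_elements :: "(int \<times> int) set \<Rightarrow> (int \<times> int) set" where
  "maximal_elements J = {p \<in> J. \<forall>q \<in> J. P_le p q \<longrightarrow> q = p}"

definition M_set :: "(int \<times> int) set \<Rightarrow> (int \<times> int) set \<Rightarrow> (int \<times> int) set" where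
  "M_set Q J = (J \<inter> Q) \<union> maximal_elements J"

text \<open>The comprehension enumerates \<open>M\<close> by increasing \<open>i\<close>, and for fixed \<open>i\<close> by increasing \<open>j\<close> with
  respect to \<^const>\<open>N_less\<close>.\<close>

definition w_perm :: "nat \<Rightarrow> (int \<times> int) set \<Rightarrow> int \<Rightarrow> int" where
  "w_perm n M = foldr (\<circ>)
    [Transposition.transpose i j.
      i \<leftarrow> [1..int n], j \<leftarrow> [1..int n] @ [- int n..-1], (i, j) \<in> M] id"

definition w_ideal :: "nat \<Rightarrow> (int \<times> int) set \<Rightarrow> (int \<times> int) set \<Rightarrow> int \<Rightarrow> int" where
  "w_ideal n Q J = inv_into UNIV (w_perm n Q) \<circ> w_perm n (M_set Q J)"


section \<open>The symplectic Pluecker algebra\<close>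

definition S_vars :: "nat \<Rightarrow> int list set" where
  "S_vars n = {t. 1 \<le> length t \<and> length t \<le> n \<and> set t \<subseteq> N_set n \<and> sorted_wrt N_less t}"

text \<open>\<open>X_tuple t\<close> is \<open>X\<^bsub>t\<^esub>\<close> for an arbitrary tuple \<open>t\<close>, whose entries need not be increasing.\<close>

definition X_tuple :: "int list \<Rightarrow> int list cpoly" where
  "X_tuple t =
    (if distinct t then
       (let \<sigma> = (THE \<sigma>. \<sigma> permutes {..<length t} \<and> sorted_wrt N_less (permute_list \<sigma> t))
        in of_int (sign \<sigma>) * cvar (permute_list \<sigma> t))
     else 0)"

text \<open>The matrix entries are indexed from \<open>0\<close>.\<close>

definition minor_map :: "int list cpoly \<Rightarrow> (int \<times> int) cpoly" where
  "minor_map = cpoly_hom (\<lambda>t.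
    Determinant.det (mat (length t) (length t) (\<lambda>(r, c). cvar (int r + 1, t ! c))))"

definition I_A :: "nat \<Rightarrow> int list cpoly set" where
  "I_A n = {p \<in> carrier (cpoly_alg (S_vars n)). minor_map p = 0}"

definition L_space :: "nat \<Rightarrow> int list cpoly set" where
  "L_space n = cspan (S_vars n)
    {\<Sum>l = 1..int n. X_tuple (t @ [l, - l]) | t.
      length t + 2 \<le> n \<and> set t \<subseteq> N_set n \<and> sorted_wrt N_less t}"

definition admissible :: "nat \<Rightarrow> int list \<Rightarrow> bool" where
  "admissible n t \<longleftrightarrow>
    distinct t \<and> (\<forall>l \<in> {1..n}. card {x \<in> set t. \<bar>x\<bar> \<le> int l} \<le> l)"

definition Theta :: "nat \<Rightarrow> int list set" where
  "Theta n = {t \<in> S_vars n. admissible n t}"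

definition Theta' :: "nat \<Rightarrow> int list set" where
  "Theta' n = {t \<in> S_vars n. \<not> admissible n t}"

definition rho1 :: "nat \<Rightarrow> int list cpoly \<Rightarrow> int list cpoly" where
  "rho1 n = cpoly_hom (\<lambda>t.
    if t \<in> Theta' n
    then (THE R. R \<in> cspan (S_vars n) (cvar ` Theta n) \<and> cvar t - R \<in> L_space n)
    else cvar t)"

definition I_ideal :: "nat \<Rightarrow> int list cpoly set" where
  "I_ideal n = rho1 n ` I_A n"

definition plucker_alg :: "nat \<Rightarrow> (complex, int list cpoly set) module" where
  "plucker_alg n = quot_alg (cpoly_alg (Theta n)) (I_ideal n)"

definition plucker_proj :: "nat \<Rightarrow> int list cpoly \<Rightarrow> int list cpoly set" where
  "plucker_proj n p = I_ideal n +>\<^bsub>cpoly_alg (Theta n)\<^esub> p"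

definition psi :: "nat \<Rightarrow> (int \<times> int) set \<Rightarrow> (int \<times> int) set cpoly \<Rightarrow> int list cpoly" where
  "psi n Q = cpoly_hom (\<lambda>J. X_tuple (map (w_ideal n Q J) [1..int (card (J \<inter> A_set n))]))"

text \<open>The products along weakly increasing chains; the empty chain gives \<open>1\<close>.\<close>

definition chain_products :: "nat \<Rightarrow> (int \<times> int) set \<Rightarrow> int list cpoly set" where
  "chain_products n Q =
    {prod_list (map (\<lambda>J. psi n Q (cvar J)) Js) | Js.
      set Js \<subseteq> order_ideals n - {{}} \<and> sorted_wrt (\<subseteq>) Js}"

end

theory Submission
  imports Defs
begin

text \<open>The symplectic Pluecker algebra is evaluated on a generic isotropic flag. For a suitable weighting
  of the free matrix entries, the minor with columns \<open>w\<^bsup>O,J\<^esup>(1), \<dots>, w\<^bsup>O,J\<^esup>(k)\<close> has a unique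
  monomial of lowest weight, namely the diagonal product. It records the maximum of every row of
  \<open>M\<^sub>O(J)\<close>, and the sum of these data along a chain determines the chain. Hence the products along
  chains are linearly independent for every \<open>O\<close>. For \<open>O = P\<close> they are the products over King's
  symplectic tableaux, which span by straightening. Since the chains do not depend on \<open>O\<close> and the
  multigraded components are finite-dimensional, the products are a basis for every \<open>O\<close>.\<close>

section \<open>Polynomial algebras\<close>

text \<open>The straightening used here is tied to King's order, that is to \<open>P_set n\<close>;
  for other \<open>Q\<close> spanning has to come from a count. The comparison is possible because
  \<open>w_perm\<close> factors into one cycle per row, and the cycles of \<open>Q\<close> and of
  \<open>M_set Q J\<close> agree on the pipes that matter: following the column w(i) of the tuple of
  J through the rows n, ..., i of \<open>Q\<close> ends at \<open>row_max J i\<close>. A row prefers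
  columns by the place at which their pipes enter it, which dictates the weights. Each row of the
  isotropic matrix also carries a scaling variable \<open>cvar (i, i)\<close>; its exponent counts
  the ideals containing (i, i) and so recovers how often w(i) = i, a case without a free entry. The
  ideal I is an image under \<open>rho1\<close>, whose values are definite descriptions. Their
  uniqueness is itself a consequence of the independence for \<open>P_set n\<close>, applied to
  products of one factor. Straightening then shows that I is exactly the kernel of
  \<open>isotropic_eval\<close> on the polynomials in admissible variables, so that questions about
  the quotient become linear algebra in a polynomial ring.\<close>

lemma cconst_0 [simp]: "cconst 0 = 0"
  by (simp add: cconst_def)

lemma cconst_add: "cconst (c + d) = cconst c + cconst d"
  by (simp add: cconst_def single_add)

lemma cconst_mult: "cconst (c * d) = cconst c * cconst d"
  by (simp add: cconst_def mult_single)

lemma cconst_sum: "cconst (sum f A) = (\<Sum>x\<in>A. cconst (f x))"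
  by (induction A rule: infinite_finite_induct) (simp_all add: cconst_add)

lemma cconst_of_int: "cconst (of_int k) = of_int k"
  by (simp add: cconst_def)

lemma lookup_cconst_mult:
  "Poly_Mapping.lookup (cconst c * p) m = c * Poly_Mapping.lookup p m"
  unfolding cconst_def mult_map_scale_conv_mult[symmetric]
  by (simp add: Poly_Mapping.map.rep_eq when_def)

text \<open>Gives access to the type-based \<open>span\<close> and independence;
  \<open>cspan_eq_span\<close> translates the carrier-based \<open>cspan\<close> of the definitions
  into it.\<close>

interpretation cp: vector_space "\<lambda>c (p :: 'v cpoly). cconst c * p"
  by unfold_locales (simp_all add: cconst_add cconst_mult cconst_one algebra_simps)

lemma of_int_mult_in_span: "p \<in> cp.span G \<Longrightarrow> of_int k * p \<in> cp.span G"
  using cp.span_scale[of p G "of_int k"] by (simp add: cconst_of_int)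

lemma cp_span_trans: "x \<in> cp.span A \<Longrightarrow> A \<subseteq> cp.span B \<Longrightarrow> x \<in> cp.span B"
  using cp.span_minimal[OF _ cp.subspace_span] by blast

lemma cp_span_mult_right:
  assumes "p \<in> cp.span G" "\<And>g. g \<in> G \<Longrightarrow> g * h \<in> cp.span H"
  shows "p * h \<in> cp.span H"
  using assms(1)
proof (induction rule: cp.span_induct_alt)
  case base
  then show ?case by (simp add: cp.span_zero)
next
  case (step c x y)
  have "(cconst c * x + y) * h = cconst c * (x * h) + y * h" by (simp add: algebra_simps)
  then show ?case using step assms(2) cp.span_add cp.span_scale by metis
qed

section \<open>Substitution homomorphisms\<close>

definition mon_eval :: "('v \<Rightarrow> 'w cpoly) \<Rightarrow> ('v \<Rightarrow>\<^sub>0 nat) \<Rightarrow> 'w cpoly" where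
  "mon_eval f m = (\<Prod>v \<in> Poly_Mapping.keys m. f v ^ Poly_Mapping.lookup m v)"

lemma mon_eval_superset:
  assumes "finite A" "Poly_Mapping.keys m \<subseteq> A"
  shows "mon_eval f m = (\<Prod>v \<in> A. f v ^ Poly_Mapping.lookup m v)"
  unfolding mon_eval_def using assms
  by (intro prod.mono_neutral_left) (auto simp: in_keys_iff)

lemma mon_eval_add: "mon_eval f (m + m') = mon_eval f m * mon_eval f m'"
proof -
  let ?A = "Poly_Mapping.keys m \<union> Poly_Mapping.keys m'"
  have "mon_eval f (m + m') = (\<Prod>v \<in> ?A. f v ^ Poly_Mapping.lookup (m + m') v)"
    by (rule mon_eval_superset) (auto simp: Poly_Mapping.keys_add)
  also have "\<dots> = (\<Prod>v \<in> ?A. f v ^ Poly_Mapping.lookup m v) * (\<Prod>v \<in> ?A. f v ^ Poly_Mapping.lookup m' v)"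
    by (simp add: lookup_add power_add prod.distrib)
  also have "\<dots> = mon_eval f m * mon_eval f m'"
    by (simp add: mon_eval_superset[of ?A])
  finally show ?thesis .
qed

lemma cpoly_hom_superset:
  assumes "finite A" "Poly_Mapping.keys p \<subseteq> A"
  shows "cpoly_hom f p = (\<Sum>m \<in> A. cconst (Poly_Mapping.lookup p m) * mon_eval f m)"
  unfolding cpoly_hom_def mon_eval_def[symmetric] using assms
  by (intro sum.mono_neutral_left) (auto simp: in_keys_iff)

lemma cpoly_hom_add: "cpoly_hom f (p + q) = cpoly_hom f p + cpoly_hom f q"
proof -
  let ?A = "Poly_Mapping.keys p \<union> Poly_Mapping.keys q"
  have "cpoly_hom f (p + q) = (\<Sum>m \<in> ?A. cconst (Poly_Mapping.lookup (p + q) m) * mon_eval f m)"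
    by (rule cpoly_hom_superset) (auto simp: Poly_Mapping.keys_add)
  also have "\<dots> = cpoly_hom f p + cpoly_hom f q"
    by (simp add: cpoly_hom_superset[of ?A] lookup_add cconst_add distrib_right sum.distrib)
  finally show ?thesis .
qed

lemma cpoly_hom_0: "cpoly_hom f 0 = 0"
  by (simp add: cpoly_hom_def)

lemma cpoly_hom_sum: "cpoly_hom f (sum g A) = (\<Sum>x\<in>A. cpoly_hom f (g x))"
  by (induction A rule: infinite_finite_induct) (simp_all add: cpoly_hom_add cpoly_hom_0)

lemma cpoly_hom_single: "cpoly_hom f (Poly_Mapping.single m c) = cconst c * mon_eval f m"
  by (subst cpoly_hom_superset[of "{m}"]) (auto simp: lookup_single)

lemma sum_single_keys:
  "p = (\<Sum>m \<in> Poly_Mapping.keys p. Poly_Mapping.single m (Poly_Mapping.lookup p m))"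
proof (rule poly_mapping_eqI)
  fix k
  show "Poly_Mapping.lookup p k = Poly_Mapping.lookup
    (\<Sum>m \<in> Poly_Mapping.keys p. Poly_Mapping.single m (Poly_Mapping.lookup p m)) k"
    by (cases "k \<in> Poly_Mapping.keys p")
      (auto simp: lookup_sum lookup_single when_def in_keys_iff if_distrib sum.delta' cong: if_cong)
qed

lemma cpoly_hom_mult: "cpoly_hom f (p * q) = cpoly_hom f p * cpoly_hom f q"
proof -
  let ?s = "\<lambda>p m. Poly_Mapping.single m (Poly_Mapping.lookup p m)"
  have "cpoly_hom f (p * q) = cpoly_hom f (sum (?s p) (Poly_Mapping.keys p) * sum (?s q) (Poly_Mapping.keys q))"
    by (simp flip: sum_single_keys)
  also have "\<dots> = (\<Sum>a\<in>Poly_Mapping.keys p. \<Sum>b\<in>Poly_Mapping.keys q. cpoly_hom f (?s p a * ?s q b))"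
    by (simp add: sum_product cpoly_hom_sum)
  also have "\<dots> = (\<Sum>a\<in>Poly_Mapping.keys p. \<Sum>b\<in>Poly_Mapping.keys q. cpoly_hom f (?s p a) * cpoly_hom f (?s q b))"
    by (simp add: mult_single cpoly_hom_single mon_eval_add cconst_mult mult.commute mult.left_commute)
  also have "\<dots> = cpoly_hom f (sum (?s p) (Poly_Mapping.keys p)) * cpoly_hom f (sum (?s q) (Poly_Mapping.keys q))"
    by (simp only: sum_product cpoly_hom_sum)
  finally show ?thesis by (simp flip: sum_single_keys)
qed

lemma mon_eval_0 [simp]: "mon_eval f 0 = 1"
  by (simp add: mon_eval_def)

lemma cpoly_hom_cconst: "cpoly_hom f (cconst c) = cconst c"
  using cpoly_hom_single[of f 0 c] by (simp add: cconst_def[symmetric])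

interpretation ph: comm_ring_hom "cpoly_hom f"
proof unfold_locales
  show "cpoly_hom f 1 = 1" using cpoly_hom_cconst[of f 1] by (simp add: cconst_one)
qed (simp_all add: cpoly_hom_add cpoly_hom_mult cpoly_hom_0)

lemma cpoly_hom_in_span:
  "p \<in> cp.span G \<Longrightarrow> cpoly_hom f p \<in> cp.span (cpoly_hom f ` G)"
proof (induction rule: cp.span_induct_alt)
  case base
  then show ?case by (simp add: cp.span_zero)
next
  case (step c x y)
  then show ?case
    by (simp add: cpoly_hom_add cpoly_hom_mult cpoly_hom_cconst cp.span_add cp.span_scale cp.span_base)
qed

lemma cpoly_hom_span_0:
  assumes "p \<in> cp.span G" "\<And>g. g \<in> G \<Longrightarrow> cpoly_hom f g = 0"
  shows "cpoly_hom f p = 0"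
proof -
  have "cpoly_hom f ` G \<subseteq> {0}" using assms(2) by auto
  from cp.span_mono[OF this] cpoly_hom_in_span[OF assms(1)] show ?thesis by auto
qed

lemma single_eq_mon_eval: "Poly_Mapping.single m c = cconst c * mon_eval cvar m"
proof -
  have pow: "cvar v ^ k = Poly_Mapping.single (Poly_Mapping.single v k) 1" for v :: 'a and k
    by (induction k) (simp_all add: cvar_def mult_single flip: single_add)
  have prod: "finite A \<Longrightarrow> (\<Prod>v \<in> A. Poly_Mapping.single (g v) (1::complex)) = Poly_Mapping.single (sum g A) 1"
    for g :: "'a \<Rightarrow> 'a \<Rightarrow>\<^sub>0 nat" and A
    by (induction A rule: finite_induct) (simp_all add: mult_single)
  have m: "m = (\<Sum>v\<in>Poly_Mapping.keys m. Poly_Mapping.single v (Poly_Mapping.lookup m v))"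
  proof (rule poly_mapping_eqI)
    fix k
    show "Poly_Mapping.lookup m k = Poly_Mapping.lookup
      (\<Sum>v\<in>Poly_Mapping.keys m. Poly_Mapping.single v (Poly_Mapping.lookup m v)) k"
      by (cases "k \<in> Poly_Mapping.keys m")
        (auto simp: lookup_sum lookup_single when_def in_keys_iff if_distrib sum.delta' cong: if_cong)
  qed
  have "mon_eval cvar m = Poly_Mapping.single m 1"
    unfolding mon_eval_def pow by (simp add: prod flip: m)
  then show ?thesis by (simp add: cconst_def mult_single)
qed

lemma cpoly_eq_sum_mon_eval:
  "p = (\<Sum>m \<in> Poly_Mapping.keys p. cconst (Poly_Mapping.lookup p m) * mon_eval cvar m)"
  using sum_single_keys[of p] by (simp add: single_eq_mon_eval)

lemma cpoly_hom_comp: "cpoly_hom f (cpoly_hom g p) = cpoly_hom (\<lambda>v. cpoly_hom f (g v)) p"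
  unfolding cpoly_hom_def[of g] cpoly_hom_sum cpoly_hom_mult cpoly_hom_cconst ph.hom_prod ph.hom_power
  by (simp add: cpoly_hom_def)

lemma cpoly_hom_cong:
  assumes "p \<in> carrier (cpoly_alg V)" "\<And>v. v \<in> V \<Longrightarrow> f v = g v"
  shows "cpoly_hom f p = cpoly_hom g p"
  unfolding cpoly_hom_def
proof (intro sum.cong refl arg_cong2[where f="(*)"] prod.cong)
  fix m v
  assume "m \<in> Poly_Mapping.keys p" "v \<in> Poly_Mapping.keys m"
  with assms(1) have "v \<in> V" by (auto simp: cpoly_alg_def)
  then show "f v ^ Poly_Mapping.lookup m v = g v ^ Poly_Mapping.lookup m v"
    using assms(2) by simp
qed

lemma cpoly_hom_cvar_id: "cpoly_hom cvar p = p"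
  using cpoly_eq_sum_mon_eval[of p] by (simp add: cpoly_hom_def mon_eval_def)

section \<open>Subalgebras generated by sets of variables\<close>

lemma cpoly_alg_add: "p \<in> carrier (cpoly_alg V) \<Longrightarrow> q \<in> carrier (cpoly_alg V) \<Longrightarrow> p + q \<in> carrier (cpoly_alg V)"
  using Poly_Mapping.keys_add[of p q] unfolding cpoly_alg_def by fastforce

lemma cpoly_alg_uminus: "p \<in> carrier (cpoly_alg V) \<Longrightarrow> - p \<in> carrier (cpoly_alg V)"
  by (simp add: cpoly_alg_def keys_uminus_cpoly)

lemma cpoly_alg_diff: "p \<in> carrier (cpoly_alg V) \<Longrightarrow> q \<in> carrier (cpoly_alg V) \<Longrightarrow> p - q \<in> carrier (cpoly_alg V)"
  using cpoly_alg_add[of p V "- q"] cpoly_alg_uminus[of q V] by simp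

lemma cpoly_alg_mult:
  assumes "p \<in> carrier (cpoly_alg V)" "q \<in> carrier (cpoly_alg V)"
  shows "p * q \<in> carrier (cpoly_alg V)"
proof -
  have "Poly_Mapping.keys m \<subseteq> V" if "m \<in> Poly_Mapping.keys (p * q)" for m
  proof -
    from that Poly_Mapping.keys_mult[of p q] obtain a b
      where "m = a + b" "a \<in> Poly_Mapping.keys p" "b \<in> Poly_Mapping.keys q" by blast
    then show ?thesis using assms Poly_Mapping.keys_add[of a b] by (fastforce simp: cpoly_alg_def)
  qed
  then show ?thesis by (simp add: cpoly_alg_def)
qed

lemma cpoly_alg_cconst [simp]: "cconst c \<in> carrier (cpoly_alg V)"
  by (simp add: cpoly_alg_def cconst_def)

lemma cpoly_alg_0 [simp]: "0 \<in> carrier (cpoly_alg V)"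
  by (simp add: cpoly_alg_def)

lemma cpoly_alg_1 [simp]: "1 \<in> carrier (cpoly_alg V)"
  by (simp add: cpoly_alg_def)

lemma cpoly_alg_cvar: "v \<in> V \<Longrightarrow> cvar v \<in> carrier (cpoly_alg V)"
  by (simp add: cpoly_alg_def cvar_def)

lemma cpoly_alg_of_int [simp]: "of_int k \<in> carrier (cpoly_alg V)"
  using cpoly_alg_cconst[of "of_int k" V] by (simp add: cconst_of_int)

lemma cpoly_alg_sum: "(\<And>x. x \<in> A \<Longrightarrow> f x \<in> carrier (cpoly_alg V)) \<Longrightarrow> sum f A \<in> carrier (cpoly_alg V)"
  by (induction A rule: infinite_finite_induct) (simp_all add: cpoly_alg_add)

lemma cpoly_alg_prod: "(\<And>x. x \<in> A \<Longrightarrow> f x \<in> carrier (cpoly_alg V)) \<Longrightarrow> prod f A \<in> carrier (cpoly_alg V)"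
  by (induction A rule: infinite_finite_induct) (simp_all add: cpoly_alg_mult)

lemma cpoly_alg_prod_list:
  "(\<And>x. x \<in> set xs \<Longrightarrow> f x \<in> carrier (cpoly_alg V)) \<Longrightarrow> prod_list (map f xs) \<in> carrier (cpoly_alg V)"
  by (induction xs) (simp_all add: cpoly_alg_mult)

lemma cpoly_alg_power: "p \<in> carrier (cpoly_alg V) \<Longrightarrow> p ^ k \<in> carrier (cpoly_alg V)"
  by (induction k) (simp_all add: cpoly_alg_mult)

lemma cpoly_alg_mono: "V \<subseteq> W \<Longrightarrow> carrier (cpoly_alg V) \<subseteq> carrier (cpoly_alg W)"
  by (auto simp: cpoly_alg_def)

lemma cpoly_alg_span: "G \<subseteq> carrier (cpoly_alg V) \<Longrightarrow> cp.span G \<subseteq> carrier (cpoly_alg V)"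
  by (rule cp.span_minimal)
    (auto intro!: cp.subspaceI cpoly_alg_add cpoly_alg_mult)

lemma cpoly_hom_carrier:
  assumes "p \<in> carrier (cpoly_alg V)" "\<And>v. v \<in> V \<Longrightarrow> f v \<in> carrier (cpoly_alg W)"
  shows "cpoly_hom f p \<in> carrier (cpoly_alg W)"
  unfolding cpoly_hom_def
  using assms(1) by (intro cpoly_alg_sum cpoly_alg_mult cpoly_alg_cconst cpoly_alg_prod
      cpoly_alg_power assms(2)) (auto simp: cpoly_alg_def)

lemma cpoly_alg_simps [simp]:
  "\<one>\<^bsub>cpoly_alg V\<^esub> = 1" "\<zero>\<^bsub>cpoly_alg V\<^esub> = 0"
  "p \<otimes>\<^bsub>cpoly_alg V\<^esub> q = p * q" "p \<oplus>\<^bsub>cpoly_alg V\<^esub> q = p + q"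
  "c \<odot>\<^bsub>cpoly_alg V\<^esub> p = cconst c * p"
  by (simp_all add: cpoly_alg_def)

lemma cring_cpoly_alg: "cring (cpoly_alg V)"
proof -
  interpret vectorspace "class_ring :: complex ring" "cpoly_alg V"
    by (rule vectorspace_cpoly_alg)
  show ?thesis
  proof (rule cringI)
    show "abelian_group (cpoly_alg V)" by (rule abelian_group_axioms)
    show "comm_monoid (cpoly_alg V)"
      by (rule comm_monoidI) (simp_all add: cpoly_alg_mult ac_simps)
  qed (simp add: distrib_right)
qed

lemma cpoly_alg_finsum:
  assumes "finite A" "\<And>x. x \<in> A \<Longrightarrow> f x \<in> carrier (cpoly_alg V)"
  shows "finsum (cpoly_alg V) f A = sum f A"
proof -
  interpret cring "cpoly_alg V" by (rule cring_cpoly_alg)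
  show ?thesis using assms
  proof (induction A rule: finite_induct)
    case empty
    show ?case by (simp only: finsum_empty cpoly_alg_simps sum.empty)
  next
    case (insert x A)
    have fx: "f x \<in> carrier (cpoly_alg V)" and fA: "f \<in> A \<rightarrow> carrier (cpoly_alg V)"
      using insert.prems by auto
    have "finsum (cpoly_alg V) f A = sum f A"
      using insert.IH insert.prems by blast
    then show ?case
      by (simp only: finsum_insert[OF insert.hyps fA fx] cpoly_alg_simps
          sum.insert[OF insert.hyps])
  qed
qed

lemma cspan_eq_span:
  assumes "G \<subseteq> carrier (cpoly_alg V)"
  shows "cspan V G = cp.span G"
proof -
  interpret vectorspace "class_ring :: complex ring" "cpoly_alg V"
    by (rule vectorspace_cpoly_alg)
  have lc: "lincomb a A = (\<Sum>v\<in>A. cconst (a v) * v)" if A: "finite A" "A \<subseteq> G" for a A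
  proof -
    have "cconst (a v) * v \<in> carrier (cpoly_alg V)" if "v \<in> A" for v
      by (rule cpoly_alg_mult) (use that A assms in auto)
    then show ?thesis
      unfolding lincomb_def cpoly_alg_simps by (rule cpoly_alg_finsum[OF A(1)])
  qed
  show ?thesis
  proof (rule Set.equalityI; rule Set.subsetI)
    fix p assume "p \<in> span G"
    then obtain a A where A: "finite A" "A \<subseteq> G" and p: "p = lincomb a A"
      unfolding span_def by blast
    have "(\<Sum>v\<in>A. cconst (a v) * v) \<in> cp.span G"
      using A(2) by (intro cp.span_sum cp.span_scale cp.span_base) blast
    then show "p \<in> cp.span G" using p lc[OF A] by simp
  next
    fix p assume "p \<in> cp.span G"
    then obtain a A where A: "finite A" "A \<subseteq> G" and p: "p = (\<Sum>v\<in>A. cconst (a v) * v)"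
      unfolding cp.span_explicit by blast
    have "p = lincomb a A" using p lc[OF A] by simp
    moreover have "a \<in> A \<rightarrow> carrier class_ring" by simp
    ultimately show "p \<in> span G"
      unfolding span_def using A by blast
  qed
qed

section \<open>Minors and alternating variables\<close>

text \<open>Uses that the coefficients have characteristic 0. A sign-reversing symmetry of a sum
  thereby makes the sum vanish.\<close>

lemma cpoly_self_uminus: "p = - p \<Longrightarrow> p = (0 :: 'v cpoly)"
proof (rule poly_mapping_eqI)
  fix m
  assume "p = - p"
  then have "Poly_Mapping.lookup p m = - Poly_Mapping.lookup p m"
    by (metis lookup_uminus)
  then show "Poly_Mapping.lookup p m = Poly_Mapping.lookup 0 m" by simp
qed

text \<open>The matrix \<open>M\<close> is left open: \<open>cvar\<close> gives the generic minors
  behind \<open>I_A\<close>, and \<open>isotropic_matrix n\<close> gives those of the isotropic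
  flag.\<close>

definition minor :: "(int \<times> int \<Rightarrow> 'w cpoly) \<Rightarrow> int list \<Rightarrow> 'w cpoly" where
  "minor M t = Determinant.det (mat (length t) (length t) (\<lambda>(r, c). M (int r + 1, t ! c)))"

text \<open>Expansion by columns: \<open>p\<close> assigns the row with index \<open>p j\<close> to
  the column with index \<open>j\<close>. Later arguments compare such assignments.\<close>

lemma minor_leibniz:
  "minor M t = (\<Sum>p | p permutes {..<length t}.
     of_int (sign p) * (\<Prod>j<length t. M (int (p j) + 1, t ! j)))"
proof -
  have "p j < length t" if "p permutes {0..<length t}" "j < length t" for p j
    using permutes_in_image[OF that(1), of j] that(2) by simp
  then show ?thesis
    unfolding minor_def by (subst det_col[of _ "length t"]) (auto simp: atLeast0LessThan intro!: sum.cong)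
qed

lemma minor_permute:
  assumes \<sigma>: "\<sigma> permutes {..<length t}"
  shows "minor M (permute_list \<sigma> t) = of_int (sign \<sigma>) * minor M t"
proof -
  let ?P = "{p. p permutes {..<length t}}"
  have "minor M (permute_list \<sigma> t) =
      (\<Sum>p\<in>?P. of_int (sign p) * (\<Prod>j<length t. M (int (p j) + 1, t ! \<sigma> j)))"
    by (simp add: minor_leibniz permute_list_nth[OF \<sigma>])
  also have "\<dots> = (\<Sum>p\<in>?P. of_int (sign (p \<circ> \<sigma>)) * (\<Prod>j<length t. M (int ((p \<circ> \<sigma>) j) + 1, t ! \<sigma> j)))"
    by (rule sum_permutations_compose_right[OF \<sigma>])
  also have "\<dots> = (\<Sum>p\<in>?P. of_int (sign \<sigma>) * (of_int (sign p) * (\<Prod>j<length t. M (int (p j) + 1, t ! j))))"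
  proof (intro sum.cong refl)
    fix p assume "p \<in> ?P"
    then have p: "p permutes {..<length t}" by simp
    have "permutation p" "permutation \<sigma>"
      using p \<sigma> finite_lessThan permutation_permutes by blast+
    then have "sign (p \<circ> \<sigma>) = sign \<sigma> * sign p" by (simp add: sign_compose)
    moreover have "(\<Prod>j<length t. M (int (p j) + 1, t ! j))
        = (\<Prod>j<length t. M (int ((p \<circ> \<sigma>) j) + 1, t ! \<sigma> j))"
      using prod.permute[OF \<sigma>, of "\<lambda>j. M (int (p j) + 1, t ! j)"] by (simp add: o_def)
    ultimately show "of_int (sign (p \<circ> \<sigma>)) * (\<Prod>j<length t. M (int ((p \<circ> \<sigma>) j) + 1, t ! \<sigma> j)) =
        of_int (sign \<sigma>) * (of_int (sign p) * (\<Prod>j<length t. M (int (p j) + 1, t ! j)))"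
      by (simp add: mult.assoc)
  qed
  also have "\<dots> = of_int (sign \<sigma>) * minor M t"
    by (simp add: minor_leibniz sum_distrib_left)
  finally show ?thesis .
qed

lemma permute_transpose_same:
  assumes "i < length t" "j < length t" "t ! i = t ! j"
  shows "permute_list (Transposition.transpose i j) t = t"
proof (rule nth_equalityI)
  have p: "Transposition.transpose i j permutes {..<length t}"
    using assms by (intro permutes_swap_id) auto
  show "permute_list (Transposition.transpose i j) t ! l = t ! l"
    if "l < length (permute_list (Transposition.transpose i j) t)" for l
    using that assms by (simp add: permute_list_nth[OF p]) (auto simp: transpose_def)
qed simp

lemma minor_not_distinct:
  assumes "\<not> distinct t"
  shows "minor M t = 0"
proof -
  from assms obtain i j where ij: "i < length t" "j < length t" "i \<noteq> j" "t ! i = t ! j"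
    by (auto simp: distinct_conv_nth)
  have p: "Transposition.transpose i j permutes {..<length t}"
    using ij by (intro permutes_swap_id) auto
  have "minor M t = - minor M t"
    using minor_permute[OF p, of M] ij
    by (simp add: permute_transpose_same sign_swap_id)
  then show ?thesis by (rule cpoly_self_uminus)
qed

lemma (in comm_ring_hom) hom_det_mat:
  "hom (Determinant.det (mat k k f)) = Determinant.det (mat k k (\<lambda>x. hom (f x)))"
proof -
  have "map_mat hom (mat k k f) = mat k k (\<lambda>x. hom (f x))"
    by (rule eq_matI) auto
  then show ?thesis using hom_det[of "mat k k f"] by simp
qed

lemma cpoly_hom_minor: "cpoly_hom f (minor M t) = minor (\<lambda>x. cpoly_hom f (M x)) t"
  unfolding minor_def ph.hom_det_mat by (simp add: case_prod_unfold)

lemma minor_map_eq: "minor_map = cpoly_hom (minor cvar)"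
  by (simp add: minor_map_def minor_def[abs_def])

text \<open>Every matrix is a specialization of the generic one, so relations among generic minors
  hold among the minors of any matrix \<open>f\<close>.\<close>

lemma cpoly_hom_minor_map: "cpoly_hom f (minor_map p) = cpoly_hom (minor f) p"
  by (simp add: minor_map_eq cpoly_hom_comp cpoly_hom_minor cpoly_hom_cvar)

section \<open>Positions in the order of N, and variables with arbitrary subscripts\<close>

definition pos :: "nat \<Rightarrow> int \<Rightarrow> int" where
  "pos n j = (if 0 < j then j else 2 * int n + 1 + j)"

lemma N_less_iff_pos: "i \<in> N_set n \<Longrightarrow> j \<in> N_set n \<Longrightarrow> N_less i j \<longleftrightarrow> pos n i < pos n j"
  by (auto simp: N_set_def N_less_def pos_def)

lemma inj_on_pos: "inj_on (pos n) (N_set n)"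
  by (auto simp: N_set_def pos_def inj_on_def split: if_splits)

lemma finite_N_set [simp]: "finite (N_set n)"
  by (simp add: N_set_def)

lemma sorted_N_less_iff:
  assumes "set t \<subseteq> N_set n"
  shows "sorted_wrt N_less t \<longleftrightarrow> sorted (map (pos n) t) \<and> distinct t"
proof -
  have "sorted_wrt N_less t \<longleftrightarrow> sorted_wrt (\<lambda>i j. pos n i < pos n j) t"
  proof -
    have "N_less (t ! i) (t ! j) \<longleftrightarrow> pos n (t ! i) < pos n (t ! j)" if "i < j" "j < length t" for i j
      using that assms by (intro N_less_iff_pos) (auto simp: subset_iff)
    then show ?thesis unfolding sorted_wrt_iff_nth_less by blast
  qed
  also have "\<dots> \<longleftrightarrow> sorted (map (pos n) t) \<and> distinct (map (pos n) t)"
    by (simp add: strict_sorted_iff flip: sorted_wrt_map)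
  also have "distinct (map (pos n) t) \<longleftrightarrow> distinct t"
    using assms inj_on_pos[of n] by (metis distinct_map inj_on_subset)
  finally show ?thesis .
qed

lemma sorted_N_less_unique:
  assumes "set s = set t" "set t \<subseteq> N_set n" "sorted_wrt N_less s" "sorted_wrt N_less t"
  shows "s = t"
proof -
  have inj: "inj_on (pos n) (set t)" using assms(2) inj_on_pos inj_on_subset by blast
  have s: "sorted (map (pos n) s)" "distinct s"
    using sorted_N_less_iff[of s n] assms by auto
  have t: "sorted (map (pos n) t)" "distinct t"
    using sorted_N_less_iff[of t n] assms by auto
  have "map (pos n) s = map (pos n) t"
    by (rule sorted_distinct_set_unique) (use s t inj assms(1) in \<open>simp_all add: distinct_map\<close>)
  then show ?thesis
    using inj assms(1) inj_on_map_eq_map[of "pos n" s t] by simp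
qed

lemma permute_list_inj:
  assumes "distinct t" "\<sigma> permutes {..<length t}" "\<tau> permutes {..<length t}"
    "permute_list \<sigma> t = permute_list \<tau> t"
  shows "\<sigma> = \<tau>"
proof
  fix i
  show "\<sigma> i = \<tau> i"
  proof (cases "i < length t")
    case True
    then have "\<sigma> i < length t" "\<tau> i < length t"
      using permutes_in_image[OF assms(2), of i] permutes_in_image[OF assms(3), of i] by simp_all
    moreover have "t ! \<sigma> i = t ! \<tau> i"
      using permute_list_nth[OF assms(2) True] permute_list_nth[OF assms(3) True] assms(4) by simp
    ultimately show ?thesis using assms(1) nth_eq_iff_index_eq by blast
  next
    case False
    then show ?thesis using assms(2,3) by (simp add: permutes_not_in)
  qed
qed

text \<open>A tuple without repetitions has only one sorting permutation, which resolves the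
  definite description in \<open>X_tuple\<close>.\<close>

lemma X_tuple_eq:
  assumes t: "distinct t" "set t \<subseteq> N_set n"
    and \<sigma>: "\<sigma> permutes {..<length t}" "sorted_wrt N_less (permute_list \<sigma> t)"
  shows "X_tuple t = of_int (sign \<sigma>) * cvar (permute_list \<sigma> t)"
proof -
  have "(THE \<sigma>. \<sigma> permutes {..<length t} \<and> sorted_wrt N_less (permute_list \<sigma> t)) = \<sigma>"
  proof (rule the_equality)
    fix \<tau> assume \<tau>: "\<tau> permutes {..<length t} \<and> sorted_wrt N_less (permute_list \<tau> t)"
    then have "permute_list \<tau> t = permute_list \<sigma> t"
      using t \<sigma> by (intro sorted_N_less_unique[of _ _ n]) simp_all
    then show "\<tau> = \<sigma>" using t \<sigma> \<tau> permute_list_inj by blast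
  qed (use \<sigma> in simp)
  then show ?thesis using t by (simp add: X_tuple_def)
qed

lemma X_tuple_sorted:
  assumes "set t \<subseteq> N_set n" "sorted_wrt N_less t"
  shows "X_tuple t = cvar t"
  using assms X_tuple_eq[of t n id] by (simp add: sorted_N_less_iff permutes_id)

lemma sorting_permutation:
  assumes "distinct t" "set t \<subseteq> N_set n"
  obtains \<sigma> where "\<sigma> permutes {..<length t}" "sorted_wrt N_less (permute_list \<sigma> t)"
proof -
  have "mset (sort_key (pos n) t) = mset t" by simp
  then obtain \<sigma> where \<sigma>: "\<sigma> permutes {..<length t}" "permute_list \<sigma> t = sort_key (pos n) t"
    by (rule mset_eq_permutation)
  have "sorted_wrt N_less (sort_key (pos n) t)"
    using assms by (subst sorted_N_less_iff[of _ n]) simp_all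
  then show thesis using that[OF \<sigma>(1)] \<sigma>(2) by simp
qed

lemma X_tuple_permute:
  assumes t: "set t \<subseteq> N_set n" and \<sigma>: "\<sigma> permutes {..<length t}"
  shows "X_tuple (permute_list \<sigma> t) = of_int (sign \<sigma>) * X_tuple t"
proof (cases "distinct t")
  case True
  obtain \<rho> where \<rho>: "\<rho> permutes {..<length t}" "sorted_wrt N_less (permute_list \<rho> (permute_list \<sigma> t))"
    using sorting_permutation[of "permute_list \<sigma> t" n] True t \<sigma> by auto
  have comp: "permute_list (\<sigma> \<circ> \<rho>) t = permute_list \<rho> (permute_list \<sigma> t)"
    using \<rho>(1) by (rule permute_list_compose)
  have "permutation \<rho>" "permutation \<sigma>"
    using \<rho>(1) \<sigma> finite_lessThan permutation_permutes by blast+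
  then have s: "sign \<rho> = sign \<sigma> * sign (\<sigma> \<circ> \<rho>)"
    by (simp add: sign_compose flip: mult.assoc)
  have 1: "X_tuple (permute_list \<sigma> t) = of_int (sign \<rho>) * cvar (permute_list (\<sigma> \<circ> \<rho>) t)"
    unfolding comp using True t \<sigma> \<rho> by (intro X_tuple_eq[of _ n]) simp_all
  have 2: "X_tuple t = of_int (sign (\<sigma> \<circ> \<rho>)) * cvar (permute_list (\<sigma> \<circ> \<rho>) t)"
    using True t \<sigma> \<rho> by (intro X_tuple_eq[of _ n]) (simp_all add: comp permutes_compose)
  show ?thesis unfolding 1 2 s by (simp add: mult.assoc)
next
  case False
  then show ?thesis using \<sigma> by (simp add: X_tuple_def)
qed

lemma sign_eq: "sign p = 1 \<or> sign p = - 1"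
  by (simp add: sign_def)

lemma X_tuple_cases:
  assumes "set t \<subseteq> N_set n" "distinct t"
  obtains s e where "sorted_wrt N_less s" "set s = set t" "length s = length t"
    "e = 1 \<or> e = -1" "X_tuple t = of_int e * cvar s"
proof -
  from sorting_permutation[OF assms(2,1)] obtain \<sigma>
    where \<sigma>: "\<sigma> permutes {..<length t}" "sorted_wrt N_less (permute_list \<sigma> t)" .
  show thesis
    by (rule that[of "permute_list \<sigma> t" "sign \<sigma>"])
      (use \<sigma> X_tuple_eq[OF assms(2,1) \<sigma>] sign_eq in auto)
qed

text \<open>Both sides are alternating in \<open>t\<close>, and for increasing \<open>t\<close> the
  variable is sent to the minor by definition.\<close>

lemma cpoly_hom_X_tuple:
  assumes "set t \<subseteq> N_set n"
  shows "cpoly_hom (minor M) (X_tuple t) = minor M t"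
proof (cases "distinct t")
  case True
  from sorting_permutation[OF True assms] obtain \<sigma>
    where \<sigma>: "\<sigma> permutes {..<length t}" "sorted_wrt N_less (permute_list \<sigma> t)" .
  have "cpoly_hom (minor M) (X_tuple t) = of_int (sign \<sigma>) * minor M (permute_list \<sigma> t)"
    by (simp add: X_tuple_eq[OF True assms \<sigma>] cpoly_hom_mult cpoly_hom_cvar ph.hom_of_int)
  also have "\<dots> = minor M t"
    by (simp add: minor_permute[OF \<sigma>(1)] flip: mult.assoc of_int_mult)
  finally show ?thesis .
next
  case False
  then show ?thesis by (simp add: X_tuple_def minor_not_distinct cpoly_hom_0)
qed

lemma X_tuple_carrier:
  assumes "set t \<subseteq> N_set n" "1 \<le> length t" "length t \<le> n"
  shows "X_tuple t \<in> carrier (cpoly_alg (S_vars n))"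
proof (cases "distinct t")
  case True
  from X_tuple_cases[OF assms(1) True] obtain s e where s: "sorted_wrt N_less s" "set s = set t"
    "length s = length t" "e = 1 \<or> e = -1" "X_tuple t = of_int e * cvar s" .
  then have "cvar s \<in> carrier (cpoly_alg (S_vars n))"
    using assms by (intro cpoly_alg_cvar) (simp add: S_vars_def)
  then show ?thesis unfolding s(5) by (rule cpoly_alg_mult[OF cpoly_alg_of_int])
next
  case False
  then show ?thesis by (simp add: X_tuple_def)
qed

lemma permute_middle:
  assumes "i < length x" "j < length x"
  shows "a @ permute_list (Transposition.transpose i j) x @ b =
    permute_list (Transposition.transpose (length a + i) (length a + j)) (a @ x @ b)" (is "?l = ?r")
proof (rule nth_equalityI)
  have p: "Transposition.transpose i j permutes {..<length x}"
    using assms by (intro permutes_swap_id) auto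
  have q: "Transposition.transpose (length a + i) (length a + j) permutes {..<length (a @ x @ b)}"
    using assms by (intro permutes_swap_id) auto
  fix l assume "l < length ?l"
  then have l: "l < length (a @ x @ b)" by simp
  show "?l ! l = ?r ! l"
    unfolding permute_list_nth[OF q l]
    using l assms by (auto simp: nth_append transpose_def permute_list_nth[OF p] split: if_splits)
qed simp

text \<open>Induction over transpositions avoids constructing the permutation of the whole tuple
  that acts as \<open>\<sigma>\<close> on the middle block.\<close>

lemma X_tuple_permute_middle:
  assumes \<sigma>: "\<sigma> permutes {..<k}" and "length x = k" "set a \<union> set x \<union> set b \<subseteq> N_set n"
  shows "X_tuple (a @ permute_list \<sigma> x @ b) = of_int (sign \<sigma>) * X_tuple (a @ x @ b)"
  using \<sigma> finite_lessThan assms(2,3)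
proof (induction arbitrary: x rule: permutes_induct)
  case id
  then show ?case by simp
next
  case (swap i j p)
  let ?\<tau> = "Transposition.transpose i j" and ?\<tau>' = "Transposition.transpose (length a + i) (length a + j)"
  have ij: "i < length x" "j < length x" using swap by auto
  have \<tau>: "?\<tau> permutes {..<length x}" using ij by (intro permutes_swap_id) auto
  have \<tau>': "?\<tau>' permutes {..<length (a @ x @ b)}" using ij by (intro permutes_swap_id) auto
  have "permutation p" using swap.hyps finite_lessThan permutation_permutes by blast
  then have s: "sign (?\<tau> \<circ> p) = - sign p"
    using swap.hyps by (simp add: sign_compose permutation_swap_id sign_swap_id)
  have 1: "permute_list (?\<tau> \<circ> p) x = permute_list p (permute_list ?\<tau> x)"
    using swap by (intro permute_list_compose) simp
  have 2: "X_tuple (a @ permute_list p (permute_list ?\<tau> x) @ b) =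
      of_int (sign p) * X_tuple (a @ permute_list ?\<tau> x @ b)"
    using swap.prems \<tau> by (intro swap.IH) simp_all
  have 3: "X_tuple (a @ permute_list ?\<tau> x @ b) = of_int (sign ?\<tau>') * X_tuple (a @ x @ b)"
    unfolding permute_middle[OF ij] using swap.prems \<tau>' by (intro X_tuple_permute[of _ n]) simp_all
  have 4: "sign ?\<tau>' = -1" using swap.hyps by (simp add: sign_swap_id)
  show ?case unfolding 1 2 3 4 s by simp
qed

text \<open>The sign \<open>e\<close> is chosen before \<open>b\<close>. This uniformity allows a
  common sign to be taken out of a sum over different endings, as in
  \<open>omega_sum_in_L_space\<close>.\<close>

lemma X_tuple_mset_middle:
  assumes "mset x = mset y" "set a \<union> set x \<subseteq> N_set n"
  shows "\<exists>e. (e = 1 \<or> e = -1) \<and>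
    (\<forall>b. set b \<subseteq> N_set n \<longrightarrow> X_tuple (a @ x @ b) = of_int e * X_tuple (a @ y @ b))"
proof -
  from mset_eq_permutation[OF assms(1)] obtain \<sigma>
    where \<sigma>: "\<sigma> permutes {..<length y}" "permute_list \<sigma> y = x" .
  have "set x = set y" using assms(1) by (rule mset_eq_setD)
  with assms(2) have sets: "set a \<union> set y \<union> set b \<subseteq> N_set n" if "set b \<subseteq> N_set n" for b
    using that by auto
  show ?thesis
    using sign_eq X_tuple_permute_middle[OF \<sigma>(1) refl sets, unfolded \<sigma>(2)] by blast
qed

section \<open>Relations satisfied by the minors of isotropic matrices\<close>

text \<open>Composition with the transposition pairs up the permutations; partners have opposite
  signs and equal values of \<open>f\<close>.\<close>

lemma sum_permutes_uminus:
  fixes f :: "(nat \<Rightarrow> nat) \<Rightarrow> 'v cpoly"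
  assumes ij: "i < m" "j < m" "i \<noteq> j"
    and f: "\<And>p. p permutes {..<m} \<Longrightarrow> f (p \<circ> Transposition.transpose i j) = f p"
  shows "(\<Sum>p | p permutes {..<m}. of_int (sign p) * f p) = 0"
proof (rule cpoly_self_uminus)
  let ?\<tau> = "Transposition.transpose i j"
  have \<tau>: "?\<tau> permutes {..<m}" using ij by (intro permutes_swap_id) auto
  have "(\<Sum>p | p permutes {..<m}. of_int (sign p) * f p) =
      (\<Sum>p | p permutes {..<m}. of_int (sign (p \<circ> ?\<tau>)) * f (p \<circ> ?\<tau>))"
    by (rule sum_permutations_compose_right[OF \<tau>])
  also have "\<dots> = (\<Sum>p | p permutes {..<m}. - (of_int (sign p) * f p))"
  proof (intro sum.cong refl)
    fix p assume "p \<in> {p. p permutes {..<m}}"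
    then have p: "p permutes {..<m}" by simp
    then have "permutation p" using finite_lessThan permutation_permutes by blast
    then have "sign (p \<circ> ?\<tau>) = - sign p"
      using ij by (simp add: sign_compose permutation_swap_id sign_swap_id)
    then show "of_int (sign (p \<circ> ?\<tau>)) * f (p \<circ> ?\<tau>) = - (of_int (sign p) * f p)"
      unfolding f[OF p] by simp
  qed
  also have "\<dots> = - (\<Sum>p | p permutes {..<m}. of_int (sign p) * f p)"
    by (rule sum_negf)
  finally show "(\<Sum>p | p permutes {..<m}. of_int (sign p) * f p) =
    - (\<Sum>p | p permutes {..<m}. of_int (sign p) * f p)" .
qed

lemma prod_lessThan_add:
  fixes f :: "nat \<Rightarrow> 'a :: comm_monoid_mult"
  shows "(\<Prod>j<a + q. f j) = (\<Prod>j<a. f j) * (\<Prod>j<q. f (a + j))"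
  by (induction q) (simp_all add: mult.assoc)

text \<open>Isotropy of the rows says that the form B(a, b), the sum of M(a, l) M(b, -l) over l, is
  symmetric. After summation over l the last two columns enter the expansion only through B, so
  exchanging their rows keeps each product and reverses its sign.\<close>

lemma minor_contract_isotropic:
  assumes iso: "\<And>a b. a \<in> {1..int n} \<Longrightarrow> b \<in> {1..int n} \<Longrightarrow>
      (\<Sum>l=1..int n. M (a, l) * M (b, - l)) = (\<Sum>l=1..int n. M (b, l) * M (a, - l))"
    and len: "length t + 2 \<le> n"
  shows "(\<Sum>l=1..int n. minor M (t @ [l, - l])) = 0"
proof -
  let ?k = "length t"
  let ?B = "\<lambda>a b. \<Sum>l=1..int n. M (a, l) * M (b, - l)"
  let ?f = "\<lambda>p. (\<Prod>j<?k. M (int (p j) + 1, t ! j)) * ?B (int (p ?k) + 1) (int (p (Suc ?k)) + 1)"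
  let ?\<tau> = "Transposition.transpose ?k (Suc ?k)"
  have "(\<Sum>l=1..int n. minor M (t @ [l, - l])) =
      (\<Sum>l=1..int n. \<Sum>p | p permutes {..<Suc (Suc ?k)}. of_int (sign p) *
        ((\<Prod>j<?k. M (int (p j) + 1, t ! j)) * (M (int (p ?k) + 1, l) * M (int (p (Suc ?k)) + 1, - l))))"
    unfolding minor_leibniz by (simp add: nth_append mult.assoc)
  also have "\<dots> = (\<Sum>p | p permutes {..<Suc (Suc ?k)}. of_int (sign p) * ?f p)"
    by (subst sum.swap) (simp add: sum_distrib_left)
  also have "\<dots> = 0"
  proof (rule sum_permutes_uminus[where i = ?k and j = "Suc ?k"])
    fix p assume p: "p permutes {..<Suc (Suc ?k)}"
    have "p i < Suc (Suc ?k)" if "i < Suc (Suc ?k)" for i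
      using permutes_in_image[OF p, of i] that by simp
    from this[of ?k] this[of "Suc ?k"]
    have "?B (int (p (Suc ?k)) + 1) (int (p ?k) + 1) = ?B (int (p ?k) + 1) (int (p (Suc ?k)) + 1)"
      using len by (intro iso) auto
    moreover have "(\<Prod>j<?k. M (int (p (?\<tau> j)) + 1, t ! j)) = (\<Prod>j<?k. M (int (p j) + 1, t ! j))"
      by (intro prod.cong) (auto simp: transpose_def)
    ultimately show "?f (p \<circ> ?\<tau>) = ?f p" by simp
  qed auto
  finally show ?thesis .
qed

text \<open>This is the Garnir form of the Pluecker relations: antisymmetrizing over more columns
  than the larger minor has rows forces two of these columns into the same row.\<close>

lemma minor_exchange:
  assumes v: "length v = Suc (length a + q)"
    and b: "length v - q + length b \<le> length a + q"
  shows "(\<Sum>\<sigma> | \<sigma> permutes {..<length v}. of_int (sign \<sigma>) *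
    (minor M (a @ take q (permute_list \<sigma> v)) * minor M (drop q (permute_list \<sigma> v) @ b))) = 0"
proof -
  have q: "q \<le> length v" using v by simp
  then obtain r where r: "length v = q + r" by (rule le_Suc_ex[THEN exE])
  let ?K = "length a + q" and ?r = r
  let ?P = "{p. p permutes {..<?K}}" and ?P' = "{p. p permutes {..<?r + length b}}"
  let ?A = "\<lambda>p. of_int (sign p) * (\<Prod>j<length a. M (int (p j) + 1, a ! j))"
  let ?B = "\<lambda>p. of_int (sign p) * (\<Prod>j<length b. M (int (p (?r + j)) + 1, b ! j))"
  let ?h = "\<lambda>p p' i. if i < q then p (length a + i) else p' (i - q)"
  let ?C = "\<lambda>p p' \<sigma>. \<Prod>j<length v. M (int (?h p p' j) + 1, v ! \<sigma> j)"
  have expand: "minor M (a @ take q (permute_list \<sigma> v)) * minor M (drop q (permute_list \<sigma> v) @ b) =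
      (\<Sum>p\<in>?P. \<Sum>p'\<in>?P'. ?A p * ?B p' * ?C p p' \<sigma>)" if \<sigma>: "\<sigma> permutes {..<length v}" for \<sigma>
  proof -
    have "minor M (a @ take q (permute_list \<sigma> v)) =
        (\<Sum>p\<in>?P. ?A p * (\<Prod>j<q. M (int (p (length a + j)) + 1, v ! \<sigma> j)))"
      unfolding minor_leibniz using q
      by (simp add: min_absorb2 prod_lessThan_add nth_append permute_list_nth[OF \<sigma>] mult.assoc)
    moreover have "minor M (drop q (permute_list \<sigma> v) @ b) =
        (\<Sum>p\<in>?P'. ?B p * (\<Prod>j<?r. M (int (p j) + 1, v ! \<sigma> (q + j))))"
    proof -
      have len: "length (drop q (permute_list \<sigma> v) @ b) = r + length b" using r by simp
      show ?thesis
        unfolding minor_leibniz len prod_lessThan_add using q r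
        by (simp add: nth_append permute_list_nth[OF \<sigma>] mult.assoc mult.commute mult.left_commute)
    qed
    moreover have "?C p p' \<sigma> = (\<Prod>j<q. M (int (p (length a + j)) + 1, v ! \<sigma> j)) *
        (\<Prod>j<?r. M (int (p' j) + 1, v ! \<sigma> (q + j)))" for p p'
      by (simp add: r prod_lessThan_add)
    ultimately show ?thesis by (simp add: sum_product ac_simps)
  qed
  have zero: "(\<Sum>\<sigma> | \<sigma> permutes {..<length v}. of_int (sign \<sigma>) * ?C p p' \<sigma>) = 0"
    if p: "p permutes {..<?K}" and p': "p' permutes {..<?r + length b}" for p p'
  proof -
    have "?h p p' i < ?K" if "i < length v" for i
    proof (cases "i < q")
      case True
      then show ?thesis using permutes_in_image[OF p, of "length a + i"] by simp
    next
      case False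
      then have "i - q < ?r + length b" using that r by simp
      then have "p' (i - q) < ?r + length b" using permutes_in_image[OF p', of "i - q"] by simp
      then show ?thesis using False b r by simp
    qed
    then have "?h p p' ` {..<length v} \<subseteq> {..<?K}" by blast
    then have "card (?h p p' ` {..<length v}) < card {..<length v}"
      using card_mono[of "{..<?K}" "?h p p' ` {..<length v}"] v by simp
    then obtain i j where ij: "i < length v" "j < length v" "i \<noteq> j" "?h p p' i = ?h p p' j"
      using pigeonhole[of "?h p p'" "{..<length v}"] by (auto simp: inj_on_def)
    let ?\<tau> = "Transposition.transpose i j"
    show ?thesis
    proof (rule sum_permutes_uminus[OF ij(1-3)])
      fix \<sigma> assume "\<sigma> permutes {..<length v}"
      have \<tau>: "?\<tau> permutes {..<length v}" using ij by (intro permutes_swap_id) auto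
      have "?h p p' (?\<tau> x) = ?h p p' x" for x
        using ij(4) by (cases "x = i \<or> x = j") (auto simp: transpose_def)
      then show "?C p p' (\<sigma> \<circ> ?\<tau>) = ?C p p' \<sigma>"
        using prod.permute[OF \<tau>, of "\<lambda>x. M (int (?h p p' x) + 1, v ! \<sigma> x)"]
        unfolding o_def by presburger
    qed
  qed
  have "(\<Sum>\<sigma> | \<sigma> permutes {..<length v}. of_int (sign \<sigma>) *
      (minor M (a @ take q (permute_list \<sigma> v)) * minor M (drop q (permute_list \<sigma> v) @ b))) =
    (\<Sum>\<sigma> | \<sigma> permutes {..<length v}. \<Sum>p\<in>?P. \<Sum>p'\<in>?P'. ?A p * ?B p' * (of_int (sign \<sigma>) * ?C p p' \<sigma>))"
    by (intro sum.cong refl) (simp add: expand sum_distrib_left ac_simps)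
  also have "\<dots> = (\<Sum>p\<in>?P. \<Sum>p'\<in>?P'. \<Sum>\<sigma> | \<sigma> permutes {..<length v}. ?A p * ?B p' * (of_int (sign \<sigma>) * ?C p p' \<sigma>))"
    by (subst sum.swap) (intro sum.cong refl sum.swap)
  also have "\<dots> = (\<Sum>p\<in>?P. \<Sum>p'\<in>?P'. ?A p * ?B p' * (\<Sum>\<sigma> | \<sigma> permutes {..<length v}. of_int (sign \<sigma>) * ?C p p' \<sigma>))"
    by (simp only: sum_distrib_left)
  also have "\<dots> = 0"
    by (intro sum.neutral ballI) (simp only: mem_Collect_eq zero mult_zero_right)
  finally show ?thesis .
qed

lemma exchange_in_I_A:
  assumes v: "length v = Suc (length a + q)"
    and b: "length v - q + length b \<le> length a + q"
    and n: "1 \<le> length a + q" "length a + q \<le> n" "1 \<le> length v - q + length b"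
    and N: "set a \<union> set v \<union> set b \<subseteq> N_set n"
  shows "(\<Sum>\<sigma> | \<sigma> permutes {..<length v}. of_int (sign \<sigma>) *
    (X_tuple (a @ take q (permute_list \<sigma> v)) * X_tuple (drop q (permute_list \<sigma> v) @ b))) \<in> I_A n"
  (is "?s \<in> _")
proof -
  have sets: "set (a @ take q (permute_list \<sigma> v)) \<subseteq> N_set n"
    "set (drop q (permute_list \<sigma> v) @ b) \<subseteq> N_set n" if "\<sigma> permutes {..<length v}" for \<sigma>
    using N that set_take_subset[of q "permute_list \<sigma> v"] set_drop_subset[of q "permute_list \<sigma> v"]
    by auto
  have "q \<le> length v" using v by simp
  then have "?s \<in> carrier (cpoly_alg (S_vars n))"
    using b n sets
    by (intro cpoly_alg_sum cpoly_alg_mult cpoly_alg_of_int X_tuple_carrier) auto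
  moreover have "minor_map ?s = 0"
    unfolding minor_map_eq using minor_exchange[OF v b, of cvar]
    by (simp add: cpoly_hom_sum cpoly_hom_mult ph.hom_of_int cpoly_hom_X_tuple[OF sets(1)]
        cpoly_hom_X_tuple[OF sets(2)])
  ultimately show ?thesis by (simp add: I_A_def)
qed

text \<open>Row \<open>i\<close> is \<open>cvar (i, i)\<close> times a row with diagonal entry \<open>1\<close> and free entries at the
  remaining positions of \<^const>\<open>P_set\<close>. For \<open>b < i\<close> the entry at \<open>(i, - b)\<close> is the one that makes row \<open>i\<close>
  orthogonal to row \<open>b\<close>; no division occurs because of the unit diagonal.\<close>

function isotropic_matrix :: "nat \<Rightarrow> int \<times> int \<Rightarrow> (int \<times> int) cpoly" where
  "isotropic_matrix n (i, j) =
    (if 0 < j \<and> j < i then 0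
     else if i = j then cvar (i, i)
     else if i \<le> \<bar>j\<bar> then cvar (i, i) * cvar (i, j)
     else - (\<Sum>l = 1 - j..int n. cvar (- j, l) * isotropic_matrix n (i, - l)
           - cvar (- j, - l) * isotropic_matrix n (i, l)))"
  by pat_completeness auto
termination
  \<comment> \<open>Every recursive call goes to a column \<open>- l\<close> with
    \<open>l > - j\<close>, which is closer to \<open>- n\<close>, or to a positive column, where
    the recursion stops.\<close>
  by (relation "measure (\<lambda>(n, i, j). if 0 < j then 0 else nat (int n + j) + 1)") auto

declare isotropic_matrix.simps [simp del]

lemma isotropic_matrix_P:
  "(i, j) \<in> P_set n \<Longrightarrow> isotropic_matrix n (i, j) = (if i = j then cvar (i, i) else cvar (i, i) * cvar (i, j))"
  by (subst isotropic_matrix.simps) (auto simp: P_set_def)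

text \<open>For a < b the entries in the positive columns below a vanish in both rows, and the
  columns a, -a contribute \<open>cvar (a, a)\<close> times the entry at (b, -a). That entry is
  defined so as to cancel the contribution of the columns beyond a.\<close>

lemma isotropic_matrix_rows:
  assumes "a \<in> {1..int n}" "b \<in> {1..int n}"
  shows "(\<Sum>l=1..int n. isotropic_matrix n (a, l) * isotropic_matrix n (b, - l)) =
    (\<Sum>l=1..int n. isotropic_matrix n (b, l) * isotropic_matrix n (a, - l))"
proof -
  let ?z = "isotropic_matrix n"
  have *: "(\<Sum>l=1..int n. ?z (a, l) * ?z (b, - l)) = (\<Sum>l=1..int n. ?z (b, l) * ?z (a, - l))"
    if ab: "1 \<le> a" "a < b" "b \<le> int n" for a b
  proof -
    have below: "?z (i, l) = 0" if "0 < l" "l < i" for i l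
      using that by (simp add: isotropic_matrix.simps)
    have above: "?z (a, l) = cvar (a, a) * cvar (a, l)" "?z (a, - l) = cvar (a, a) * cvar (a, - l)"
      if "l \<in> {a + 1..int n}" for l
      using that ab by (simp_all add: isotropic_matrix_P P_set_def)
    have dep: "?z (b, - a) = - (\<Sum>l = a + 1..int n. cvar (a, l) * ?z (b, - l) - cvar (a, - l) * ?z (b, l))"
      using ab by (subst isotropic_matrix.simps) (simp add: add.commute)
    have diag: "?z (a, a) = cvar (a, a)" by (simp add: isotropic_matrix.simps)
    have split: "{1..int n} = {1..a - 1} \<union> {a} \<union> {a + 1..int n}" using ab by auto
    have "(\<Sum>l=1..int n. ?z (a, l) * ?z (b, - l) - ?z (b, l) * ?z (a, - l)) =
        cvar (a, a) * ?z (b, - a) + (\<Sum>l = a + 1..int n. ?z (a, l) * ?z (b, - l) - ?z (b, l) * ?z (a, - l))"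
      unfolding split using ab by (subst sum.union_disjoint; simp add: below diag)+
    also have "(\<Sum>l = a + 1..int n. ?z (a, l) * ?z (b, - l) - ?z (b, l) * ?z (a, - l)) =
        cvar (a, a) * (\<Sum>l = a + 1..int n. cvar (a, l) * ?z (b, - l) - cvar (a, - l) * ?z (b, l))"
      unfolding sum_distrib_left by (intro sum.cong refl) (simp add: above algebra_simps)
    finally show ?thesis by (simp add: dep sum_subtractf algebra_simps)
  qed
  show ?thesis using *[of a b] *[of b a] assms by (cases a b rule: linorder_cases) auto
qed

section \<open>Evaluation on the isotropic flag\<close>

definition isotropic_eval :: "nat \<Rightarrow> int list cpoly \<Rightarrow> (int \<times> int) cpoly" where
  "isotropic_eval n = cpoly_hom (minor (isotropic_matrix n))"

lemma pair_in_N_set [simp]: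
  assumes "1 \<le> l" "l \<le> int n"
  shows "l \<in> N_set n" "- l \<in> N_set n"
  using assms by (auto simp: N_set_def)

text \<open>The wedge product of \<open>t\<close> with the symplectic bivector, the sum over all
  pairs l, -l. For increasing \<open>t\<close> these are the generators of
  \<open>L_space n\<close>.\<close>

definition omega_sum :: "nat \<Rightarrow> int list \<Rightarrow> int list cpoly" where
  "omega_sum n t = (\<Sum>l = 1..int n. X_tuple (t @ [l, - l]))"

lemma L_space_eq:
  "L_space n = cp.span {omega_sum n t | t.
    length t + 2 \<le> n \<and> set t \<subseteq> N_set n \<and> sorted_wrt N_less t}"
  unfolding L_space_def omega_sum_def
  by (rule cspan_eq_span) (auto intro!: cpoly_alg_sum X_tuple_carrier)

lemma L_space_carrier: "L_space n \<subseteq> carrier (cpoly_alg (S_vars n))"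
  unfolding L_space_eq omega_sum_def
  by (rule cpoly_alg_span) (auto intro!: cpoly_alg_sum X_tuple_carrier)

lemma isotropic_eval_X_tuple:
  "set t \<subseteq> N_set n \<Longrightarrow> isotropic_eval n (X_tuple t) = minor (isotropic_matrix n) t"
  by (simp add: isotropic_eval_def cpoly_hom_X_tuple)

lemma isotropic_eval_L_space:
  assumes "p \<in> L_space n"
  shows "isotropic_eval n p = 0"
  unfolding isotropic_eval_def
proof (rule cpoly_hom_span_0[OF assms[unfolded L_space_eq]])
  fix g assume "g \<in> {omega_sum n t | t. length t + 2 \<le> n \<and> set t \<subseteq> N_set n \<and> sorted_wrt N_less t}"
  then obtain t where g: "g = omega_sum n t" and t: "length t + 2 \<le> n" "set t \<subseteq> N_set n" by blast
  have "cpoly_hom (minor (isotropic_matrix n)) g = (\<Sum>l=1..int n. minor (isotropic_matrix n) (t @ [l, - l]))"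
    unfolding g omega_sum_def cpoly_hom_sum
    using t by (intro sum.cong refl cpoly_hom_X_tuple[of _ n]) auto
  also have "\<dots> = 0"
    by (rule minor_contract_isotropic[OF isotropic_matrix_rows t(1)])
  finally show "cpoly_hom (minor (isotropic_matrix n)) g = 0" .
qed

lemma isotropic_eval_I_A: "p \<in> I_A n \<Longrightarrow> isotropic_eval n p = 0"
  using cpoly_hom_minor_map[of "isotropic_matrix n" p]
  by (simp add: I_A_def isotropic_eval_def cpoly_hom_0)

section \<open>Lowest monomials\<close>

definition weight :: "('v \<Rightarrow> nat) \<Rightarrow> ('v \<Rightarrow>\<^sub>0 nat) \<Rightarrow> nat" where
  "weight W m = (\<Sum>v \<in> Poly_Mapping.keys m. W v * Poly_Mapping.lookup m v)"

lemma weight_superset: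
  assumes "finite A" "Poly_Mapping.keys m \<subseteq> A"
  shows "weight W m = (\<Sum>v \<in> A. W v * Poly_Mapping.lookup m v)"
  unfolding weight_def using assms
  by (intro sum.mono_neutral_left) (auto simp: in_keys_iff)

lemma weight_add: "weight W (m + m') = weight W m + weight W m'"
proof -
  let ?A = "Poly_Mapping.keys m \<union> Poly_Mapping.keys m'"
  have "weight W (m + m') = (\<Sum>v \<in> ?A. W v * Poly_Mapping.lookup (m + m') v)"
    by (rule weight_superset) (auto simp: Poly_Mapping.keys_add)
  also have "\<dots> = weight W m + weight W m'"
    by (simp add: weight_superset[of ?A] lookup_add distrib_left sum.distrib)
  finally show ?thesis .
qed

lemma weight_0 [simp]: "weight W 0 = 0"
  by (simp add: weight_def)

lemma weight_sum: "weight W (sum f A) = (\<Sum>x\<in>A. weight W (f x))"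
  by (induction A rule: infinite_finite_induct) (simp_all add: weight_add)

lemma weight_single: "weight W (Poly_Mapping.single v k) = W v * k"
  by (subst weight_superset[of "{v}"]) auto

definition weight_ge :: "('v \<Rightarrow> nat) \<Rightarrow> nat \<Rightarrow> 'v cpoly \<Rightarrow> bool" where
  "weight_ge W a p \<longleftrightarrow> (\<forall>m \<in> Poly_Mapping.keys p. a \<le> weight W m)"

lemma weight_ge_0 [simp]: "weight_ge W 0 p"
  by (simp add: weight_ge_def)

lemma weight_ge_zero [simp]: "weight_ge W a 0"
  by (simp add: weight_ge_def)

lemma weight_ge_mono: "weight_ge W a p \<Longrightarrow> b \<le> a \<Longrightarrow> weight_ge W b p"
  by (auto simp: weight_ge_def)

lemma weight_ge_single: "a \<le> weight W m \<Longrightarrow> weight_ge W a (Poly_Mapping.single m c)"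
  by (auto simp: weight_ge_def)

lemma weight_ge_add: "weight_ge W a p \<Longrightarrow> weight_ge W a q \<Longrightarrow> weight_ge W a (p + q)"
  using Poly_Mapping.keys_add[of p q] by (auto simp: weight_ge_def)

lemma weight_ge_sum: "(\<And>x. x \<in> A \<Longrightarrow> weight_ge W a (f x)) \<Longrightarrow> weight_ge W a (sum f A)"
  by (induction A rule: infinite_finite_induct) (simp_all add: weight_ge_add)

lemma weight_ge_mult:
  assumes "weight_ge W a p" "weight_ge W b q"
  shows "weight_ge W (a + b) (p * q)"
  unfolding weight_ge_def
proof
  fix m assume "m \<in> Poly_Mapping.keys (p * q)"
  with Poly_Mapping.keys_mult[of p q] obtain k l
    where "m = k + l" "k \<in> Poly_Mapping.keys p" "l \<in> Poly_Mapping.keys q" by blast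
  then show "a + b \<le> weight W m"
    using assms by (simp add: weight_ge_def weight_add add_mono)
qed

lemma weight_ge_prod:
  "(\<And>x. x \<in> A \<Longrightarrow> weight_ge W (a x) (f x)) \<Longrightarrow> weight_ge W (sum a A) (prod f A)"
  by (induction A rule: infinite_finite_induct) (simp_all add: weight_ge_mult)

text \<open>Monomials of equal weight are not ordered further, so \<open>m\<close> has to be the
  only one of least weight, with coefficient 1. Stating this through the remainder lets products be
  treated by multiplying remainders.\<close>

definition lowest :: "('v \<Rightarrow> nat) \<Rightarrow> 'v cpoly \<Rightarrow> ('v \<Rightarrow>\<^sub>0 nat) \<Rightarrow> bool" where
  "lowest W p m \<longleftrightarrow> weight_ge W (Suc (weight W m)) (p - Poly_Mapping.single m 1)"

lemma lowest_1: "lowest W 1 0"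
  by (simp add: lowest_def)

lemma lowest_mult:
  assumes "lowest W p m" "lowest W q m'"
  shows "lowest W (p * q) (m + m')"
proof -
  define p' q' where "p' = p - Poly_Mapping.single m 1" and "q' = q - Poly_Mapping.single m' 1"
  have p: "weight_ge W (Suc (weight W m)) p'" and q: "weight_ge W (Suc (weight W m')) q'"
    using assms by (simp_all add: lowest_def p'_def q'_def)
  let ?s = "Poly_Mapping.single :: _ \<Rightarrow> complex \<Rightarrow> _"
  have m: "weight_ge W (weight W m) (?s m 1)" and m': "weight_ge W (weight W m') (?s m' 1)"
    by (simp_all add: weight_ge_single)
  have "weight_ge W (Suc (weight W (m + m'))) (?s m 1 * q' + p' * ?s m' 1 + p' * q')"
    using weight_ge_mult[OF m q] weight_ge_mult[OF p m'] weight_ge_mono[OF weight_ge_mult[OF p q]]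
    by (intro weight_ge_add) (simp_all add: weight_add)
  moreover have "p * q - ?s (m + m') 1 = ?s m 1 * q' + p' * ?s m' 1 + p' * q'"
  proof -
    have "p = ?s m 1 + p'" "q = ?s m' 1 + q'" by (simp_all add: p'_def q'_def)
    moreover have "?s (m + m') 1 = ?s m 1 * ?s m' 1" by (simp add: mult_single)
    ultimately show ?thesis by (simp add: algebra_simps)
  qed
  ultimately show ?thesis by (simp add: lowest_def)
qed

lemma lowest_prod_list:
  "(\<And>x. x \<in> set xs \<Longrightarrow> lowest W (f x) (m x)) \<Longrightarrow>
    lowest W (prod_list (map f xs)) (sum_list (map m xs))"
  by (induction xs) (simp_all add: lowest_1 lowest_mult)

lemma lookup_lowest:
  assumes "lowest W p m" "weight W m' \<le> weight W m"
  shows "Poly_Mapping.lookup p m' = (if m' = m then 1 else 0)"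
proof -
  have "m' \<notin> Poly_Mapping.keys (p - Poly_Mapping.single m 1)"
    using assms by (auto simp: lowest_def weight_ge_def)
  then have "Poly_Mapping.lookup (p - Poly_Mapping.single m 1) m' = 0"
    by (simp add: in_keys_iff)
  then show ?thesis by (auto simp: lookup_minus lookup_single)
qed

text \<open>Different monomials may have equal weight, so the minimal index \<open>j\<close> is
  chosen by weight only. Still the coefficient at \<open>m j\<close> receives nothing from the other
  terms: their own lowest monomial differs from \<open>m j\<close> and is at least as heavy, and the
  rest of their monomials are heavier still.\<close>

lemma lowest_independent:
  assumes "finite F" "\<And>i. i \<in> F \<Longrightarrow> lowest W (f i) (m i)" "inj_on m F"
    and zero: "(\<Sum>i\<in>F. cconst (a i) * f i) = 0" and "i \<in> F"
  shows "a i = 0"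
proof (rule ccontr)
  assume "a i \<noteq> 0"
  define F' where "F' = {i \<in> F. a i \<noteq> 0}"
  have F': "finite F'" "F' \<noteq> {}" using assms(1,5) \<open>a i \<noteq> 0\<close> by (auto simp: F'_def)
  define j where "j = arg_min_on (\<lambda>i. weight W (m i)) F'"
  have j: "j \<in> F'" "\<And>l. l \<in> F' \<Longrightarrow> weight W (m j) \<le> weight W (m l)"
    using arg_min_if_finite[OF F', of "\<lambda>i. weight W (m i)"] unfolding j_def
    by (auto simp: not_less)
  have "0 = Poly_Mapping.lookup (\<Sum>i\<in>F. cconst (a i) * f i) (m j)"
    using zero by simp
  also have "\<dots> = (\<Sum>i\<in>F. a i * Poly_Mapping.lookup (f i) (m j))"
    by (simp add: lookup_sum lookup_cconst_mult)
  also have "\<dots> = (\<Sum>i\<in>F. if i = j then a i else 0)"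
  proof (intro sum.cong refl)
    fix l assume l: "l \<in> F"
    show "a l * Poly_Mapping.lookup (f l) (m j) = (if l = j then a l else 0)"
    proof (cases "a l = 0")
      case False
      then have "weight W (m j) \<le> weight W (m l)" using l j(2) by (simp add: F'_def)
      then have "Poly_Mapping.lookup (f l) (m j) = (if m j = m l then 1 else 0)"
        using lookup_lowest[OF assms(2)[OF l]] by blast
      moreover have "m j = m l \<longleftrightarrow> j = l"
        using assms(3) l j(1) by (auto simp: F'_def inj_on_def)
      ultimately show ?thesis by auto
    qed auto
  qed
  also have "\<dots> = a j" using assms(1) j(1) by (simp add: F'_def)
  finally show False using j(1) by (simp add: F'_def)
qed

text \<open>With digits below \<open>B\<close>, the places r, ..., k - 1 together stay below one
  unit of the place before r. The extra summand \<open>B ^ (n - k)\<close>, one unit of the last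
  place, carries the induction.\<close>

lemma sum_digits_less:
  fixes \<rho> :: "nat \<Rightarrow> nat"
  assumes "r \<le> k" "k \<le> n" "\<And>j. r \<le> j \<Longrightarrow> j < k \<Longrightarrow> \<rho> j < B"
  shows "(\<Sum>j\<in>{r..<k}. B ^ (n - Suc j) * \<rho> j) + B ^ (n - k) \<le> B ^ (n - r)"
  using assms
proof (induction k rule: dec_induct)
  case base
  then show ?case by simp
next
  case (step k)
  have "B ^ (n - Suc k) * \<rho> k + B ^ (n - Suc k) = B ^ (n - Suc k) * Suc (\<rho> k)" by simp
  also have "\<dots> \<le> B ^ (n - Suc k) * B" using step.prems step.hyps by (intro mult_left_mono) (auto simp: Suc_le_eq)
  also have "\<dots> = B ^ (n - k)" using step.prems by (metis Suc_diff_Suc Suc_le_lessD power_Suc2)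
  finally show ?case using step by simp
qed

text \<open>In the expansion of the minor, compare a permutation with the identity at the first row in
  which they differ: the identity has the smaller weight there, and all later rows together weigh
  less than this difference.\<close>

lemma lowest_minor:
  assumes k: "length t \<le> n"
    and entry: "\<And>r c. r \<le> c \<Longrightarrow> c < length t \<Longrightarrow> M (int r + 1, t ! c) = Poly_Mapping.single (\<mu> r (t ! c)) 1"
    and wt: "\<And>r c. r \<le> c \<Longrightarrow> c < length t \<Longrightarrow> weight W (\<mu> r (t ! c)) = B ^ (n - Suc r) * \<rho> r (t ! c)"
    and \<rho>: "\<And>r c. r < c \<Longrightarrow> c < length t \<Longrightarrow> \<rho> r (t ! r) < \<rho> r (t ! c)"
    and B: "\<And>r. r < length t \<Longrightarrow> \<rho> r (t ! r) < B"
  shows "lowest W (minor M t) (\<Sum>r<length t. \<mu> r (t ! r))"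
proof -
  let ?k = "length t"
  let ?P = "{p. p permutes {..<?k}}" and ?f = "\<lambda>p. \<Prod>j<?k. M (int (p j) + 1, t ! j)"
  let ?m = "\<Sum>r<?k. \<mu> r (t ! r)"
  have fin: "finite ?P" by (simp add: finite_permutations)
  have single_prod: "(\<Prod>x\<in>A. Poly_Mapping.single (g x) 1) = Poly_Mapping.single (sum g A) (1 :: complex)"
    if "finite A" for g :: "nat \<Rightarrow> 'a \<Rightarrow>\<^sub>0 nat" and A
    using that by (induction A rule: finite_induct) (simp_all add: mult_single)
  have id: "?f id = Poly_Mapping.single ?m 1"
    by (simp add: entry single_prod)
  have mt: "weight W ?m = (\<Sum>j<?k. B ^ (n - Suc j) * \<rho> j (t ! j))"
    by (simp add: weight_sum wt)
  have heavy: "weight_ge W (Suc (weight W ?m)) (?f p)" if p: "p permutes {..<?k}" and "p \<noteq> id" for p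
  proof -
    define r where "r = (LEAST r. p r \<noteq> r)"
    have "\<exists>r. p r \<noteq> r" using \<open>p \<noteq> id\<close> by (auto simp: fun_eq_iff)
    then have r: "p r \<noteq> r" unfolding r_def by (rule LeastI_ex)
    have least: "p i = i" if "i < r" for i using not_less_Least that unfolding r_def by blast
    have rk: "r < ?k" using r p permutes_not_in by (metis lessThan_iff)
    obtain c where c: "p c = r" using p by (metis permutes_surj surj_def)
    have ck: "c < ?k" using c rk permutes_in_image[OF p, of c] by simp
    have rc: "r < c"
      using c r least by (metis linorder_neqE_nat less_irrefl)
    \<comment> \<open>Lower bounds for the weights of the factors. Rows before \<open>r\<close> keep
      their diagonal entry, and column \<open>c\<close> sits in row \<open>r\<close>. The remaining
      factors get the bound 0, since they may lie below the diagonal, where nothing is assumed about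
      the entries.\<close>
    let ?a = "\<lambda>j. if j < r then B ^ (n - Suc j) * \<rho> j (t ! j)
      else if j = c then B ^ (n - Suc r) * \<rho> r (t ! c) else 0"
    have "weight_ge W (sum ?a {..<?k}) (?f p)"
    proof (rule weight_ge_prod)
      fix j assume "j \<in> {..<?k}"
      then show "weight_ge W (?a j) (M (int (p j) + 1, t ! j))"
        using rc c least[of j] wt[of j j] entry[of j j] wt[of r c] entry[of r c]
        by (auto simp: weight_ge_single)
    qed
    moreover have "Suc (weight W ?m) \<le> sum ?a {..<?k}"
    proof -
      have split: "{..<?k} = {..<r} \<union> {r..<?k}" using rk by auto
      have "sum ?a {..<?k} = sum ?a {..<r} + sum ?a {r..<?k}"
        unfolding split by (rule sum.union_disjoint) auto
      also have "sum ?a {r..<?k} = (\<Sum>j\<in>{r..<?k}. if j = c then B ^ (n - Suc r) * \<rho> r (t ! c) else 0)"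
        by (intro sum.cong) auto
      also have "\<dots> = B ^ (n - Suc r) * \<rho> r (t ! c)" using rc ck by simp
      finally have a: "sum ?a {..<?k} =
        (\<Sum>j<r. B ^ (n - Suc j) * \<rho> j (t ! j)) + B ^ (n - Suc r) * \<rho> r (t ! c)" by simp
      note mt
      also have "(\<Sum>j<?k. B ^ (n - Suc j) * \<rho> j (t ! j)) =
          (\<Sum>j<r. B ^ (n - Suc j) * \<rho> j (t ! j)) + (\<Sum>j\<in>{r..<?k}. B ^ (n - Suc j) * \<rho> j (t ! j))"
        unfolding split by (rule sum.union_disjoint) auto
      also have "(\<Sum>j\<in>{r..<?k}. B ^ (n - Suc j) * \<rho> j (t ! j)) =
          B ^ (n - Suc r) * \<rho> r (t ! r) + (\<Sum>j\<in>{Suc r..<?k}. B ^ (n - Suc j) * \<rho> j (t ! j))"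
        using rk by (rule sum.atLeast_Suc_lessThan)
      finally have w: "weight W ?m = (\<Sum>j<r. B ^ (n - Suc j) * \<rho> j (t ! j)) +
        (B ^ (n - Suc r) * \<rho> r (t ! r) + (\<Sum>j\<in>{Suc r..<?k}. B ^ (n - Suc j) * \<rho> j (t ! j)))" .
      have "B ^ (n - ?k) > 0" using B[OF rk] by simp
      moreover have "(\<Sum>j\<in>{Suc r..<?k}. B ^ (n - Suc j) * \<rho> j (t ! j)) + B ^ (n - ?k) \<le> B ^ (n - Suc r)"
        using rk k B by (intro sum_digits_less) auto
      moreover have "B ^ (n - Suc r) * Suc (\<rho> r (t ! r)) \<le> B ^ (n - Suc r) * \<rho> r (t ! c)"
        using \<rho>[OF rc ck] by (intro mult_left_mono) auto
      moreover have "B ^ (n - Suc r) * Suc (\<rho> r (t ! r)) = B ^ (n - Suc r) + B ^ (n - Suc r) * \<rho> r (t ! r)"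
        by simp
      ultimately show ?thesis unfolding w a by linarith
    qed
    ultimately show ?thesis by (rule weight_ge_mono)
  qed
  have "minor M t = (\<Sum>p\<in>?P. of_int (sign p) * ?f p)" by (rule minor_leibniz)
  also have "\<dots> = of_int (sign (id :: nat \<Rightarrow> nat)) * ?f id + (\<Sum>p\<in>?P - {id}. of_int (sign p) * ?f p)"
  proof -
    have "id \<in> ?P" by (simp add: permutes_id)
    from sum.remove[OF fin this, of "\<lambda>p. of_int (sign p) * ?f p"] show ?thesis .
  qed
  also have "of_int (sign (id :: nat \<Rightarrow> nat)) * ?f id = Poly_Mapping.single ?m 1" unfolding id by simp
  finally have eq: "minor M t = Poly_Mapping.single ?m 1 + (\<Sum>p\<in>?P - {id}. of_int (sign p) * ?f p)" .
  have "minor M t - Poly_Mapping.single ?m 1 = (\<Sum>p\<in>?P - {id}. of_int (sign p) * ?f p)"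
    unfolding eq by (rule add_diff_cancel_left')
  also have "weight_ge W (Suc (weight W ?m)) \<dots>"
    using weight_ge_mult[OF weight_ge_0 heavy] by (intro weight_ge_sum) auto
  finally show ?thesis by (simp add: lowest_def)
qed

section \<open>Pipes\<close>

lemma pos_range: "j \<in> N_set n \<Longrightarrow> 1 \<le> pos n j \<and> pos n j \<le> 2 * int n"
  by (auto simp: N_set_def pos_def)

lemma pos_eq_iff: "i \<in> N_set n \<Longrightarrow> j \<in> N_set n \<Longrightarrow> pos n i = pos n j \<longleftrightarrow> i = j"
  using inj_on_pos[of n] by (auto simp: inj_on_def)

lemma P_set_iff: "(i, j) \<in> P_set n \<longleftrightarrow> 1 \<le> i \<and> i \<le> int n \<and> j \<in> N_set n \<and> i \<le> \<bar>j\<bar>"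
  by (auto simp: P_set_def N_set_def)

lemma P_le_iff:
  "(i, j) \<in> P_set n \<Longrightarrow> (i', j') \<in> P_set n \<Longrightarrow> P_le (i, j) (i', j') \<longleftrightarrow> i \<le> i' \<and> pos n j \<le> pos n j'"
  using pos_eq_iff[of j n j'] by (auto simp: P_le_def P_set_iff N_less_iff_pos)

lemma pos_diag_le: "(i, j) \<in> P_set n \<Longrightarrow> pos n i \<le> pos n j"
  by (auto simp: P_set_def pos_def)

text \<open>For distinct \<open>i # js\<close> this product of transpositions is a single cycle:
  each entry of \<open>js\<close> goes to its predecessor in \<open>i # js\<close>, and
  \<open>i\<close> goes to the last entry.\<close>

definition cycle :: "'a \<Rightarrow> 'a list \<Rightarrow> 'a \<Rightarrow> 'a" where
  "cycle i js = foldr (Transposition.transpose i) js"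

lemma cycle_simps:
  "cycle i [] x = x"
  "cycle i (j # js) x = Transposition.transpose i j (cycle i js x)"
  by (simp_all add: cycle_def)

text \<open>A diagonal element (i, i) contributes the identity, so it may be split off the list of
  its row.\<close>

lemma cycle_self: "cycle i (i # js) = cycle i js"
  by (simp add: cycle_simps fun_eq_iff)

lemma bij_foldr: "(\<And>x. x \<in> set xs \<Longrightarrow> bij (f x)) \<Longrightarrow> bij (foldr f xs)"
proof (induction xs)
  case Nil
  have "foldr f [] = id" by (simp add: fun_eq_iff)
  then show ?case by (simp only: bij_id)
next
  case (Cons x xs)
  have "foldr f (x # xs) = f x \<circ> foldr f xs" by (simp add: fun_eq_iff)
  then show ?case using Cons by (simp only: bij_comp list.set_intros)
qed

lemma bij_cycle: "bij (cycle i js)"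
  unfolding cycle_def by (rule bij_foldr) simp

lemma cycle_fixed: "x \<notin> set (i # js) \<Longrightarrow> cycle i js x = x"
  by (induction js) (auto simp: cycle_simps transpose_def)

lemma cycle_base: "distinct (i # js) \<Longrightarrow> cycle i js i = last (i # js)"
proof (induction js)
  case (Cons j js)
  have "last js \<noteq> i \<and> last js \<noteq> j" if "js \<noteq> []"
    using Cons.prems last_in_set[OF that] by auto
  then show ?case using Cons by (auto simp: cycle_simps transpose_def)
qed (simp add: cycle_simps)

lemma cycle_step:
  "distinct (i # js) \<Longrightarrow> q < length js \<Longrightarrow> cycle i js (js ! q) = (i # js) ! q"
proof (induction js arbitrary: q)
  case (Cons j js)
  show ?case
  proof (cases q)
    case 0
    have "cycle i js j = j" using Cons.prems by (intro cycle_fixed) auto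
    then show ?thesis using 0 by (simp add: cycle_simps)
  next
    case (Suc q')
    have q': "q' < length js" using Cons.prems(2) Suc by simp
    have "cycle i (j # js) ((j # js) ! q) = Transposition.transpose i j ((i # js) ! q')"
      using Cons.IH[OF _ q'] Cons.prems(1) Suc by (simp add: cycle_simps)
    also have "\<dots> = (j # js) ! q'"
    proof (cases q')
      case (Suc r)
      then have "js ! r \<in> set js" using q' by (intro nth_mem) simp
      then have "js ! r \<noteq> i" "js ! r \<noteq> j" using Cons.prems(1) by auto
      then show ?thesis using Suc by (simp add: transpose_def)
    qed simp
    finally show ?thesis using Suc by simp
  qed
qed simp

definition N_list :: "nat \<Rightarrow> int list" where
  "N_list n = [1..int n] @ [- int n..-1]"

lemma set_N_list: "set (N_list n) = N_set n"
  by (auto simp: N_list_def N_set_def)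

lemma distinct_N_list: "distinct (N_list n)"
  by (auto simp: N_list_def)

lemma sorted_N_list: "sorted_wrt (\<lambda>i j. pos n i < pos n j) (N_list n)"
proof -
  have s: "sorted_wrt (<) [1..int n]" "sorted_wrt (<) [- int n..-1]"
    by (simp_all add: strict_sorted_iff)
  have "sorted_wrt (\<lambda>i j. pos n i < pos n j) [1..int n]"
    by (rule sorted_wrt_mono_rel[OF _ s(1)]) (simp add: pos_def)
  moreover have "sorted_wrt (\<lambda>i j. pos n i < pos n j) [- int n..-1]"
    by (rule sorted_wrt_mono_rel[OF _ s(2)]) (simp add: pos_def)
  ultimately show ?thesis
    unfolding N_list_def sorted_wrt_append by (simp add: pos_def)
qed

definition row_cycle :: "nat \<Rightarrow> (int \<times> int) set \<Rightarrow> int \<Rightarrow> int \<Rightarrow> int" where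
  "row_cycle n M i = cycle i (filter (\<lambda>j. (i, j) \<in> M) (N_list n))"

text \<open>The rightmost factor acts first, so an argument passes through the rows n, n - 1, ...,
  i. Its successive values form its pipe; the value under \<open>tail_perm n M (i + 1)\<close> is
  the column at which the pipe enters row i.\<close>

definition tail_perm :: "nat \<Rightarrow> (int \<times> int) set \<Rightarrow> int \<Rightarrow> int \<Rightarrow> int" where
  "tail_perm n M i = foldr (row_cycle n M) [i..int n]"

lemma concat_map_filter: "concat (map (\<lambda>j. if P j then [f j] else []) js) = map f (filter P js)"
  by (induction js) auto

lemma foldr_comp_id: "foldr (\<circ>) fs id x = foldr (\<lambda>f. f) fs x"
  by (induction fs) simp_all

lemma foldr_concat: "foldr f (concat xss) x = foldr (foldr f) xss x"
  by (induction xss) simp_all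

lemma foldr_id_map: "foldr (\<lambda>f. f) (map g xs) = foldr g xs"
  by (rule ext) (induction xs; simp)

lemma w_perm_eq: "w_perm n M = tail_perm n M 1"
proof
  fix x
  have "w_perm n M x = foldr (\<lambda>f. f) (concat (map (\<lambda>i. map (Transposition.transpose i)
      (filter (\<lambda>j. (i, j) \<in> M) (N_list n))) [1..int n])) x"
    unfolding w_perm_def N_list_def[symmetric] concat_map_filter by (rule foldr_comp_id)
  also have "\<dots> = foldr (\<lambda>i. foldr (\<lambda>f. f) (map (Transposition.transpose i)
      (filter (\<lambda>j. (i, j) \<in> M) (N_list n)))) [1..int n] x"
    unfolding foldr_concat by (simp add: foldr_map foldr_id_map comp_def)
  also have "\<dots> = tail_perm n M 1 x"
    unfolding tail_perm_def row_cycle_def[abs_def] cycle_def foldr_id_map ..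
  finally show "w_perm n M x = tail_perm n M 1 x" .
qed

lemma tail_perm_rec: "i \<le> int n \<Longrightarrow> tail_perm n M i y = row_cycle n M i (tail_perm n M (i + 1) y)"
  unfolding tail_perm_def by (subst upto_rec1) auto

lemma tail_perm_end: "int n < i \<Longrightarrow> tail_perm n M i y = y"
  by (simp add: tail_perm_def)

lemma bij_tail_perm: "bij (tail_perm n M i)"
  unfolding tail_perm_def by (rule bij_foldr) (simp add: row_cycle_def bij_cycle)

text \<open>The common property of \<open>Q\<close> and \<open>M_set Q J\<close>: a nonempty row
  contains its diagonal element, which is also its least element. The factor of that row is then a
  cycle on exactly the columns present in it.\<close>

definition diagonal :: "nat \<Rightarrow> (int \<times> int) set \<Rightarrow> bool" where
  "diagonal n M \<longleftrightarrow> M \<subseteq> P_set n \<and> (\<forall>(i, j) \<in> M. (i, i) \<in> M)"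

lemma row_cycle_list:
  assumes "diagonal n M" "(i, i) \<in> M"
  obtains js where "row_cycle n M i = cycle i js" "set (i # js) = {j. (i, j) \<in> M}"
    "sorted_wrt (\<lambda>i j. pos n i < pos n j) (i # js)" "distinct (i # js)"
proof -
  let ?ls = "filter (\<lambda>j. (i, j) \<in> M) (N_list n)"
  have MP: "M \<subseteq> P_set n" using assms(1) by (simp add: diagonal_def)
  have s: "sorted_wrt (\<lambda>i j. pos n i < pos n j) ?ls"
    using sorted_N_list by (rule sorted_wrt_filter)
  have set: "set ?ls = {j. (i, j) \<in> M}"
    unfolding set_filter set_N_list using MP by (auto simp: P_set_iff)
  obtain a js where ls: "?ls = a # js"
    using set assms(2) by (cases ?ls) auto
  have "a = i"
  proof (rule ccontr)
    assume "a \<noteq> i"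
    then have "i \<in> set js" using set assms(2) unfolding ls by auto
    then have "pos n a < pos n i" using s unfolding ls by simp
    moreover have "(i, a) \<in> P_set n" using set MP unfolding ls by auto
    ultimately show False using pos_diag_le by fastforce
  qed
  have d: "distinct ?ls"
    using distinct_N_list by (rule distinct_filter)
  show thesis
  proof (rule that)
    show "row_cycle n M i = cycle i js"
      unfolding row_cycle_def ls \<open>a = i\<close> by (rule cycle_self)
  qed (use s set d in \<open>simp_all only: ls \<open>a = i\<close>\<close>)
qed

lemma row_cycle_fixed:
  assumes "diagonal n M" "(i, y) \<notin> M" "y \<noteq> i \<or> (i, i) \<notin> M"
  shows "row_cycle n M i y = y"
proof (cases "(i, i) \<in> M")
  case True
  from row_cycle_list[OF assms(1) this] obtain js where js: "row_cycle n M i = cycle i js"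
    "set (i # js) = {j. (i, j) \<in> M}" .
  then show ?thesis using assms by (simp add: cycle_fixed)
next
  case False
  then have "(i, j) \<notin> M" for j using assms(1) by (auto simp: diagonal_def)
  then show ?thesis by (simp add: row_cycle_def cycle_simps)
qed

lemma row_cycle_base:
  assumes "diagonal n M" "(i, i) \<in> M"
  shows "(i, row_cycle n M i i) \<in> M"
    and "\<And>z. (i, z) \<in> M \<Longrightarrow> pos n z \<le> pos n (row_cycle n M i i)"
proof -
  from row_cycle_list[OF assms] obtain js where js: "row_cycle n M i = cycle i js"
    "set (i # js) = {j. (i, j) \<in> M}" "sorted_wrt (\<lambda>i j. pos n i < pos n j) (i # js)"
    "distinct (i # js)" .
  have base: "row_cycle n M i i = last (i # js)"
    unfolding js(1) by (rule cycle_base[OF js(4)])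
  show "(i, row_cycle n M i i) \<in> M"
    unfolding base using js(2) last_in_set[of "i # js"] by blast
  fix z assume "(i, z) \<in> M"
  then have "z \<in> set (i # js)" using js(2) by simp
  then obtain q where q: "q < length (i # js)" "z = (i # js) ! q" by (metis in_set_conv_nth)
  show "pos n z \<le> pos n (row_cycle n M i i)"
  proof (cases "q = length js")
    case True
    then show ?thesis unfolding base q(2) by (simp add: last_conv_nth)
  next
    case False
    then have "pos n ((i # js) ! q) < pos n ((i # js) ! length js)"
      using sorted_wrt_nth_less[OF js(3), of q "length js"] q(1) by simp
    moreover have "(i # js) ! length js = last (i # js)"
      by (subst last_conv_nth) simp_all
    ultimately show ?thesis unfolding base q(2) by (simp only: less_imp_le)
  qed
qed

text \<open>Together the three parts say that \<open>y\<close> moves to its immediate predecessor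
  within row \<open>i\<close> of \<open>M\<close>.\<close>

lemma row_cycle_step:
  assumes "diagonal n M" "(i, y) \<in> M" "y \<noteq> i"
  shows "(i, row_cycle n M i y) \<in> M"
    and "pos n (row_cycle n M i y) < pos n y"
    and "\<And>z. (i, z) \<in> M \<Longrightarrow> pos n z < pos n y \<Longrightarrow> pos n z \<le> pos n (row_cycle n M i y)"
proof -
  have "(i, i) \<in> M" using assms by (auto simp: diagonal_def)
  from row_cycle_list[OF assms(1) this] obtain js where js: "row_cycle n M i = cycle i js"
    "set (i # js) = {j. (i, j) \<in> M}" "sorted_wrt (\<lambda>i j. pos n i < pos n j) (i # js)"
    "distinct (i # js)" .
  have "y \<in> set js" using js(2) assms by auto
  then obtain q where q: "q < length js" "y = js ! q" by (metis in_set_conv_nth)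
  have step: "row_cycle n M i y = (i # js) ! q"
    unfolding js(1) q(2) by (rule cycle_step[OF js(4) q(1)])
  have y: "y = (i # js) ! Suc q" by (simp add: q)
  show "(i, row_cycle n M i y) \<in> M"
    unfolding step using js(2) nth_mem[of q "i # js"] q(1) by auto
  show "pos n (row_cycle n M i y) < pos n y"
    unfolding step using sorted_wrt_nth_less[OF js(3), of q "Suc q"] q by simp
  fix z assume "(i, z) \<in> M" and less: "pos n z < pos n y"
  then have "z \<in> set (i # js)" using js(2) by simp
  then obtain r where r: "r < length (i # js)" "z = (i # js) ! r" by (metis in_set_conv_nth)
  have "r < Suc q"
  proof (rule ccontr)
    assume "\<not> r < Suc q"
    then have "r = Suc q \<or> Suc q < r" by auto
    then have "pos n y \<le> pos n z"
      using sorted_wrt_nth_less[OF js(3), of "Suc q" r] r unfolding y by auto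
    then show False using less by simp
  qed
  then have "r = q \<or> r < q" by auto
  then show "pos n z \<le> pos n (row_cycle n M i y)"
    using sorted_wrt_nth_less[OF js(3), of r q] q(1) unfolding step r(2) by auto
qed

text \<open>All columns occurring in row \<open>i\<close> have absolute value at least
  \<open>i\<close>, hence at least \<open>m\<close>.\<close>

lemma row_cycle_region:
  assumes "diagonal n M" "1 \<le> m" "m \<le> i" "i \<le> int n" "y \<in> N_set n" "m \<le> \<bar>y\<bar>"
  shows "row_cycle n M i y \<in> N_set n \<and> m \<le> \<bar>row_cycle n M i y\<bar>"
proof -
  have MP: "M \<subseteq> P_set n" using assms(1) by (simp add: diagonal_def)
  consider "(i, y) \<notin> M" "y \<noteq> i \<or> (i, i) \<notin> M" | "(i, i) \<in> M" "y = i" | "(i, y) \<in> M" "y \<noteq> i" by blast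
  then show ?thesis
  proof cases
    case 1
    then show ?thesis using row_cycle_fixed[OF assms(1), of i y] assms by simp
  next
    case 2
    then have "(i, row_cycle n M i y) \<in> P_set n" using row_cycle_base(1)[OF assms(1)] MP by blast
    then show ?thesis using assms(3) by (simp add: P_set_iff)
  next
    case 3
    then have "(i, row_cycle n M i y) \<in> P_set n" using row_cycle_step(1)[OF assms(1)] MP by blast
    then show ?thesis using assms(3) by (simp add: P_set_iff)
  qed
qed

lemma tail_perm_region:
  assumes M: "diagonal n M" and "1 \<le> m" "m \<le> i" and y: "y \<in> N_set n" "m \<le> \<bar>y\<bar>"
  shows "tail_perm n M i y \<in> N_set n \<and> m \<le> \<bar>tail_perm n M i y\<bar>"
proof (cases "i \<le> int n")
  case True
  \<comment> \<open>Induction from the last row upwards; \<open>d\<close> is the number of rows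
    passed, and for \<open>d = 0\<close> the product is empty.\<close>
  have "m \<le> int n + 1 - int d \<Longrightarrow> tail_perm n M (int n + 1 - int d) y \<in> N_set n \<and>
      m \<le> \<bar>tail_perm n M (int n + 1 - int d) y\<bar>" for d
  proof (induction d)
    case 0
    show ?case using y by (simp add: tail_perm_end)
  next
    case (Suc d)
    define r where "r = int n - int d"
    have r: "int n + 1 - int (Suc d) = r" "int n + 1 - int d = r + 1" "m \<le> r" "r \<le> int n"
      using Suc.prems by (simp_all add: r_def)
    have IH: "tail_perm n M (r + 1) y \<in> N_set n" "m \<le> \<bar>tail_perm n M (r + 1) y\<bar>"
      using Suc.IH r by simp_all
    show ?case
      unfolding r(1) tail_perm_rec[OF r(4)]
      by (rule row_cycle_region[OF M \<open>1 \<le> m\<close> r(3,4) IH])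
  qed
  from this[of "nat (int n + 1 - i)"] show ?thesis using True assms(3) by simp
next
  case False
  then show ?thesis using y by (simp add: tail_perm_end)
qed

lemma tail_perm_fixed:
  assumes M: "diagonal n M" and "\<bar>y\<bar> < i"
  shows "tail_perm n M i y = y"
proof (cases "i \<le> int n")
  case True
  have "\<bar>y\<bar> < int n + 1 - int d \<Longrightarrow> tail_perm n M (int n + 1 - int d) y = y" for d
  proof (induction d)
    case 0
    show ?case by (simp add: tail_perm_end)
  next
    case (Suc d)
    define r where "r = int n - int d"
    have r: "int n + 1 - int (Suc d) = r" "int n + 1 - int d = r + 1" "\<bar>y\<bar> < r" "r \<le> int n"
      using Suc.prems by (simp_all add: r_def)
    have "tail_perm n M (r + 1) y = y"
      using Suc.IH r by simp
    moreover have "(r, y) \<notin> M" using M r by (auto simp: diagonal_def P_set_def)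
    then have "row_cycle n M r y = y" using M r by (intro row_cycle_fixed) auto
    ultimately show ?case
      unfolding r(1) tail_perm_rec[OF r(4)] by simp
  qed
  from this[of "nat (int n + 1 - i)"] show ?thesis using True assms(2) by simp
next
  case False
  then show ?thesis by (simp add: tail_perm_end)
qed

section \<open>Order ideals and their pipes\<close>

lemma order_ideal_P: "J \<in> order_ideals n \<Longrightarrow> J \<subseteq> P_set n"
  by (simp add: order_ideals_def)

lemma order_ideal_down:
  assumes "J \<in> order_ideals n" "(i, j) \<in> J" "(i', j') \<in> P_set n" "i' \<le> i" "pos n j' \<le> pos n j"
  shows "(i', j') \<in> J"
proof -
  have "(i, j) \<in> P_set n" using assms order_ideal_P by blast
  then have "P_le (i', j') (i, j)" using assms by (simp add: P_le_iff)
  then show ?thesis using assms(1-3) by (auto simp: order_ideals_def)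
qed

lemma order_ideal_diag:
  assumes "J \<in> order_ideals n" "(i, j) \<in> J" "1 \<le> i'" "i' \<le> i"
  shows "(i', i') \<in> J"
proof -
  have "(i, j) \<in> P_set n" using assms order_ideal_P by blast
  then have "pos n i' \<le> pos n j" "(i', i') \<in> P_set n"
    using pos_diag_le[of i j n] assms by (auto simp: P_set_iff pos_def N_set_def)
  then show ?thesis using order_ideal_down[OF assms(1,2)] assms by blast
qed

text \<open>The diagonal elements of an ideal form an initial segment, so their number is also the
  index of the last row that the ideal meets.\<close>

lemma order_ideal_diag_iff:
  assumes J: "J \<in> order_ideals n" and i: "1 \<le> i" "i \<le> int n"
  shows "(i, i) \<in> J \<longleftrightarrow> i \<le> int (card (J \<inter> A_set n))"
proof -
  define D where "D = {i. 1 \<le> i \<and> i \<le> int n \<and> (i, i) \<in> J}"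
  have JA: "J \<inter> A_set n = (\<lambda>i. (i, i)) ` D" by (auto simp: A_set_def D_def)
  have card: "card (J \<inter> A_set n) = card D"
    unfolding JA by (rule card_image) (auto simp: inj_on_def)
  have fin: "finite D" by (rule finite_subset[of _ "{1..int n}"]) (auto simp: D_def)
  have "D = {1..int (card D)}"
  proof (cases "D = {}")
    case False
    have max: "Max D \<in> D" using fin False by simp
    have "D = {1..Max D}"
    proof
      show "D \<subseteq> {1..Max D}" using fin by (auto simp: D_def)
      show "{1..Max D} \<subseteq> D"
      proof
        fix r assume r: "r \<in> {1..Max D}"
        then have "(r, r) \<in> J" using max order_ideal_diag[OF J, of "Max D" "Max D" r] by (simp add: D_def)
        then show "r \<in> D" using r max by (simp add: D_def)
      qed
    qed
    moreover have "1 \<le> Max D" using max by (simp add: D_def)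
    ultimately show ?thesis by (metis card_atLeastAtMost_int diff_add_cancel int_nat_eq order_trans zero_le_one)
  qed simp
  then have "i \<in> D \<longleftrightarrow> i \<le> int (card D)" using i by (metis atLeastAtMost_iff)
  then show ?thesis using i by (simp add: card D_def)
qed

lemma card_diag_le:
  assumes "J \<subseteq> P_set n"
  shows "card (J \<inter> A_set n) \<le> n"
proof -
  have "A_set n = (\<lambda>i. (i, i)) ` {1..int n}" by (auto simp: A_set_def)
  then have "card (A_set n) \<le> n" "finite (A_set n)" using card_image_le[of "{1..int n}" "\<lambda>i. (i, i)"] by auto
  then show ?thesis using card_mono[of "A_set n" "J \<inter> A_set n"] by simp
qed

locale pipes =
  fixes n :: nat and Q :: "(int \<times> int) set"
  assumes A_sub_Q: "A_set n \<subseteq> Q" and Q_sub_P: "Q \<subseteq> P_set n"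
begin

abbreviation G :: "int \<Rightarrow> int \<Rightarrow> int" where "G \<equiv> tail_perm n Q"

lemma diag_in_Q: "1 \<le> i \<Longrightarrow> i \<le> int n \<Longrightarrow> (i, i) \<in> Q"
  using A_sub_Q by (auto simp: A_set_def)

lemma diagonal_Q: "diagonal n Q"
  using Q_sub_P diag_in_Q by (fastforce simp: diagonal_def P_set_def)

lemma diagonal_M:
  assumes "J \<in> order_ideals n"
  shows "diagonal n (M_set Q J)"
  unfolding diagonal_def
proof (intro conjI ballI)
  show "M_set Q J \<subseteq> P_set n"
    using order_ideal_P[OF assms] by (auto simp: M_set_def maximal_elements_def)
  fix p assume p: "p \<in> M_set Q J"
  obtain i j where [simp]: "p = (i, j)" by fastforce
  have "(i, j) \<in> J" using p by (auto simp: M_set_def maximal_elements_def)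
  moreover from this have "1 \<le> i" "i \<le> int n" using order_ideal_P[OF assms] by (auto simp: P_set_iff)
  ultimately have "(i, i) \<in> J \<inter> Q" using order_ideal_diag[OF assms, of i j i] diag_in_Q by simp
  then show "case p of (i, j) \<Rightarrow> (i, i) \<in> M_set Q J" by (simp add: M_set_def)
qed

text \<open>By \<open>row_cycle_base\<close> this is the largest column in row \<open>i\<close> of
  \<open>M_set Q J\<close>, provided that J meets this row. It is the datum of J that the lowest
  monomials record.\<close>

definition row_max :: "(int \<times> int) set \<Rightarrow> int \<Rightarrow> int" where
  "row_max J i = row_cycle n (M_set Q J) i i"

lemma row_max:
  assumes "J \<in> order_ideals n" "(i, i) \<in> J"
  shows "(i, row_max J i) \<in> M_set Q J" "(i, row_max J i) \<in> J"
    and "\<And>z. (i, z) \<in> M_set Q J \<Longrightarrow> pos n z \<le> pos n (row_max J i)"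
proof -
  have "1 \<le> i" "i \<le> int n" using assms(2) order_ideal_P[OF assms(1)] by (auto simp: P_set_iff)
  then have "(i, i) \<in> M_set Q J" using assms(2) diag_in_Q by (simp add: M_set_def)
  note * = row_cycle_base[OF diagonal_M[OF assms(1)] this]
  show "(i, row_max J i) \<in> M_set Q J" unfolding row_max_def by (rule *)
  then show "(i, row_max J i) \<in> J" by (auto simp: M_set_def maximal_elements_def)
  show "\<And>z. (i, z) \<in> M_set Q J \<Longrightarrow> pos n z \<le> pos n (row_max J i)"
    unfolding row_max_def by (rule *)
qed

text \<open>An element of \<open>M_set Q J\<close> outside \<open>Q\<close> can only have entered as
  a maximal element of J.\<close>

lemma maximal_M_notin_Q:
  assumes "p \<in> M_set Q J" "p \<notin> Q" "q \<in> J" "P_le p q"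
  shows "q = p"
  using assms by (auto simp: M_set_def maximal_elements_def)

text \<open>A pipe that enters row \<open>r\<close> from below does not see the difference between \<open>M_set Q J\<close> and \<open>Q\<close>.\<close>

lemma row_cycle_M_eq:
  assumes J: "J \<in> order_ideals n" and ic: "(i, c) \<in> J" and r: "1 \<le> r" "r < i"
    and y: "y \<in> N_set n" "r < \<bar>y\<bar>" "pos n y \<le> pos n c"
  shows "row_cycle n (M_set Q J) r y = row_cycle n Q r y"
    and "pos n (row_cycle n Q r y) \<le> pos n c"
proof -
  let ?M = "M_set Q J"
  have dM: "diagonal n ?M" by (rule diagonal_M[OF J])
  have icP: "(i, c) \<in> P_set n" using ic order_ideal_P[OF J] by blast
  have ryP: "(r, y) \<in> P_set n" using icP r y by (auto simp: P_set_iff)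
  have ryJ: "(r, y) \<in> J" using order_ideal_down[OF J ic ryP] r y by simp
  have ne: "y \<noteq> r" using r y by auto
  have "row_cycle n ?M r y = row_cycle n Q r y \<and> pos n (row_cycle n Q r y) \<le> pos n c"
  proof (cases "(r, y) \<in> Q")
    case True
    then have M: "(r, y) \<in> ?M" using ryJ by (simp add: M_set_def)
    define a b where "a = row_cycle n Q r y" and "b = row_cycle n ?M r y"
    note a = row_cycle_step[OF diagonal_Q True ne, folded a_def]
    note b = row_cycle_step[OF dM M ne, folded b_def]
    have bJ: "(r, b) \<in> J" using b(1) by (auto simp: M_set_def maximal_elements_def)
    have aP: "(r, a) \<in> P_set n" "(r, b) \<in> P_set n" using a(1) Q_sub_P bJ order_ideal_P[OF J] by auto
    have "(r, a) \<in> J" using order_ideal_down[OF J ryJ aP(1)] a(2) by simp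
    then have "(r, a) \<in> ?M" using a(1) by (simp add: M_set_def)
    then have "pos n a \<le> pos n b" using b(3) a(2) by blast
    \<comment> \<open>Outside \<open>Q\<close>, \<open>(r, b)\<close> would be a maximal element of
      J, although \<open>(r, y)\<close> lies strictly above it in J.\<close>
    moreover have "(r, b) \<in> Q"
    proof (rule ccontr)
      assume "(r, b) \<notin> Q"
      moreover have "P_le (r, b) (r, y)" using aP ryP b(2) by (simp add: P_le_iff)
      ultimately have "(r, y) = (r, b)" using maximal_M_notin_Q[OF b(1)] ryJ by blast
      then show False using b(2) by simp
    qed
    then have "pos n b \<le> pos n a" using a(3) b(2) by blast
    ultimately have "a = b" using aP pos_eq_iff[of a n b] by (simp add: P_set_iff)
    then show ?thesis using a(2) y(3) by (simp add: a_def b_def)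
  next
    case False
    have "(r, y) \<notin> ?M"
    proof
      assume "(r, y) \<in> ?M"
      moreover have "P_le (r, y) (i, c)" using ryP icP r y by (simp add: P_le_iff)
      ultimately have "(i, c) = (r, y)" using maximal_M_notin_Q False ic by blast
      then show False using r by simp
    qed
    then show ?thesis
      using row_cycle_fixed[OF dM] row_cycle_fixed[OF diagonal_Q False] ne y(3) by simp
  qed
  then show "row_cycle n ?M r y = row_cycle n Q r y" "pos n (row_cycle n Q r y) \<le> pos n c" by auto
qed

text \<open>Let s be the column whose pipe for \<open>Q\<close> leaves row i at
  \<open>row_max J i\<close>. The rows beyond i fix i, so the pipe of i for \<open>M_set Q J\<close>
  leaves row i at the same place. In the rows r < i the two sets act alike on it by
  \<open>row_cycle_M_eq\<close>, so both pipes end at the same column and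
  \<open>w_ideal n Q J i\<close> is s.\<close>

lemma w_ideal_rows:
  assumes J: "J \<in> order_ideals n" and iJ: "(i, i) \<in> J" and r: "1 \<le> r" "r \<le> i"
  shows "G i (w_ideal n Q J i) = row_max J i"
    and "pos n (G r (w_ideal n Q J i)) \<le> pos n (row_max J i)"
    and "G r (w_ideal n Q J i) \<in> N_set n" "r \<le> \<bar>G r (w_ideal n Q J i)\<bar>"
proof -
  let ?M = "M_set Q J" and ?c = "row_max J i"
  have dM: "diagonal n ?M" by (rule diagonal_M[OF J])
  have iP: "(i, i) \<in> P_set n" using iJ order_ideal_P[OF J] by blast
  then have i: "1 \<le> i" "i \<le> int n" by (simp_all add: P_set_iff)
  have cP: "(i, ?c) \<in> P_set n" using row_max(2)[OF J iJ] order_ideal_P[OF J] by blast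
  define s where "s = inv_into UNIV (G i) ?c"
  have Gs: "G i s = ?c"
    unfolding s_def using bij_tail_perm[of n Q i] by (simp add: bij_is_surj surj_f_inv_f)
  have inv: "tail_perm n ?M (i - int d) i = G (i - int d) s \<and> pos n (G (i - int d) s) \<le> pos n ?c \<and>
      G (i - int d) s \<in> N_set n \<and> i - int d \<le> \<bar>G (i - int d) s\<bar>" if "int d \<le> i - 1" for d
    using that
  proof (induction d)
    case 0
    have "tail_perm n ?M i i = row_cycle n ?M i i"
      using tail_perm_fixed[OF dM, of i "i + 1"] i by (simp add: tail_perm_rec)
    then show ?case using Gs cP by (simp add: row_max_def P_set_iff)
  next
    case (Suc d)
    define r where "r = i - int (Suc d)"
    have r: "i - int d = r + 1" "1 \<le> r" "r < i" "r \<le> int n" using Suc.prems i by (auto simp: r_def)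
    define y where "y = G (r + 1) s"
    have y: "tail_perm n ?M (r + 1) i = y" "pos n y \<le> pos n ?c" "y \<in> N_set n" "r < \<bar>y\<bar>"
      using Suc.IH Suc.prems unfolding r(1) y_def by auto
    note eq = row_cycle_M_eq[OF J row_max(2)[OF J iJ] r(2,3) y(3,4,2)]
    have "row_cycle n Q r y \<in> N_set n \<and> r \<le> \<bar>row_cycle n Q r y\<bar>"
      using row_cycle_region[OF diagonal_Q r(2), of r y] r y by simp
    then show ?case
      unfolding r_def[symmetric] tail_perm_rec[OF r(4)] y(1) y_def[symmetric] using eq by simp
  qed
  have "w_perm n ?M i = w_perm n Q s"
    using inv[of "nat (i - 1)"] i by (simp add: w_perm_eq)
  then have ws: "w_ideal n Q J i = s"
    unfolding w_ideal_def w_perm_eq using bij_tail_perm[of n Q 1] by (simp add: bij_is_inj)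
  show "G i (w_ideal n Q J i) = row_max J i" unfolding ws by (rule Gs)
  show "pos n (G r (w_ideal n Q J i)) \<le> pos n (row_max J i)" "G r (w_ideal n Q J i) \<in> N_set n"
    "r \<le> \<bar>G r (w_ideal n Q J i)\<bar>"
    unfolding ws using inv[of "nat (i - r)"] r by auto
qed

lemma inj_G: "G i x = G i y \<longleftrightarrow> x = y"
  using bij_tail_perm[of n Q i] by (auto simp: bij_def inj_def)

text \<open>\<open>G i\<close> maps the finite region injectively into itself, hence onto itself;
  being injective everywhere, it brings nothing in from outside.\<close>

lemma G_region_rev:
  assumes "1 \<le> m" "m \<le> i" "G i x \<in> N_set n" "m \<le> \<bar>G i x\<bar>"
  shows "x \<in> N_set n \<and> m \<le> \<bar>x\<bar>"
proof -
  let ?R = "{y \<in> N_set n. m \<le> \<bar>y\<bar>}"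
  have "G i ` ?R \<subseteq> ?R" using tail_perm_region[OF diagonal_Q assms(1,2)] by blast
  moreover have "inj_on (G i) ?R" using inj_G by (simp add: inj_on_def)
  ultimately have "G i ` ?R = ?R" by (intro endo_inj_surj) simp_all
  then obtain y where "y \<in> ?R" "G i y = G i x" using assms by (metis (mono_tags, lifting) imageE mem_Collect_eq)
  then show ?thesis by (simp add: inj_G)
qed

text \<open>Ensures that the diagonal product of the minor uses only entries at positions of the
  poset, where \<open>isotropic_matrix\<close> is a single monomial.\<close>

lemma w_ideal_P:
  assumes J: "J \<in> order_ideals n" and iJ: "(i, i) \<in> J"
  shows "(i, w_ideal n Q J i) \<in> P_set n"
proof -
  have "(i, i) \<in> P_set n" using iJ order_ideal_P[OF J] by blast
  then have i: "1 \<le> i" "i \<le> int n" by (simp_all add: P_set_iff)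
  show ?thesis
    using w_ideal_rows(3,4)[OF J iJ i(1) order_refl]
      G_region_rev[OF i(1) order_refl] i by (simp add: P_set_iff)
qed

text \<open>The position of column \<open>j\<close> in the order in which row \<open>i\<close> prefers columns. The columns of the tuple
  of \<open>J\<close> are matched to the rows greedily: row \<open>i\<close> takes its favourite among those not taken by the rows
  before it.\<close>

definition rank :: "int \<Rightarrow> int \<Rightarrow> nat" where
  "rank i j = (if j = i then 0 else nat (2 * int n + 1 - pos n (G (i + 1) j)))"

text \<open>Let e and y be the columns at which the pipes of w(i) and w(l) enter row i; outside the
  diagonal case a later entry means a smaller rank. If e came no later than y, then (i, e) would lie
  in J below (l, \<open>row_max J l\<close>). For (i, e) in \<open>Q\<close> this contradicts that
  row i moves e strictly back to the row maximum. Outside \<open>Q\<close> the row fixes e, so (i,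
  e) would be a maximal element of J with another element above it.\<close>

lemma rank_less:
  assumes J: "J \<in> order_ideals n" and lJ: "(l, l) \<in> J" and i: "1 \<le> i" "i < l"
  shows "rank i (w_ideal n Q J i) < rank i (w_ideal n Q J l)"
proof -
  define t u where "t = w_ideal n Q J i" and "u = w_ideal n Q J l"
  have iJ: "(i, i) \<in> J" using order_ideal_diag[OF J lJ] i by simp
  have in': "i \<le> int n" using iJ order_ideal_P[OF J] by (auto simp: P_set_iff)
  have tP: "(i, t) \<in> P_set n" and uP: "(l, u) \<in> P_set n"
    using w_ideal_P[OF J] iJ lJ by (simp_all add: t_def u_def)
  have ui: "u \<noteq> i" using uP i by (auto simp: P_set_iff)
  define y where "y = G (i + 1) u"
  have y: "pos n y \<le> pos n (row_max J l)" "y \<in> N_set n" "i + 1 \<le> \<bar>y\<bar>"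
    using w_ideal_rows(2-4)[OF J lJ, of "i + 1"] i by (simp_all add: y_def u_def)
  have lcJ: "(l, row_max J l) \<in> J" by (rule row_max(2)[OF J lJ])
  then have lcP: "(l, row_max J l) \<in> P_set n" using order_ideal_P[OF J] by blast
  have iyP: "(i, y) \<in> P_set n" using y i in' by (simp add: P_set_iff)
  have iyJ: "(i, y) \<in> J" using order_ideal_down[OF J lcJ iyP] i y by simp
  have ru: "rank i u = nat (2 * int n + 1 - pos n y)" using ui by (simp add: rank_def y_def)
  show ?thesis
  proof (cases "t = i")
    case True
    then show ?thesis using ru pos_range[OF y(2)] by (simp add: rank_def flip: t_def u_def)
  next
    case False
    define e where "e = G (i + 1) t"
    have e: "e \<in> N_set n" "i \<le> \<bar>e\<bar>"
      using tail_perm_region[OF diagonal_Q i(1), of "i + 1" t] tP by (auto simp: P_set_iff e_def)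
    have "G (i + 1) i = i" using tail_perm_fixed[OF diagonal_Q] i by simp
    then have "e \<noteq> i" using False inj_G unfolding e_def by metis
    have ce: "row_max J i = row_cycle n Q i e"
      using w_ideal_rows(1)[OF J iJ i(1) order_refl] in'
      by (simp add: tail_perm_rec e_def t_def)
    have ieP: "(i, e) \<in> P_set n" using e i in' by (simp add: P_set_iff)
    have "pos n y < pos n e"
    proof (rule ccontr)
      assume "\<not> pos n y < pos n e"
      then have le: "pos n e \<le> pos n y" by simp
      have ieJ: "(i, e) \<in> J" using order_ideal_down[OF J iyJ ieP] le by simp
      show False
      proof (cases "(i, e) \<in> Q")
        case True
        then have "(i, e) \<in> M_set Q J" using ieJ by (simp add: M_set_def)
        then have "pos n e \<le> pos n (row_max J i)" by (rule row_max(3)[OF J iJ])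
        then show False using row_cycle_step(2)[OF diagonal_Q True \<open>e \<noteq> i\<close>] ce by simp
      next
        case False
        then have "row_max J i = e" using ce row_cycle_fixed[OF diagonal_Q False] \<open>e \<noteq> i\<close> by simp
        then have "(i, e) \<in> M_set Q J" using row_max(1)[OF J iJ] by simp
        moreover have "P_le (i, e) (l, row_max J l)" using ieP lcP le y(1) i by (simp add: P_le_iff)
        ultimately have "(l, row_max J l) = (i, e)" using maximal_M_notin_Q False lcJ by blast
        then show False using i by simp
      qed
    qed
    then show ?thesis
      using ru False pos_range[OF e(1)] by (simp add: rank_def flip: t_def u_def e_def)
  qed
qed

text \<open>A pipe enters at a position between 1 and 2n, so ranks are at most 2n. This is the
  origin of the base 2n + 1 in \<open>pipe_weight\<close>.\<close>

lemma rank_bound: "(i, j) \<in> P_set n \<Longrightarrow> rank i j < 2 * n + 1"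
  using tail_perm_region[OF diagonal_Q, of 1 "i + 1" j] pos_range[of "G (i + 1) j" n]
  by (auto simp: rank_def P_set_iff)

text \<open>Within \<open>Q\<close> nothing of J is lost in \<open>M_set Q J\<close>, so the row
  maximum bounds it; conversely the row maximum lies in J, and J is a lower set.\<close>

lemma in_ideal_iff:
  assumes J: "J \<in> order_ideals n" and q: "(i, j) \<in> Q"
  shows "(i, j) \<in> J \<longleftrightarrow> (i, i) \<in> J \<and> pos n j \<le> pos n (row_max J i)"
proof
  assume ij: "(i, j) \<in> J"
  have "1 \<le> i" using q Q_sub_P by (auto simp: P_set_iff)
  then have "(i, i) \<in> J" using order_ideal_diag[OF J ij] by simp
  moreover from this have "pos n j \<le> pos n (row_max J i)"
    using row_max(3)[OF J] ij q by (simp add: M_set_def)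
  ultimately show "(i, i) \<in> J \<and> pos n j \<le> pos n (row_max J i)" by simp
next
  assume *: "(i, i) \<in> J \<and> pos n j \<le> pos n (row_max J i)"
  then show "(i, j) \<in> J"
    using order_ideal_down[OF J row_max(2)[OF J], of i i j] q Q_sub_P by auto
qed

text \<open>Outside \<open>Q\<close> only the maximal elements of J survive in
  \<open>M_set Q J\<close>, and a maximal element of J is the last one in its row. Hence the row
  maxima reveal maximality here, but not membership.\<close>

lemma maximal_iff:
  assumes J: "J \<in> order_ideals n" and q: "(i, j) \<in> P_set n" "(i, j) \<notin> Q"
  shows "(i, j) \<in> maximal_elements J \<longleftrightarrow> (i, i) \<in> J \<and> row_max J i = j"
proof
  assume m: "(i, j) \<in> maximal_elements J"
  then have ij: "(i, j) \<in> J" by (simp add: maximal_elements_def)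
  have iJ: "(i, i) \<in> J" using order_ideal_diag[OF J ij] q by (simp add: P_set_iff)
  have "(i, j) \<in> M_set Q J" using m by (simp add: M_set_def)
  then have "pos n j \<le> pos n (row_max J i)" by (rule row_max(3)[OF J iJ])
  moreover have cJ: "(i, row_max J i) \<in> J" by (rule row_max(2)[OF J iJ])
  ultimately have "P_le (i, j) (i, row_max J i)"
    using q order_ideal_P[OF J] by (subst P_le_iff) auto
  then have "(i, row_max J i) = (i, j)" using m cJ unfolding maximal_elements_def by blast
  then show "(i, i) \<in> J \<and> row_max J i = j" using iJ by simp
next
  assume "(i, i) \<in> J \<and> row_max J i = j"
  then show "(i, j) \<in> maximal_elements J"
    using row_max(1)[OF J] q(2) by (auto simp: M_set_def)
qed

end

section \<open>Linear independence of the chain products\<close>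

lemma length_filter_fibres:
  "finite C \<Longrightarrow> length (filter (\<lambda>x. P x \<and> f x \<in> C) xs) = (\<Sum>c\<in>C. length (filter (\<lambda>x. P x \<and> f x = c) xs))"
proof (induction xs)
  case (Cons x xs)
  have "(\<Sum>c\<in>C. length (filter (\<lambda>x. P x \<and> f x = c) (x # xs))) =
      (\<Sum>c\<in>C. (if P x \<and> f x = c then 1 else 0) + length (filter (\<lambda>x. P x \<and> f x = c) xs))"
    by (intro sum.cong) auto
  also have "\<dots> = (\<Sum>c\<in>C. if P x \<and> f x = c then 1 else 0) +
      (\<Sum>c\<in>C. length (filter (\<lambda>x. P x \<and> f x = c) xs))"
    by (rule sum.distrib)
  also have "(\<Sum>c\<in>C. if P x \<and> f x = c then 1 else 0) = (if P x \<and> f x \<in> C then 1 else (0 :: nat))"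
    using Cons.prems by (cases "P x") simp_all
  finally show ?case using Cons by simp
qed simp

text \<open>The entries satisfying \<open>P\<close> form a final segment, and its length tells where
  it starts. For a chain of sets and \<open>P\<close> membership of a fixed element, counts thus
  determine the chain.\<close>

lemma nth_monotone_filter:
  assumes "sorted_wrt (\<lambda>x y. P x \<longrightarrow> P y) xs" "a < length xs"
  shows "P (xs ! a) \<longleftrightarrow> length xs \<le> a + length (filter P xs)"
  using assms
proof (induction xs arbitrary: a)
  case (Cons x xs)
  show ?case
  proof (cases "P x")
    case True
    then have all: "\<forall>y\<in>set (x # xs). P y" using Cons.prems(1) by auto
    then have "P ((x # xs) ! a)" using Cons.prems(2) nth_mem by blast
    moreover have "filter P (x # xs) = x # xs" using all by (simp add: filter_id_conv)
    ultimately show ?thesis by simp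
  next
    case False
    show ?thesis
    proof (cases a)
      case 0
      have "length (filter P xs) \<le> length xs" by (rule length_filter_le)
      then show ?thesis using False 0 by (simp add: not_le less_Suc_eq_le)
    next
      case (Suc b)
      then show ?thesis using Cons False by simp
    qed
  qed
qed simp

lemma sum_list_lookup:
  "Poly_Mapping.lookup (sum_list (map f xs)) v = sum_list (map (\<lambda>x. Poly_Mapping.lookup (f x) v) xs)"
  by (induction xs) (simp_all add: lookup_add)

lemma sum_list_of_bool: "sum_list (map (\<lambda>x. if P x then 1 else 0) xs) = length (filter P xs)"
  by (induction xs) simp_all

definition ideal_chains :: "nat \<Rightarrow> (int \<times> int) set list set" where
  "ideal_chains n = {Js. set Js \<subseteq> order_ideals n - {{}} \<and> sorted_wrt (\<subseteq>) Js}"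

lemma order_ideal_nonempty:
  assumes "J \<in> order_ideals n" "J \<noteq> {}"
  shows "(1, 1) \<in> J" "1 \<le> card (J \<inter> A_set n)"
proof -
  obtain i j where ij: "(i, j) \<in> J" using assms(2) by fastforce
  then have i: "1 \<le> i" "i \<le> int n" using order_ideal_P[OF assms(1)] by (auto simp: P_set_iff)
  show *: "(1, 1) \<in> J" using order_ideal_diag[OF assms(1) ij, of 1] i by simp
  then show "1 \<le> card (J \<inter> A_set n)" using order_ideal_diag_iff[OF assms(1), of 1] i by simp
qed

section \<open>Lowest monomials of ideals and of chains\<close>

definition pipe_monomial :: "int \<Rightarrow> int \<Rightarrow> int \<times> int \<Rightarrow>\<^sub>0 nat" where
  "pipe_monomial i j =
    (if i = j then Poly_Mapping.single (i, i) 1 else Poly_Mapping.single (i, i) 1 + Poly_Mapping.single (i, j) 1)"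

lemma isotropic_matrix_pipe:
  "(i, j) \<in> P_set n \<Longrightarrow> isotropic_matrix n (i, j) = Poly_Mapping.single (pipe_monomial i j) 1"
  by (simp add: isotropic_matrix_P pipe_monomial_def cvar_def mult_single)

lemma lookup_pipe_monomial:
  "Poly_Mapping.lookup (pipe_monomial i' j') (i, j) =
    (if i' = i \<and> (j = i \<or> j' = j) then 1 else 0)"
  by (auto simp: pipe_monomial_def lookup_add lookup_single when_def)

context pipes
begin

definition ideal_tuple :: "(int \<times> int) set \<Rightarrow> int list" where
  "ideal_tuple J = map (w_ideal n Q J) [1..int (card (J \<inter> A_set n))]"

lemma ideal_tuple_nth:
  "r < card (J \<inter> A_set n) \<Longrightarrow> ideal_tuple J ! r = w_ideal n Q J (int r + 1)"
  by (simp add: ideal_tuple_def add.commute)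

lemma length_ideal_tuple [simp]: "length (ideal_tuple J) = card (J \<inter> A_set n)"
  by (simp add: ideal_tuple_def)

lemma ideal_tuple_P:
  assumes J: "J \<in> order_ideals n" and r: "r < card (J \<inter> A_set n)"
  shows "(int r + 1, int r + 1) \<in> J" "(int r + 1, ideal_tuple J ! r) \<in> P_set n"
proof -
  have "card (J \<inter> A_set n) \<le> n" using card_diag_le order_ideal_P[OF J] by blast
  then show *: "(int r + 1, int r + 1) \<in> J" using order_ideal_diag_iff[OF J, of "int r + 1"] r by simp
  show "(int r + 1, ideal_tuple J ! r) \<in> P_set n"
    unfolding ideal_tuple_nth[OF r] by (rule w_ideal_P[OF J *])
qed

lemma ideal_tuple_N: "J \<in> order_ideals n \<Longrightarrow> set (ideal_tuple J) \<subseteq> N_set n"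
  using ideal_tuple_P(2) by (fastforce simp: in_set_conv_nth P_set_iff)

text \<open>The powers make a difference of rank in row i outweigh the diagonal entries of all later
  rows, as \<open>lowest_minor\<close> requires. The scaling variables have weight 0, in accordance
  with rank 0 of the diagonal column.\<close>

definition pipe_weight :: "int \<times> int \<Rightarrow> nat" where
  "pipe_weight = (\<lambda>(i, j). if i = j then 0 else (2 * n + 1) ^ (n - nat i) * rank i j)"

definition ideal_monomial :: "(int \<times> int) set \<Rightarrow> int \<times> int \<Rightarrow>\<^sub>0 nat" where
  "ideal_monomial J = (\<Sum>r<card (J \<inter> A_set n). pipe_monomial (int r + 1) (ideal_tuple J ! r))"

lemma lowest_ideal_tuple:
  assumes J: "J \<in> order_ideals n"
  shows "lowest pipe_weight (isotropic_eval n (X_tuple (ideal_tuple J))) (ideal_monomial J)"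
proof -
  let ?t = "ideal_tuple J"
  have "lowest pipe_weight (minor (isotropic_matrix n) ?t)
      (\<Sum>r<length ?t. pipe_monomial (int r + 1) (?t ! r))"
  proof (rule lowest_minor[where B = "2 * n + 1" and \<rho> = "\<lambda>r. rank (int r + 1)"])
    show "length ?t \<le> n" using card_diag_le order_ideal_P[OF J] by simp
    have P: "(int r + 1, ?t ! c) \<in> P_set n" if "r \<le> c" "c < length ?t" for r c
      using ideal_tuple_P(2)[OF J, of c] that by (auto simp: P_set_iff)
    fix r c
    show "isotropic_matrix n (int r + 1, ?t ! c) = Poly_Mapping.single (pipe_monomial (int r + 1) (?t ! c)) 1"
      if "r \<le> c" "c < length ?t"
      by (rule isotropic_matrix_pipe[OF P[OF that]])
    show "weight pipe_weight (pipe_monomial (int r + 1) (?t ! c)) =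
        (2 * n + 1) ^ (n - Suc r) * rank (int r + 1) (?t ! c)" if "r \<le> c" "c < length ?t"
    proof -
      have "nat (int r + 1) = Suc r" by simp
      then show ?thesis
        by (simp add: pipe_monomial_def weight_add weight_single pipe_weight_def rank_def)
    qed
    show "rank (int r + 1) (?t ! r) < rank (int r + 1) (?t ! c)" if "r < c" "c < length ?t"
      using rank_less[OF J ideal_tuple_P(1)[OF J], of c "int r + 1"] that
      by (simp add: ideal_tuple_nth)
    show "rank (int r + 1) (?t ! r) < 2 * n + 1" if "r < length ?t"
      using P[of r r] that by (intro rank_bound) simp
  qed
  then show ?thesis by (simp add: isotropic_eval_X_tuple[OF ideal_tuple_N[OF J]] ideal_monomial_def)
qed

definition chain_product :: "(int \<times> int) set list \<Rightarrow> int list cpoly" where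
  "chain_product Js = prod_list (map (\<lambda>J. X_tuple (ideal_tuple J)) Js)"

definition chain_monomial :: "(int \<times> int) set list \<Rightarrow> int \<times> int \<Rightarrow>\<^sub>0 nat" where
  "chain_monomial Js = sum_list (map ideal_monomial Js)"

lemma isotropic_eval_prod_list:
  "isotropic_eval n (prod_list (map f xs)) = prod_list (map (\<lambda>x. isotropic_eval n (f x)) xs)"
  unfolding isotropic_eval_def by (induction xs) (simp_all add: ph.hom_one cpoly_hom_mult)

lemma lowest_chain_product:
  "set Js \<subseteq> order_ideals n \<Longrightarrow> lowest pipe_weight (isotropic_eval n (chain_product Js)) (chain_monomial Js)"
  unfolding chain_product_def chain_monomial_def isotropic_eval_prod_list
  by (intro lowest_prod_list lowest_ideal_tuple) blast

lemma lookup_ideal_monomial: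
  assumes J: "J \<in> order_ideals n" and i: "1 \<le> i" "i \<le> int n"
  shows "Poly_Mapping.lookup (ideal_monomial J) (i, j) =
    (if (i, i) \<in> J \<and> (j = i \<or> w_ideal n Q J i = j) then 1 else 0)"
proof -
  define k s where "k = card (J \<inter> A_set n)" and "s = nat (i - 1)"
  have s: "i = int s + 1" using i by (simp add: s_def)
  have "Poly_Mapping.lookup (ideal_monomial J) (i, j) =
      (\<Sum>r<k. if r = s then (if j = i \<or> ideal_tuple J ! r = j then 1 else 0) else 0)"
    unfolding ideal_monomial_def lookup_sum lookup_pipe_monomial k_def[symmetric]
    by (intro sum.cong) (auto simp: s)
  also have "\<dots> = (if s < k \<and> (j = i \<or> ideal_tuple J ! s = j) then 1 else 0)" by simp
  also have "s < k \<longleftrightarrow> (i, i) \<in> J"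
    using order_ideal_diag_iff[OF J i] s by (auto simp: k_def)
  also have "(if (i, i) \<in> J \<and> (j = i \<or> ideal_tuple J ! s = j) then 1 else 0) =
      (if (i, i) \<in> J \<and> (j = i \<or> w_ideal n Q J i = j) then 1 else (0 :: nat))"
    using \<open>s < k \<longleftrightarrow> (i, i) \<in> J\<close> ideal_tuple_nth[of s J] s by (auto simp: k_def)
  finally show ?thesis .
qed

lemma lookup_chain_monomial:
  assumes "set Js \<subseteq> order_ideals n" "1 \<le> i" "i \<le> int n"
  shows "Poly_Mapping.lookup (chain_monomial Js) (i, j) =
    length (filter (\<lambda>J. (i, i) \<in> J \<and> (j = i \<or> w_ideal n Q J i = j)) Js)"
proof -
  have "Poly_Mapping.lookup (chain_monomial Js) (i, j) =
      sum_list (map (\<lambda>J. if (i, i) \<in> J \<and> (j = i \<or> w_ideal n Q J i = j) then 1 else 0) Js)"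
    unfolding chain_monomial_def sum_list_lookup
    using assms by (intro arg_cong[where f = sum_list] map_cong refl lookup_ideal_monomial) auto
  then show ?thesis unfolding sum_list_of_bool .
qed

text \<open>The exponent of (i, j) for j other than i counts the ideals with w(i) = j, and that of
  (i, i) counts all ideals containing (i, i); the multiplicity of w(i) = i follows by subtraction.
  The bijection \<open>G i\<close> turns w(i) into the row maximum.\<close>

lemma chain_monomial_row_max:
  assumes Js: "set Js \<subseteq> order_ideals n" "set Js' \<subseteq> order_ideals n"
    and eq: "chain_monomial Js = chain_monomial Js'" and i: "1 \<le> i" "i \<le> int n"
  shows "length (filter (\<lambda>J. (i, i) \<in> J \<and> row_max J i = c) Js) =
    length (filter (\<lambda>J. (i, i) \<in> J \<and> row_max J i = c) Js')"
proof -
  let ?n = "\<lambda>Js j. length (filter (\<lambda>J. (i, i) \<in> J \<and> w_ideal n Q J i = j) Js)"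
  have off: "?n Js j = ?n Js' j" if "j \<noteq> i" for j
    using lookup_chain_monomial[OF Js(1) i, of j] lookup_chain_monomial[OF Js(2) i, of j] eq that by simp
  have total: "length (filter (\<lambda>J. (i, i) \<in> J) Ks) = ?n Ks i + (\<Sum>j\<in>N_set n - {i}. ?n Ks j)"
    if Ks: "set Ks \<subseteq> order_ideals n" for Ks
  proof -
    have "filter (\<lambda>J. (i, i) \<in> J) Ks = filter (\<lambda>J. (i, i) \<in> J \<and> w_ideal n Q J i \<in> N_set n) Ks"
      using Ks w_ideal_P by (intro filter_cong refl) (auto simp: P_set_iff)
    then have "length (filter (\<lambda>J. (i, i) \<in> J) Ks) = (\<Sum>j\<in>N_set n. ?n Ks j)"
      by (simp add: length_filter_fibres)
    also have "\<dots> = ?n Ks i + (\<Sum>j\<in>N_set n - {i}. ?n Ks j)"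
      using i by (intro sum.remove) simp_all
    finally show ?thesis .
  qed
  have "length (filter (\<lambda>J. (i, i) \<in> J) Js) = length (filter (\<lambda>J. (i, i) \<in> J) Js')"
    using lookup_chain_monomial[OF Js(1) i, of i] lookup_chain_monomial[OF Js(2) i, of i] eq by simp
  moreover have "(\<Sum>j\<in>N_set n - {i}. ?n Js j) = (\<Sum>j\<in>N_set n - {i}. ?n Js' j)"
    by (intro sum.cong refl off) simp
  ultimately have diag: "?n Js i = ?n Js' i" using total[OF Js(1)] total[OF Js(2)] by simp
  have rw: "filter (\<lambda>J. (i, i) \<in> J \<and> row_max J i = c) Ks =
      filter (\<lambda>J. (i, i) \<in> J \<and> w_ideal n Q J i = inv_into UNIV (G i) c) Ks"
    if Ks: "set Ks \<subseteq> order_ideals n" for Ks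
  proof (intro filter_cong refl conj_cong)
    fix J assume "J \<in> set Ks" "(i, i) \<in> J"
    then have "G i (w_ideal n Q J i) = row_max J i" using w_ideal_rows(1)[of J i i] Ks i by auto
    then show "row_max J i = c \<longleftrightarrow> w_ideal n Q J i = inv_into UNIV (G i) c"
      using bij_tail_perm[of n Q i] by (metis bij_inv_eq_iff)
  qed
  have "?n Js j = ?n Js' j" for j using off diag by (cases "j = i") auto
  then show ?thesis unfolding rw[OF Js(1)] rw[OF Js(2)] .
qed

text \<open>It suffices to know for every q how many members of the chain contain q. In
  \<open>Q\<close> the row maxima give this number. Outside \<open>Q\<close> they only tell for how
  many members q is maximal; the other members containing q also contain something above q, and
  those are known by induction from the top of the poset.\<close>

lemma chain_eqI:
  assumes chains: "Js \<in> ideal_chains n" "Js' \<in> ideal_chains n" and n: "1 \<le> n"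
    and eq: "\<And>i c. 1 \<le> i \<Longrightarrow> i \<le> int n \<Longrightarrow>
      length (filter (\<lambda>J. (i, i) \<in> J \<and> row_max J i = c) Js) =
      length (filter (\<lambda>J. (i, i) \<in> J \<and> row_max J i = c) Js')"
  shows "Js = Js'"
proof -
  have ideals: "set Ks \<subseteq> order_ideals n" if "Ks \<in> ideal_chains n" for Ks
    using that by (auto simp: ideal_chains_def)
  have inQ: "length (filter (\<lambda>J. q \<in> J) Js) = length (filter (\<lambda>J. q \<in> J) Js')" if q: "q \<in> Q" for q
  proof -
    obtain i j where [simp]: "q = (i, j)" by fastforce
    have i: "1 \<le> i" "i \<le> int n" using q Q_sub_P by (auto simp: P_set_iff)
    let ?C = "{c \<in> N_set n. pos n j \<le> pos n c}"
    have rw: "filter (\<lambda>J. q \<in> J) Ks = filter (\<lambda>J. (i, i) \<in> J \<and> row_max J i \<in> ?C) Ks"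
      if Ks: "set Ks \<subseteq> order_ideals n" for Ks
    proof (intro filter_cong refl)
      fix J assume "J \<in> set Ks"
      then have J: "J \<in> order_ideals n" using Ks by blast
      have "row_max J i \<in> N_set n" if "(i, i) \<in> J"
        using row_max(2)[OF J that] order_ideal_P[OF J] by (auto simp: P_set_iff)
      then show "q \<in> J \<longleftrightarrow> (i, i) \<in> J \<and> row_max J i \<in> ?C"
        using in_ideal_iff[OF J, of i j] q by auto
    qed
    have "finite ?C" by simp
    note fibres = length_filter_fibres[OF this]
    show ?thesis
      unfolding rw[OF ideals[OF chains(1)]] rw[OF ideals[OF chains(2)]] fibres eq[OF i] ..
  qed
  have len: "length Ks = length (filter (\<lambda>J. (1, 1) \<in> J) Ks)" if "Ks \<in> ideal_chains n" for Ks
  proof -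
    have "filter (\<lambda>J. (1, 1) \<in> J) Ks = Ks"
      using that order_ideal_nonempty(1) unfolding filter_id_conv ideal_chains_def by blast
    then show ?thesis by simp
  qed
  have "(1, 1) \<in> Q" using diag_in_Q[of 1] n by simp
  then have m: "length Js = length Js'" using inQ len[OF chains(1)] len[OF chains(2)] by simp
  have nth: "q \<in> Ks ! a \<longleftrightarrow> length Ks \<le> a + length (filter (\<lambda>J. q \<in> J) Ks)"
    if "Ks \<in> ideal_chains n" "a < length Ks" for Ks a q
  proof (rule nth_monotone_filter[OF _ that(2)])
    have "sorted_wrt (\<subseteq>) Ks" using that(1) by (simp add: ideal_chains_def)
    then show "sorted_wrt (\<lambda>J J'. q \<in> J \<longrightarrow> q \<in> J') Ks"
      by (rule sorted_wrt_mono_rel[rotated]) blast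
  qed
  \<comment> \<open>Decreases on passing to a larger element of the poset, so the induction starts
    at the top.\<close>
  define h where "h = (\<lambda>(i, j). nat (int n - i + (2 * int n - pos n j)))"
  have all: "length (filter (\<lambda>J. q \<in> J) Js) = length (filter (\<lambda>J. q \<in> J) Js')" if "q \<in> P_set n" for q
    using that
  proof (induction "h q" arbitrary: q rule: less_induct)
    case less
    obtain i j where [simp]: "q = (i, j)" by fastforce
    have i: "1 \<le> i" "i \<le> int n" using less.prems by (auto simp: P_set_iff)
    show ?case
    proof (cases "q \<in> Q")
      case False
      define U where "U = {q' \<in> P_set n. q' \<noteq> q \<and> P_le q q'}"
      have IH: "length (filter (\<lambda>J. q' \<in> J) Js) = length (filter (\<lambda>J. q' \<in> J) Js')" if q': "q' \<in> U" for q'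
      proof (rule less.hyps)
        obtain i' j' where [simp]: "q' = (i', j')" by fastforce
        have P: "(i, j) \<in> P_set n" "(i', j') \<in> P_set n" using q' less.prems by (simp_all add: U_def)
        then have le: "i \<le> i'" "pos n j \<le> pos n j'" "(i', j') \<noteq> (i, j)"
          using q' by (simp_all add: U_def P_le_iff)
        have "pos n j = pos n j' \<Longrightarrow> j = j'" using P by (simp add: P_set_iff pos_eq_iff)
        then have "i < i' \<or> pos n j < pos n j'" using le by fastforce
        then have "int n - i' + (2 * int n - pos n j') < int n - i + (2 * int n - pos n j)"
          using le(1,2) by linarith
        moreover have "pos n j' \<le> 2 * int n" "i' \<le> int n" using P pos_range[of j' n] by (auto simp: P_set_iff)
        ultimately show "h q' < h q" by (simp add: h_def)
        show "q' \<in> P_set n" using P by simp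
      qed
      have split: "length (filter (\<lambda>J. q \<in> J) Ks) =
          length (filter (\<lambda>J. (i, i) \<in> J \<and> row_max J i = j) Ks) + card {a. a < length Ks \<and> (\<exists>q'\<in>U. q' \<in> Ks ! a)}"
        if Ks: "Ks \<in> ideal_chains n" for Ks
      proof -
        have J: "q \<in> J \<longleftrightarrow> q \<in> maximal_elements J \<or> (\<exists>q'\<in>U. q' \<in> J)"
          "\<not> (q \<in> maximal_elements J \<and> (\<exists>q'\<in>U. q' \<in> J))" if "J \<in> set Ks" for J
        proof -
          have J: "J \<in> order_ideals n" using that Ks ideals by blast
          have "q \<in> J" if "q' \<in> U" "q' \<in> J" for q'
            using that J less.prems by (auto simp: U_def order_ideals_def)
          then show "q \<in> J \<longleftrightarrow> q \<in> maximal_elements J \<or> (\<exists>q'\<in>U. q' \<in> J)"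
            using order_ideal_P[OF J] unfolding maximal_elements_def U_def by blast
          show "\<not> (q \<in> maximal_elements J \<and> (\<exists>q'\<in>U. q' \<in> J))"
            unfolding maximal_elements_def U_def by blast
        qed
        have "length (filter (\<lambda>J. q \<in> J) Ks) = card {a. a < length Ks \<and> q \<in> Ks ! a}"
          by (rule length_filter_conv_card)
        also have "{a. a < length Ks \<and> q \<in> Ks ! a} =
            {a. a < length Ks \<and> q \<in> maximal_elements (Ks ! a)} \<union> {a. a < length Ks \<and> (\<exists>q'\<in>U. q' \<in> Ks ! a)}"
          using J(1)[OF nth_mem] by blast
        also have "card \<dots> = card {a. a < length Ks \<and> q \<in> maximal_elements (Ks ! a)} +
            card {a. a < length Ks \<and> (\<exists>q'\<in>U. q' \<in> Ks ! a)}"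
        proof (rule card_Un_disjoint)
          show "{a. a < length Ks \<and> q \<in> maximal_elements (Ks ! a)} \<inter>
              {a. a < length Ks \<and> (\<exists>q'\<in>U. q' \<in> Ks ! a)} = {}"
            using J(2)[OF nth_mem] by blast
        qed simp_all
        also have "card {a. a < length Ks \<and> q \<in> maximal_elements (Ks ! a)} =
            length (filter (\<lambda>J. q \<in> maximal_elements J) Ks)"
          by (rule length_filter_conv_card[symmetric])
        also have "filter (\<lambda>J. q \<in> maximal_elements J) Ks = filter (\<lambda>J. (i, i) \<in> J \<and> row_max J i = j) Ks"
        proof (intro filter_cong refl)
          fix J assume "J \<in> set Ks"
          then have "J \<in> order_ideals n" using Ks ideals by blast
          then show "q \<in> maximal_elements J \<longleftrightarrow> (i, i) \<in> J \<and> row_max J i = j"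
            using maximal_iff[of J i j] less.prems False by simp
        qed
        finally show ?thesis .
      qed
      \<comment> \<open>Counts for the single \<open>q'\<close> would not determine the size of a
        union in general. In a chain, however, the count for \<open>q'\<close> fixes which indices
        occur, so the union over \<open>U\<close> is fixed as well.\<close>
      have "{a. a < length Js \<and> (\<exists>q'\<in>U. q' \<in> Js ! a)} = {a. a < length Js' \<and> (\<exists>q'\<in>U. q' \<in> Js' ! a)}"
      proof -
        have "q' \<in> Js ! a \<longleftrightarrow> q' \<in> Js' ! a" if "a < length Js'" "q' \<in> U" for a q'
          unfolding nth[OF chains(1) that(1)[folded m]] nth[OF chains(2) that(1)] IH[OF that(2)] m ..
        then show ?thesis unfolding m by blast
      qed
      then show ?thesis unfolding split[OF chains(1)] split[OF chains(2)] using eq[OF i] by simp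
    qed (rule inQ)
  qed
  show ?thesis
  proof (rule nth_equalityI[OF m])
    fix a assume a: "a < length Js"
    then have a': "a < length Js'" using m by simp
    have "Js ! a \<in> order_ideals n" "Js' ! a \<in> order_ideals n"
      using nth_mem[OF a] nth_mem[OF a'] ideals[OF chains(1)] ideals[OF chains(2)] by blast+
    then have "Js ! a \<subseteq> P_set n" "Js' ! a \<subseteq> P_set n" by (simp_all add: order_ideal_P)
    moreover have "q \<in> Js ! a \<longleftrightarrow> q \<in> Js' ! a" if "q \<in> P_set n" for q
      unfolding nth[OF chains(1) a] nth[OF chains(2) a'] all[OF that] m ..
    ultimately show "Js ! a = Js' ! a" by blast
  qed
qed

lemma chain_products_independent:
  assumes "1 \<le> n" "finite F" "F \<subseteq> ideal_chains n"
    and "(\<Sum>Js\<in>F. cconst (a Js) * isotropic_eval n (chain_product Js)) = 0" "Js \<in> F"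
  shows "a Js = 0"
proof (rule lowest_independent[OF assms(2) _ _ assms(4,5)])
  have ideals: "set Ks \<subseteq> order_ideals n" if "Ks \<in> F" for Ks
    using that assms(3) by (auto simp: ideal_chains_def)
  show "lowest pipe_weight (isotropic_eval n (chain_product Ks)) (chain_monomial Ks)" if "Ks \<in> F" for Ks
    by (rule lowest_chain_product[OF ideals[OF that]])
  show "inj_on chain_monomial F"
  proof (rule inj_onI)
    fix Ks Ls assume *: "Ks \<in> F" "Ls \<in> F" "chain_monomial Ks = chain_monomial Ls"
    show "Ks = Ls"
      using * assms(1,3) chain_monomial_row_max[OF ideals ideals *(3)]
      by (intro chain_eqI) blast+
  qed
qed

end

section \<open>Columns of King tableaux\<close>

text \<open>Positions in King's order \<open>1, -1, 2, -2, \<dots>\<close>\<close>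

definition king :: "int \<Rightarrow> nat" where
  "king j = (if 0 < j then nat (2 * j - 1) else nat (- 2 * j))"

lemma king_eq_iff: "i \<in> N_set n \<Longrightarrow> j \<in> N_set n \<Longrightarrow> king i = king j \<longleftrightarrow> i = j"
proof -
  assume "i \<in> N_set n" "j \<in> N_set n"
  then have int: "int (king i) = (if 0 < i then 2 * i - 1 else - 2 * i)"
    "int (king j) = (if 0 < j then 2 * j - 1 else - 2 * j)"
    by (auto simp: N_set_def king_def)
  have "king i = king j \<longleftrightarrow> int (king i) = int (king j)" by simp
  also have "\<dots> \<longleftrightarrow> i = j" unfolding int by (simp split: if_splits) presburger
  finally show ?thesis .
qed

lemma king_abs_mono: "i \<in> N_set n \<Longrightarrow> j \<in> N_set n \<Longrightarrow> king i \<le> king j \<Longrightarrow> \<bar>i\<bar> \<le> \<bar>j\<bar>"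
  unfolding N_set_def king_def by (auto split: if_splits)

lemma king_bound: "j \<in> N_set n \<Longrightarrow> king j \<le> 2 * n"
  unfolding N_set_def king_def by auto

lemma pipes_P: "pipes n (P_set n)"
  by unfold_locales (auto simp: A_set_def P_set_def)

lemma ex_pos:
  assumes "1 \<le> p" "p \<le> 2 * int n"
  obtains j where "j \<in> N_set n" "pos n j = p"
proof (cases "p \<le> int n")
  case True
  then show ?thesis using assms by (intro that[of p]) (auto simp: N_set_def pos_def)
next
  case False
  then show ?thesis using assms by (intro that[of "p - (2 * int n + 1)"]) (auto simp: N_set_def pos_def)
qed

text \<open>A row of the poset is an interval of positions. For \<open>P_set n\<close> the
  predecessor of a column in its row is therefore its neighbour in the order of N.\<close>

lemma P_set_pos_iff: "(i, j) \<in> P_set n \<longleftrightarrow> 1 \<le> i \<and> i \<le> int n \<and> j \<in> N_set n \<and> i \<le> pos n j \<and> pos n j \<le> 2 * int n + 1 - i"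
  by (auto simp: P_set_iff N_set_def pos_def)

lemma row_cycle_P_base:
  assumes "1 \<le> i" "i \<le> int n"
  shows "pos n (row_cycle n (P_set n) i i) = 2 * int n + 1 - i"
proof -
  interpret pipes n "P_set n" by (rule pipes_P)
  have "(i, i) \<in> P_set n" "(i, - i) \<in> P_set n" using assms by (auto simp: P_set_def)
  note base = row_cycle_base[OF diagonal_Q this(1)] and this(2)
  then show ?thesis
    using base(2)[of "- i"] base(1) assms by (auto simp: P_set_pos_iff pos_def)
qed

lemma row_cycle_P_step:
  assumes y: "(i, y) \<in> P_set n" "y \<noteq> i"
  shows "pos n (row_cycle n (P_set n) i y) = pos n y - 1"
proof -
  interpret pipes n "P_set n" by (rule pipes_P)
  note step = row_cycle_step[OF diagonal_Q y]
  have P: "1 \<le> i" "i \<le> int n" "y \<in> N_set n" "i \<le> pos n y" "pos n y \<le> 2 * int n + 1 - i"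
    using y(1) by (auto simp: P_set_pos_iff)
  have "pos n y \<noteq> i"
    using y(2) P pos_eq_iff[of y n i] by (auto simp: pos_def split: if_splits)
  then have gt: "i < pos n y" using P by simp
  obtain z where z: "z \<in> N_set n" "pos n z = pos n y - 1"
    using ex_pos[of "pos n y - 1" n] gt P by auto
  have "(i, z) \<in> P_set n" using z gt P by (simp add: P_set_pos_iff)
  then show ?thesis using step(2) step(3)[of z] z by simp
qed

text \<open>The pipe of \<open>j\<close> stays put until row \<open>\<bar>j\<bar>\<close>. There
  \<open>j > 0\<close> jumps to the last column of the row, and \<open>j < 0\<close> is that column
  and moves back by one; each further row moves the pipe back by one. The two cases differ by one
  position, as do j and -j in King's order.\<close>

lemma tail_perm_P:
  assumes j: "j \<in> N_set n" "i \<le> \<bar>j\<bar>" and i: "1 \<le> i"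
  shows "pos n (tail_perm n (P_set n) i j) = 2 * int n + i - int (king j)"
proof -
  interpret pipes n "P_set n" by (rule pipes_P)
  define b where "b = \<bar>j\<bar>"
  have b: "1 \<le> b" "b \<le> int n" using j i by (auto simp: b_def N_set_def)
  have "int d \<le> b - 1 \<Longrightarrow> pos n (G (b - int d) j) = 2 * int n + (b - int d) - int (king j)" for d
  proof (induction d)
    case 0
    have "G b j = row_cycle n (P_set n) b j"
      using tail_perm_fixed[OF diagonal_Q, of j "b + 1"] b by (simp add: tail_perm_rec b_def)
    moreover have "pos n (row_cycle n (P_set n) b j) = 2 * int n + b - int (king j)"
    proof (cases "0 < j")
      case True
      then show ?thesis using row_cycle_P_base[OF b] by (simp add: b_def king_def)
    next
      case False
      then have "(b, j) \<in> P_set n" "j \<noteq> b" using j b by (auto simp: P_set_iff b_def)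
      then show ?thesis using row_cycle_P_step False by (simp add: b_def king_def pos_def)
    qed
    ultimately show ?case by simp
  next
    case (Suc d)
    define r where "r = b - int (Suc d)"
    have r: "b - int d = r + 1" "1 \<le> r" "r \<le> int n" using Suc.prems b by (auto simp: r_def)
    have y: "G (r + 1) j \<in> N_set n" "r + 1 \<le> \<bar>G (r + 1) j\<bar>"
      using tail_perm_region[OF diagonal_Q, of "r + 1" "r + 1" j] r j Suc.prems by (auto simp: b_def r_def)
    then have "(r, G (r + 1) j) \<in> P_set n" "G (r + 1) j \<noteq> r" using r by (auto simp: P_set_iff)
    then have "pos n (G r j) = pos n (G (r + 1) j) - 1"
      unfolding tail_perm_rec[OF r(3)] by (rule row_cycle_P_step)
    then show ?case using Suc.IH Suc.prems unfolding r_def[symmetric] r(1) by simp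
  qed
  from this[of "nat (b - i)"] show ?thesis using j i by (simp add: b_def)
qed

definition king_column :: "nat \<Rightarrow> int list \<Rightarrow> bool" where
  "king_column n c \<longleftrightarrow> 1 \<le> length c \<and> length c \<le> n \<and> set c \<subseteq> N_set n \<and>
    sorted_wrt (\<lambda>x y. king x < king y) c \<and> (\<forall>r<length c. int r + 1 \<le> \<bar>c ! r\<bar>)"

text \<open>The bound on \<open>pos n j\<close> is the value of \<open>pos n (G i (c ! (i - 1)))\<close> in the case \<open>Q = P_set n\<close>; so
  \<open>c\<close> is the tuple of this ideal, and inclusion of ideals is the row condition for King tableaux.\<close>

definition column_ideal :: "nat \<Rightarrow> int list \<Rightarrow> (int \<times> int) set" where
  "column_ideal n c = {(i, j) \<in> P_set n. i \<le> int (length c) \<and>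
    pos n j \<le> 2 * int n + i - int (king (c ! nat (i - 1)))}"

text \<open>Values of \<open>king\<close> grow by at least 1 from one row to the next, so the bound
  on \<open>pos n j\<close> weakly decreases as \<open>i\<close> grows.\<close>

lemma column_ideal_order_ideal:
  assumes c: "king_column n c"
  shows "column_ideal n c \<in> order_ideals n"
proof -
  have down: "(i', j') \<in> column_ideal n c"
    if ij: "(i, j) \<in> column_ideal n c" and P': "(i', j') \<in> P_set n" and le: "P_le (i', j') (i, j)" for i j i' j'
  proof -
    have P: "(i, j) \<in> P_set n" and i: "i \<le> int (length c)"
      and j: "pos n j \<le> 2 * int n + i - int (king (c ! nat (i - 1)))"
      using ij by (auto simp: column_ideal_def)
    have le': "1 \<le> i'" "i' \<le> i" "pos n j' \<le> pos n j"
      using le P' unfolding P_le_iff[OF P' P] by (simp_all add: P_set_iff)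
    have s: "sorted_wrt (\<lambda>x y. king x < king y) c" using c by (simp add: king_column_def)
    have "int (king (c ! r)) + int d \<le> int (king (c ! (r + d)))" if "r + d < length c" for r d
      using that
    proof (induction d)
      case (Suc d)
      have "king (c ! (r + d)) < king (c ! (r + Suc d))"
        using sorted_wrt_nth_less[OF s, of "r + d" "r + Suc d"] Suc.prems by simp
      then show ?case using Suc by simp
    qed simp
    note steps = this[of "nat (i' - 1)" "nat (i - i')"]
    have "int (nat (i' - 1) + nat (i - i')) = int (nat (i - 1))" using le' by simp
    then have "nat (i' - 1) + nat (i - i') = nat (i - 1)" by (simp only: of_nat_eq_iff)
    moreover have "nat (i - 1) < length c" using i le' by simp
    ultimately have "int (king (c ! nat (i' - 1))) + (i - i') \<le> int (king (c ! nat (i - 1)))"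
      using steps le' by simp
    then show ?thesis using j i le' P' by (simp add: column_ideal_def)
  qed
  have "\<forall>p \<in> column_ideal n c. \<forall>q \<in> P_set n. P_le q p \<longrightarrow> q \<in> column_ideal n c"
  proof (intro ballI impI)
    fix p q assume "p \<in> column_ideal n c" "q \<in> P_set n" "P_le q p"
    then show "q \<in> column_ideal n c"
      using down[of "fst p" "snd p" "fst q" "snd q"] by simp
  qed
  moreover have "column_ideal n c \<subseteq> P_set n" by (auto simp: column_ideal_def)
  ultimately show ?thesis by (simp add: order_ideals_def)
qed

text \<open>At the diagonal the defining bound says that the entry has \<open>king\<close> at most
  2n, which holds for every element of N.\<close>

lemma column_ideal_diag:
  assumes c: "king_column n c" and i: "1 \<le> i" "i \<le> int n"
  shows "(i, i) \<in> column_ideal n c \<longleftrightarrow> i \<le> int (length c)"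
proof -
  have "king (c ! nat (i - 1)) \<le> 2 * n" if "i \<le> int (length c)"
  proof (rule king_bound)
    have "c ! nat (i - 1) \<in> set c" using that i by (intro nth_mem) simp
    then show "c ! nat (i - 1) \<in> N_set n" using c by (auto simp: king_column_def)
  qed
  then show ?thesis using i by (auto simp: column_ideal_def P_set_iff pos_def)
qed

lemma card_column_ideal:
  assumes c: "king_column n c"
  shows "card (column_ideal n c \<inter> A_set n) = length c"
proof -
  let ?k = "card (column_ideal n c \<inter> A_set n)"
  have J: "column_ideal n c \<in> order_ideals n" by (rule column_ideal_order_ideal[OF c])
  have k: "?k \<le> n" using card_diag_le order_ideal_P[OF J] by blast
  have l: "length c \<le> n" "1 \<le> length c" using c by (simp_all add: king_column_def)
  have iff: "i \<le> int ?k \<longleftrightarrow> i \<le> int (length c)" if "1 \<le> i" "i \<le> int n" for i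
    using order_ideal_diag_iff[OF J that] column_ideal_diag[OF c that] by simp
  have "int (length c) \<le> int ?k" using iff[of "int (length c)"] l by simp
  moreover have "int ?k \<le> int (length c)"
    using iff[of "int ?k"] k calculation l by simp
  ultimately show ?thesis by simp
qed

text \<open>For \<open>Q = P_set n\<close> the set \<open>M_set Q J\<close> is J itself. By
  \<open>tail_perm_P\<close> the bound in row i is attained by the image of the i-th entry of
  \<open>c\<close> under \<open>G i\<close>, which is therefore the row maximum. Injectivity of
  \<open>G i\<close> identifies that entry with w(i).\<close>

lemma ideal_tuple_column_ideal:
  assumes c: "king_column n c"
  shows "pipes.ideal_tuple n (P_set n) (column_ideal n c) = c"
proof -
  interpret pipes n "P_set n" by (rule pipes_P)
  let ?J = "column_ideal n c"
  have J: "?J \<in> order_ideals n" by (rule column_ideal_order_ideal[OF c])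
  have M: "M_set (P_set n) ?J = ?J"
    using order_ideal_P[OF J] by (auto simp: M_set_def maximal_elements_def)
  show ?thesis
  proof (rule nth_equalityI)
    fix r assume "r < length (ideal_tuple ?J)"
    then have r: "r < length c" by (simp add: card_column_ideal[OF c])
    define i where "i = int r + 1"
    have i: "1 \<le> i" "i \<le> int n" "i \<le> int (length c)" and ri: "r = nat (i - 1)"
      using r c by (auto simp: i_def king_column_def)
    have iJ: "(i, i) \<in> ?J" using column_ideal_diag[OF c i(1,2)] i by simp
    have cr: "c ! r \<in> N_set n" "i \<le> \<bar>c ! r\<bar>"
      using c r nth_mem[OF r] by (auto simp: king_column_def i_def)
    let ?g = "G i (c ! r)"
    have g: "?g \<in> N_set n" "i \<le> \<bar>?g\<bar>"
      using tail_perm_region[OF diagonal_Q i(1) order_refl cr] by auto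
    have pos_g: "pos n ?g = 2 * int n + i - int (king (c ! r))"
      by (rule tail_perm_P[OF cr i(1)])
    have "(i, ?g) \<in> ?J" using g i pos_g by (simp add: column_ideal_def P_set_iff ri)
    then have "pos n ?g \<le> pos n (row_max ?J i)" using row_max(3)[OF J iJ] M by simp
    moreover have max: "(i, row_max ?J i) \<in> ?J" by (rule row_max(2)[OF J iJ])
    then have "pos n (row_max ?J i) \<le> pos n ?g" using pos_g by (simp add: column_ideal_def ri)
    moreover have "row_max ?J i \<in> N_set n" using max order_ideal_P[OF J] by (auto simp: P_set_iff)
    ultimately have "row_max ?J i = ?g" using pos_eq_iff[of "row_max ?J i" n ?g] g by simp
    then have "w_ideal n (P_set n) ?J i = c ! r"
      using w_ideal_rows(1)[OF J iJ i(1) order_refl] inj_G by metis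
    then show "ideal_tuple ?J ! r = c ! r"
      using r by (simp add: ideal_tuple_nth card_column_ideal[OF c] i_def)
  qed (simp add: card_column_ideal[OF c])
qed

lemma column_ideal_mono:
  assumes "length d \<le> length c" "\<And>r. r < length d \<Longrightarrow> king (c ! r) \<le> king (d ! r)"
  shows "column_ideal n d \<subseteq> column_ideal n c"
proof clarify
  fix i j assume ij: "(i, j) \<in> column_ideal n d"
  then have i: "1 \<le> i" "i \<le> int (length d)" by (auto simp: column_ideal_def P_set_iff)
  then have "king (c ! nat (i - 1)) \<le> king (d ! nat (i - 1))" by (intro assms(2)) simp
  then show "(i, j) \<in> column_ideal n c" using ij assms(1) by (auto simp: column_ideal_def)
qed

text \<open>If the entry with index r, counted from 0, had absolute value at most r, then so would
  all entries before it, because King's order is compatible with absolute values. These r + 1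
  entries contradict admissibility for l = r.\<close>

lemma king_column_admissible:
  assumes c: "set c \<subseteq> N_set n" "sorted_wrt (\<lambda>x y. king x < king y) c" "admissible n c"
    and len: "1 \<le> length c" "length c \<le> n"
  shows "king_column n c"
proof -
  have "int r + 1 \<le> \<bar>c ! r\<bar>" if r: "r < length c" for r
  proof (rule ccontr)
    assume "\<not> int r + 1 \<le> \<bar>c ! r\<bar>"
    then have small: "\<bar>c ! r\<bar> \<le> int r" by simp
    have N: "c ! s \<in> N_set n" if "s < length c" for s using c(1) nth_mem[OF that] by blast
    have "\<bar>c ! r\<bar> \<ge> 1" using N[OF r] by (auto simp: N_set_def)
    then have "1 \<le> r" using small by simp
    have "(!) c ` {..r} \<subseteq> {x \<in> set c. \<bar>x\<bar> \<le> int r}"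
    proof clarify
      fix s assume "s \<le> r"
      then have "king (c ! s) \<le> king (c ! r)"
        using sorted_wrt_nth_less[OF c(2), of s r] r by (cases "s = r") auto
      then have "\<bar>c ! s\<bar> \<le> \<bar>c ! r\<bar>" using king_abs_mono[of "c ! s" n "c ! r"] N r \<open>s \<le> r\<close> by simp
      then show "c ! s \<in> set c \<and> \<bar>c ! s\<bar> \<le> int r" using small r \<open>s \<le> r\<close> by simp
    qed
    then have "card ((!) c ` {..r}) \<le> card {x \<in> set c. \<bar>x\<bar> \<le> int r}"
      by (intro card_mono) simp_all
    also have "\<dots> \<le> r" using c(3) \<open>1 \<le> r\<close> r len by (simp add: admissible_def)
    finally have "card ((!) c ` {..r}) \<le> r" .
    moreover have "inj_on ((!) c) {..r}"
      using c(3) r by (auto simp: admissible_def inj_on_def nth_eq_iff_index_eq)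
    ultimately show False by (simp add: card_image)
  qed
  then show ?thesis using assms by (simp add: king_column_def)
qed

lemma king_sort:
  assumes "distinct c" "set c \<subseteq> N_set n"
  shows "sorted_wrt (\<lambda>x y. king x < king y) (sort_key king c)"
proof -
  have inj: "inj_on king (set c)"
  proof (rule inj_onI)
    fix x y assume "x \<in> set c" "y \<in> set c" "king x = king y"
    then show "x = y" using king_eq_iff[of x n y] assms(2) by blast
  qed
  have "sorted_wrt (<) (map king (sort_key king c))"
    using assms(1) inj by (simp add: strict_sorted_iff distinct_map)
  then show ?thesis by (simp add: sorted_wrt_map)
qed

section \<open>Straightening\<close>

lemma alternating_permute:
  fixes f :: "'a list \<Rightarrow> 'v cpoly"
  assumes \<sigma>: "\<sigma> permutes S" "S \<subseteq> {..<m}"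
    and swap: "\<And>w i j. length w = m \<Longrightarrow> set w \<subseteq> A \<Longrightarrow> i \<in> S \<Longrightarrow> j \<in> S \<Longrightarrow> i \<noteq> j \<Longrightarrow>
      f (permute_list (Transposition.transpose i j) w) = - f w"
    and w: "length w = m" "set w \<subseteq> A"
  shows "f (permute_list \<sigma> w) = of_int (sign \<sigma>) * f w"
  using \<sigma>(1) finite_subset[OF \<sigma>(2) finite_lessThan] w
proof (induction arbitrary: w rule: permutes_induct)
  case id
  then show ?case by simp
next
  case (swap i j p)
  let ?\<tau> = "Transposition.transpose i j"
  have fin: "finite S" using \<sigma>(2) finite_subset by blast
  have p: "p permutes {..<length w}" using permutes_subset[OF swap.hyps(4) \<sigma>(2)] swap.prems by simp
  have \<tau>: "?\<tau> permutes {..<length w}"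
    using swap.hyps \<sigma>(2) swap.prems by (intro permutes_swap_id) auto
  have "permutation p" using swap.hyps(4) fin permutation_permutes by blast
  then have s: "sign (?\<tau> \<circ> p) = - sign p"
    using swap.hyps by (simp add: sign_compose permutation_swap_id sign_swap_id)
  have 1: "permute_list (?\<tau> \<circ> p) w = permute_list p (permute_list ?\<tau> w)"
    by (rule permute_list_compose[OF p])
  have 2: "f (permute_list p (permute_list ?\<tau> w)) = of_int (sign p) * f (permute_list ?\<tau> w)"
    using swap.prems \<tau> by (intro swap.IH) simp_all
  have 3: "f (permute_list ?\<tau> w) = - f w"
    using swap.hyps swap.prems by (intro assms(3))
  show ?case unfolding 1 2 3 s by simp
qed

definition king_sum :: "int list \<Rightarrow> nat" where
  "king_sum c = sum_list (map king c)"

text \<open>\<open>T\<close> arises from the first \<open>q\<close> indices by trading some of them,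
  with \<open>g\<close> above \<open>\<beta>\<close>, for equally many others with \<open>g\<close>
  at most \<open>\<beta>\<close>.\<close>

lemma sum_less_swap:
  fixes g :: "nat \<Rightarrow> nat"
  assumes "T \<noteq> {..<q}" "finite T" "card T = q"
    and "\<And>j. j < q \<Longrightarrow> \<beta> < g j" "\<And>j. j \<in> T \<Longrightarrow> q \<le> j \<Longrightarrow> g j \<le> \<beta>"
  shows "sum g T < sum g {..<q}"
proof -
  let ?D = "{..<q} - T" and ?E = "T - {..<q}"
  have Un: "?D \<union> ({..<q} \<inter> T) = {..<q}" "?E \<union> ({..<q} \<inter> T) = T" by blast+
  have "card ?D + card ({..<q} \<inter> T) = card {..<q}"
    by (subst Un(1)[symmetric], subst card_Un_disjoint) auto
  moreover have "card ?E + card ({..<q} \<inter> T) = card T"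
    using assms(2) by (subst (3) Un(2)[symmetric], subst card_Un_disjoint) auto
  ultimately have card: "card ?E = card ?D" using assms(3) by simp
  have "?D \<noteq> {}"
  proof
    assume "?D = {}"
    then have "{..<q} \<subseteq> T" by blast
    then have "{..<q} = T" using card_subset_eq[of T "{..<q}"] assms(2,3) by simp
    then show False using assms(1) by simp
  qed
  have "sum g ?E \<le> card ?E * \<beta>"
    using assms(5) sum_bounded_above[of ?E g \<beta>] by simp
  also have "\<dots> < card ?D * Suc \<beta>"
  proof -
    have "0 < card ?D" using \<open>?D \<noteq> {}\<close> by (metis card_gt_0_iff finite_Diff finite_lessThan)
    then show ?thesis unfolding card by simp
  qed
  also have "\<dots> \<le> sum g ?D"
    using assms(4) sum_bounded_below[of ?D "Suc \<beta>" g] by (simp add: Suc_le_eq)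
  finally have "sum g ?E < sum g ?D" .
  moreover have "sum g T = sum g ({..<q} \<inter> T) + sum g ?E"
    using sum.Int_Diff[OF assms(2), of g "{..<q}"] by (simp add: Int_commute)
  moreover have "sum g {..<q} = sum g ({..<q} \<inter> T) + sum g ?D"
    using sum.Int_Diff[of "{..<q}" g T] by simp
  ultimately show ?thesis by simp
qed

lemma take_permute_list:
  assumes "\<sigma> permutes {..<length w}" "q \<le> length w"
  shows "take q (permute_list \<sigma> w) = map (\<lambda>i. w ! \<sigma> i) [0..<q]"
  by (rule nth_equalityI) (use assms in \<open>auto simp: permute_list_nth\<close>)

lemma X_tuple_swap_within_block:
  assumes "i \<in> S" "j \<in> S" "i \<noteq> j" "S = {..<q} \<or> S = {q..<length w}" "q \<le> length w"
    and N: "set a \<union> set w \<union> set b \<subseteq> N_set n"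
  shows "X_tuple (a @ take q (permute_list (Transposition.transpose i j) w)) *
      X_tuple (drop q (permute_list (Transposition.transpose i j) w) @ b) =
    - (X_tuple (a @ take q w) * X_tuple (drop q w @ b))"
proof -
  let ?\<tau> = "Transposition.transpose i j"
  have lt: "i < length w" "j < length w" using assms by auto
  have \<tau>: "?\<tau> permutes {..<length w}" using lt by (intro permutes_swap_id) auto
  have sets: "set (take q w) \<subseteq> N_set n" "set (drop q w) \<subseteq> N_set n"
    using N set_take_subset[of q w] set_drop_subset[of q w] by auto
  from assms(4) show ?thesis
  proof
    assume S: "S = {..<q}"
    then have ij: "i < length (take q w)" "j < length (take q w)" using assms by auto
    have \<tau>': "?\<tau> permutes {..<length (take q w)}" using ij by (intro permutes_swap_id) auto
    have "permute_list ?\<tau> (take q w) @ drop q w = permute_list ?\<tau> w"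
      using permute_middle[OF ij, of "[]" "drop q w"] by simp
    then have "permute_list ?\<tau> w = permute_list ?\<tau> (take q w) @ drop q w" by (rule sym)
    then have "take q (permute_list ?\<tau> w) = permute_list ?\<tau> (take q w)" "drop q (permute_list ?\<tau> w) = drop q w"
      using assms(5) by (simp_all add: min_absorb2)
    moreover have "X_tuple (a @ permute_list ?\<tau> (take q w)) = - X_tuple (a @ take q w)"
      using X_tuple_permute_middle[OF \<tau>' refl, of a "[]" n] N sets assms(3) by (simp add: sign_swap_id)
    ultimately show ?thesis by simp
  next
    assume S: "S = {q..<length w}"
    define i' j' where "i' = i - q" and "j' = j - q"
    have ij: "i' < length (drop q w)" "j' < length (drop q w)" "i = q + i'" "j = q + j'" "i' \<noteq> j'"
      using assms S by (auto simp: i'_def j'_def)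
    have \<tau>': "Transposition.transpose i' j' permutes {..<length (drop q w)}"
      using ij by (intro permutes_swap_id) auto
    have "take q w @ permute_list (Transposition.transpose i' j') (drop q w) = permute_list ?\<tau> w"
      using permute_middle[OF ij(1,2), of "take q w" "[]"] ij(3,4) assms(5) by (simp add: min_absorb2)
    then have "permute_list ?\<tau> w = take q w @ permute_list (Transposition.transpose i' j') (drop q w)"
      by (rule sym)
    then have "take q (permute_list ?\<tau> w) = take q w"
      "drop q (permute_list ?\<tau> w) = permute_list (Transposition.transpose i' j') (drop q w)"
      using assms(5) by (simp_all add: min_absorb2)
    moreover have "X_tuple (permute_list (Transposition.transpose i' j') (drop q w) @ b) = - X_tuple (drop q w @ b)"
      using X_tuple_permute_middle[OF \<tau>' refl, of "[]" b n] N sets ij(5) by (simp add: sign_swap_id)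
    ultimately show ?thesis by simp
  qed
qed

lemma split_block_permutation:
  fixes m q :: nat
  assumes \<sigma>: "\<sigma> permutes {..<m}" and q: "\<sigma> ` {..<q} = {..<q}" "q \<le> m"
  obtains \<sigma>\<^sub>1 \<sigma>\<^sub>2 where "\<sigma>\<^sub>1 permutes {..<q}" "\<sigma>\<^sub>2 permutes {q..<m}" "\<sigma> = \<sigma>\<^sub>1 \<circ> \<sigma>\<^sub>2" "sign \<sigma> = sign \<sigma>\<^sub>1 * sign \<sigma>\<^sub>2"
proof -
  define \<sigma>\<^sub>1 \<sigma>\<^sub>2 where "\<sigma>\<^sub>1 = (\<lambda>i. if i < q then \<sigma> i else i)" and "\<sigma>\<^sub>2 = (\<lambda>i. if i < q then i else \<sigma> i)"
  have inj: "inj \<sigma>" using permutes_inj[OF \<sigma>] .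
  have low: "\<sigma> i < q \<longleftrightarrow> i < q" for i
  proof
    assume "\<sigma> i < q"
    then have "\<sigma> i \<in> \<sigma> ` {..<q}" using q(1) by simp
    then show "i < q" using injD[OF inj] by blast
  next
    assume "i < q"
    then have "\<sigma> i \<in> \<sigma> ` {..<q}" by blast
    then show "\<sigma> i < q" unfolding q(1) by simp
  qed
  have 1: "\<sigma>\<^sub>1 permutes {..<q}"
  proof (rule bij_imp_permutes)
    have "\<sigma>\<^sub>1 ` {..<q} = \<sigma> ` {..<q}" by (rule image_cong) (simp_all add: \<sigma>\<^sub>1_def)
    then have "\<sigma>\<^sub>1 ` {..<q} = {..<q}" using q(1) by simp
    moreover have "inj_on \<sigma>\<^sub>1 {..<q}" by (rule inj_onI) (use injD[OF inj] in \<open>simp add: \<sigma>\<^sub>1_def\<close>)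
    ultimately show "bij_betw \<sigma>\<^sub>1 {..<q} {..<q}" by (simp add: bij_betw_def)
  qed (simp add: \<sigma>\<^sub>1_def)
  have 2: "\<sigma>\<^sub>2 permutes {q..<m}"
  proof (rule bij_imp_permutes)
    have "\<sigma>\<^sub>2 ` {q..<m} \<subseteq> {q..<m}"
    proof clarify
      fix x assume "x \<in> {q..<m}"
      then show "\<sigma>\<^sub>2 x \<in> {q..<m}"
        using permutes_in_image[OF \<sigma>, of x] low[of x] by (simp add: \<sigma>\<^sub>2_def)
    qed
    moreover have "inj_on \<sigma>\<^sub>2 {q..<m}" by (rule inj_onI) (use injD[OF inj] in \<open>simp add: \<sigma>\<^sub>2_def\<close>)
    ultimately show "bij_betw \<sigma>\<^sub>2 {q..<m} {q..<m}"
      unfolding bij_betw_def using endo_inj_surj[of "{q..<m}" \<sigma>\<^sub>2] by simp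
    show "\<sigma>\<^sub>2 x = x" if "x \<notin> {q..<m}" for x
      using that permutes_not_in[OF \<sigma>, of x] by (auto simp: \<sigma>\<^sub>2_def)
  qed
  have comp: "\<sigma>\<^sub>1 \<circ> \<sigma>\<^sub>2 = \<sigma>"
    using low by (auto simp: \<sigma>\<^sub>1_def \<sigma>\<^sub>2_def fun_eq_iff)
  have "permutation \<sigma>\<^sub>1" "permutation \<sigma>\<^sub>2"
    using 1 2 permutation_permutes finite_lessThan finite_atLeastLessThan by blast+
  then have "sign (\<sigma>\<^sub>1 \<circ> \<sigma>\<^sub>2) = sign \<sigma>\<^sub>1 * sign \<sigma>\<^sub>2" by (rule sign_compose)
  then show thesis using that[OF 1 2] unfolding comp by simp
qed

text \<open>Antisymmetrize over the entries of \<open>a\<close> from the violated position on and those of \<open>b\<close> up to it. The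
  permutations that preserve the two groups all contribute the original product.\<close>

lemma exchange_step:
  assumes a: "sorted_wrt (\<lambda>x y. king x < king y) a" and b: "sorted_wrt (\<lambda>x y. king x < king y) b"
    and N: "set a \<union> set b \<subseteq> N_set n" and len: "length b \<le> length a" "length a \<le> n"
    and r: "r < length b" "king (b ! r) < king (a ! r)"
  shows "X_tuple a * X_tuple b \<in> cp.span (I_A n \<union> {X_tuple u * X_tuple v | u v.
    length u = length a \<and> length v = length b \<and> set u \<union> set v \<subseteq> N_set n \<and>
    mset u + mset v = mset a + mset b \<and> king_sum u < king_sum a})" (is "_ \<in> cp.span (_ \<union> ?E)")
proof -
  \<comment> \<open>The entries of \<open>a\<close> from row \<open>r\<close> on exceed those of
    \<open>b\<close> up to row \<open>r\<close> in King's order. Together they are so many that,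
    with the rest of \<open>a\<close>, there is one entry more than the first minor can
    hold.\<close>
  define q where "q = length a - r"
  define w where "w = drop r a @ take (Suc r) b"
  let ?a = "take r a" and ?b = "drop (Suc r) b"
  let ?f = "\<lambda>w. X_tuple (?a @ take q w) * X_tuple (drop q w @ ?b)"
  let ?P = "{\<sigma>. \<sigma> permutes {..<length w}}" and ?B = "{\<sigma>. \<sigma> permutes {..<length w} \<and> \<sigma> ` {..<q} = {..<q}}"
  have ra: "r < length a" using r len by simp
  have lw: "length w = q + Suc r" "length w = Suc (length ?a + q)" and q: "q \<le> length w"
    using ra r by (simp_all add: w_def q_def min_absorb2)
  have parts: "take q w = drop r a" "drop q w = take (Suc r) b"
    by (simp_all add: w_def q_def)
  have setw: "set ?a \<union> set w \<union> set ?b \<subseteq> N_set n"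
    using N set_take_subset[of r a] set_drop_subset[of r a] set_take_subset[of "Suc r" b]
      set_drop_subset[of "Suc r" b] by (auto simp: w_def)
  have fw: "?f w = X_tuple a * X_tuple b" by (simp add: parts)
  have rel: "(\<Sum>\<sigma>\<in>?P. of_int (sign \<sigma>) * ?f (permute_list \<sigma> w)) \<in> I_A n"
  proof (rule exchange_in_I_A[OF lw(2)])
    show "length w - q + length ?b \<le> length ?a + q" "1 \<le> length ?a + q" "length ?a + q \<le> n"
      "1 \<le> length w - q + length ?b"
      using lw ra r len by (simp_all add: q_def min_absorb2)
  qed (rule setw)
  have block: "of_int (sign \<sigma>) * ?f (permute_list \<sigma> w) = X_tuple a * X_tuple b" if "\<sigma> \<in> ?B" for \<sigma>
  proof -
    have \<sigma>: "\<sigma> permutes {..<length w}" "\<sigma> ` {..<q} = {..<q}" using that by auto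
    from split_block_permutation[OF \<sigma> q] obtain \<sigma>\<^sub>1 \<sigma>\<^sub>2
      where s: "\<sigma>\<^sub>1 permutes {..<q}" "\<sigma>\<^sub>2 permutes {q..<length w}" "\<sigma> = \<sigma>\<^sub>1 \<circ> \<sigma>\<^sub>2" "sign \<sigma> = sign \<sigma>\<^sub>1 * sign \<sigma>\<^sub>2" .
    have 1: "?f (permute_list \<sigma>\<^sub>1 w) = of_int (sign \<sigma>\<^sub>1) * ?f w"
    proof (rule alternating_permute[OF s(1), of "length w" "set w"])
      fix v i j assume v: "length v = length w" "set v \<subseteq> set w" and ij: "i \<in> {..<q}" "j \<in> {..<q}" "i \<noteq> j"
      have vN: "set ?a \<union> set v \<union> set ?b \<subseteq> N_set n" using setw v(2) by blast
      show "?f (permute_list (Transposition.transpose i j) v) = - ?f v"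
        by (rule X_tuple_swap_within_block[OF ij disjI1[OF refl] _ vN]) (simp add: v q)
    qed (use q in auto)
    have p1: "\<sigma>\<^sub>1 permutes {..<length w}" using permutes_subset[OF s(1)] q by simp
    have 2: "?f (permute_list \<sigma>\<^sub>2 (permute_list \<sigma>\<^sub>1 w)) = of_int (sign \<sigma>\<^sub>2) * ?f (permute_list \<sigma>\<^sub>1 w)"
    proof (rule alternating_permute[OF s(2), of "length w" "set w"])
      fix v i j assume v: "length v = length w" "set v \<subseteq> set w"
        and ij: "i \<in> {q..<length w}" "j \<in> {q..<length w}" "i \<noteq> j"
      have vN: "set ?a \<union> set v \<union> set ?b \<subseteq> N_set n" using setw v(2) by blast
      show "?f (permute_list (Transposition.transpose i j) v) = - ?f v"
        by (rule X_tuple_swap_within_block[OF ij _ _ vN]) (simp_all add: v q)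
    qed (use p1 in auto)
    have p2: "\<sigma>\<^sub>2 permutes {..<length w}" by (rule permutes_subset[OF s(2)]) auto
    have "permute_list \<sigma> w = permute_list \<sigma>\<^sub>2 (permute_list \<sigma>\<^sub>1 w)"
      unfolding s(3) by (rule permute_list_compose[OF p2])
    then have "of_int (sign \<sigma>) * ?f (permute_list \<sigma> w) =
        of_int (sign \<sigma>\<^sub>1 * sign \<sigma>\<^sub>1) * (of_int (sign \<sigma>\<^sub>2 * sign \<sigma>\<^sub>2) * ?f w)"
      by (simp only: 1 2 s(4) of_int_mult ac_simps)
    then show ?thesis by (simp only: sign_idempotent of_int_1 mult_1 fw)
  qed
  have other: "of_int (sign \<sigma>) * ?f (permute_list \<sigma> w) \<in> cp.span (I_A n \<union> ?E)" if "\<sigma> \<in> ?P - ?B" for \<sigma>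
  proof (intro of_int_mult_in_span cp.span_base UnI2)
    have \<sigma>: "\<sigma> permutes {..<length w}" "\<sigma> ` {..<q} \<noteq> {..<q}" using that by auto
    have inj: "inj_on \<sigma> {..<q}"
      by (rule inj_on_subset[OF permutes_inj[OF \<sigma>(1)]]) simp
    let ?w = "permute_list \<sigma> w"
    let ?u = "?a @ take q ?w" and ?v = "drop q ?w @ ?b"
    have "mset ?w = mset w" by (rule mset_permute_list[OF \<sigma>(1)])
    moreover have split: "mset (take k xs) + mset (drop k xs) = mset xs" for k and xs :: "int list"
      by (simp flip: mset_append)
    have "mset ?u + mset ?v = mset ?a + (mset (take q ?w) + mset (drop q ?w)) + mset ?b"
      by (simp only: mset_append add.assoc)
    then have "mset ?u + mset ?v = mset ?a + mset ?w + mset ?b"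
      unfolding split .
    moreover have "mset a + mset b = mset ?a + mset w + mset ?b"
      unfolding w_def mset_append split[of r a, symmetric] split[of "Suc r" b, symmetric]
      by (simp only: add.assoc)
    ultimately have ms: "mset ?u + mset ?v = mset a + mset b" by simp
    have sets: "set ?u \<union> set ?v \<subseteq> N_set n"
      using arg_cong[OF ms, of set_mset] N by simp
    have lens: "length ?u = length a" "length ?v = length b"
      using lw ra r q by (simp_all add: q_def min_absorb2)
    have "king_sum (take q ?w) = (\<Sum>i<q. king (w ! \<sigma> i))"
      by (simp add: king_sum_def take_permute_list[OF \<sigma>(1) q] interv_sum_list_conv_sum_set_nat
          o_def atLeast0LessThan)
    also have "\<dots> = (\<Sum>j\<in>\<sigma> ` {..<q}. king (w ! j))"
      by (simp add: sum.reindex[OF inj] o_def)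
    also have "\<dots> < (\<Sum>j<q. king (w ! j))"
    proof (rule sum_less_swap[OF \<sigma>(2), where \<beta> = "king (b ! r)"])
      show "card (\<sigma> ` {..<q}) = q"
        by (simp add: card_image[OF inj])
      show "king (b ! r) < king (w ! j)" if "j < q" for j
      proof -
        have "w ! j = a ! (r + j)" using that ra by (simp add: w_def q_def nth_append)
        moreover have "king (a ! r) \<le> king (a ! (r + j))"
        proof (cases "j = 0")
          case False
          moreover have "r + j < length a" using that by (simp add: q_def)
          ultimately show ?thesis using sorted_wrt_nth_less[OF a, of r "r + j"] by simp
        qed simp
        ultimately show ?thesis using r(2) by simp
      qed
      show "king (w ! j) \<le> king (b ! r)" if jT: "j \<in> \<sigma> ` {..<q}" and qj: "q \<le> j" for j
      proof -
        obtain i where i: "i < q" "j = \<sigma> i" using jT by blast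
        then have "j < length w" using permutes_in_image[OF \<sigma>(1), of i] q by simp
        then have j: "j - q \<le> r" using lw by simp
        then have "w ! j = b ! (j - q)" using qj r ra by (simp add: w_def q_def nth_append)
        moreover have "king (b ! (j - q)) \<le> king (b ! r)"
          using sorted_wrt_nth_less[OF b, of "j - q" r] j r by (cases "j - q = r") auto
        ultimately show ?thesis by simp
      qed
    qed simp
    also have "(\<Sum>j<q. king (w ! j)) = king_sum (drop r a)"
    proof -
      have "take q w = map ((!) w) [0..<q]" using q by (intro nth_equalityI) auto
      then show ?thesis
        by (simp add: king_sum_def interv_sum_list_conv_sum_set_nat o_def atLeast0LessThan flip: parts(1))
    qed
    finally have "king_sum ?u < king_sum ?a + king_sum (drop r a)" by (simp add: king_sum_def)
    also have "\<dots> = king_sum a"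
      unfolding king_sum_def by (simp flip: sum_list_append map_append)
    finally have "king_sum ?u < king_sum a" .
    with ms sets lens show "?f ?w \<in> ?E"
      unfolding mem_Collect_eq by (intro exI[of _ ?u] exI[of _ ?v] conjI refl)
  qed
  have finP: "finite ?P" by (simp add: finite_permutations)
  have "?B \<subseteq> ?P" by blast
  then have "(\<Sum>\<sigma>\<in>?P. of_int (sign \<sigma>) * ?f (permute_list \<sigma> w)) =
      (\<Sum>\<sigma>\<in>?P - ?B. of_int (sign \<sigma>) * ?f (permute_list \<sigma> w)) + (\<Sum>\<sigma>\<in>?B. of_int (sign \<sigma>) * ?f (permute_list \<sigma> w))"
    using finP by (rule sum.subset_diff)
  also have "(\<Sum>\<sigma>\<in>?B. of_int (sign \<sigma>) * ?f (permute_list \<sigma> w)) = of_nat (card ?B) * (X_tuple a * X_tuple b)"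
    using block by simp
  finally have "of_nat (card ?B) * (X_tuple a * X_tuple b) =
      (\<Sum>\<sigma>\<in>?P. of_int (sign \<sigma>) * ?f (permute_list \<sigma> w)) -
      (\<Sum>\<sigma>\<in>?P - ?B. of_int (sign \<sigma>) * ?f (permute_list \<sigma> w))" by simp
  also have "\<dots> \<in> cp.span (I_A n \<union> ?E)"
    by (rule cp.span_diff[OF cp.span_base[OF UnI1[OF rel]] cp.span_sum[OF other]])
  finally have *: "of_nat (card ?B) * (X_tuple a * X_tuple b) \<in> cp.span (I_A n \<union> ?E)" .
  \<comment> \<open>The block-preserving permutations add up to a positive multiple of the original
    product, which is divided out over the complex numbers.\<close>
  have "id \<in> ?B" by (simp add: permutes_id)
  moreover have "finite ?B" using finP \<open>?B \<subseteq> ?P\<close> finite_subset by blast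
  ultimately have c: "card ?B \<noteq> 0" by (metis card_eq_0_iff empty_iff)
  have inverse: "cconst (1 / of_nat k) * (of_nat k * p) = (p :: int list cpoly)" if "k \<noteq> 0" for k p
  proof -
    have "(of_nat k :: int list cpoly) = cconst (of_nat k)"
      by (metis cconst_of_int of_int_of_nat_eq)
    then have "cconst (1 / of_nat k) * (of_nat k * p) = cconst (1 / of_nat k * of_nat k) * p"
      by (simp only: cconst_mult mult.assoc)
    then show ?thesis using that by (simp add: cconst_one)
  qed
  show ?thesis
    using cp.span_scale[OF *, of "1 / of_nat (card ?B)"] unfolding inverse[OF c] .
qed

text \<open>Powers of \<open>2\<close> make a tuple heavier whenever entries are traded for one of larger absolute value.\<close>

definition heft :: "int list \<Rightarrow> nat" where
  "heft c = sum_list (map (\<lambda>x. 2 ^ nat \<bar>x\<bar>) c)"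

definition pair_list :: "int list \<Rightarrow> int list" where
  "pair_list is = concat (map (\<lambda>i. [i, - i]) is)"

lemma pair_list_simps [simp]:
  "pair_list [] = []" "pair_list (i # is) = i # - i # pair_list is"
  "pair_list (xs @ ys) = pair_list xs @ pair_list ys"
  by (simp_all add: pair_list_def)

lemma set_pair_list: "set (pair_list is) = set is \<union> uminus ` set is"
  by (induction "is") auto

lemma length_pair_list [simp]: "length (pair_list is) = 2 * length is"
  by (induction "is") auto

lemma heft_append [simp]: "heft (xs @ ys) = heft xs + heft ys"
  by (simp add: heft_def)

lemma heft_pair_list: "(\<And>i. i \<in> set is \<Longrightarrow> 0 < i) \<Longrightarrow> heft (pair_list is) = 2 * (\<Sum>i\<leftarrow>is. 2 ^ nat i)"
proof (induction "is")
  case (Cons i "is")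
  have "0 < i" using Cons.prems by simp
  then have "nat \<bar>i\<bar> = nat i" by simp
  moreover have "heft (pair_list is) = 2 * (\<Sum>i\<leftarrow>is. 2 ^ nat i)" using Cons by simp
  ultimately show ?case by (simp add: heft_def)
qed (simp add: heft_def)

lemma heft_mset: "mset xs = mset ys \<Longrightarrow> heft xs = heft ys"
  unfolding heft_def by (metis mset_map sum_mset_sum_list)

text \<open>The generators of \<open>L_space n\<close> have increasing subscripts. Sorting
  \<open>s\<close> costs one sign, the same for all summands, and a repetition in \<open>s\<close>
  makes every summand vanish.\<close>

lemma omega_sum_in_L_space:
  assumes s: "set s \<subseteq> N_set n" and len: "length s + 2 \<le> n"
  shows "omega_sum n s \<in> L_space n"
proof (cases "distinct s")
  case True
  let ?t = "sort_key (pos n) s"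
  have "mset s = mset ?t" "set [] \<union> set s \<subseteq> N_set n" using s by simp_all
  from X_tuple_mset_middle[OF this] obtain e where
    e: "\<And>b. set b \<subseteq> N_set n \<Longrightarrow> X_tuple ([] @ s @ b) = of_int e * X_tuple ([] @ ?t @ b)" by blast
  have "omega_sum n s = of_int e * omega_sum n ?t"
    unfolding omega_sum_def sum_distrib_left
  proof (intro sum.cong refl)
    fix l assume "l \<in> {1..int n}"
    then show "X_tuple (s @ [l, - l]) = of_int e * X_tuple (?t @ [l, - l])"
      using e[of "[l, - l]"] by simp
  qed
  moreover have "omega_sum n ?t \<in> L_space n"
    unfolding L_space_eq
  proof (intro cp.span_base CollectI exI conjI)
    show "sorted_wrt N_less ?t" using True s by (subst sorted_N_less_iff[of _ n]) simp_all
  qed (use s len in simp_all)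
  ultimately show ?thesis unfolding L_space_eq by (simp only: of_int_mult_in_span)
next
  case False
  then have "omega_sum n s = 0" by (simp add: omega_sum_def X_tuple_def)
  then show ?thesis by (simp add: L_space_eq cp.span_zero)
qed

lemma X_tuple_swap:
  assumes "set a \<union> {x, y} \<union> set b \<subseteq> N_set n"
  shows "X_tuple (a @ x # y # b) = - X_tuple (a @ y # x # b)"
proof -
  have p: "Transposition.transpose 0 1 permutes {..<length [y, x]}"
    by (intro permutes_swap_id) auto
  have "permute_list (Transposition.transpose 0 1) [y, x] = [x, y]"
    by (simp add: permute_list_def)
  then show ?thesis
    using X_tuple_permute_middle[OF p refl, of a b n] assms by (simp add: sign_swap_id)
qed

text \<open>Each entry of \<open>zs\<close> passes both members of the pair, which costs two
  signs.\<close>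

lemma X_tuple_move_pair:
  assumes "set a \<union> {x, y} \<union> set zs \<union> set b \<subseteq> N_set n"
  shows "X_tuple (a @ x # y # zs @ b) = X_tuple (a @ zs @ x # y # b)"
  using assms
proof (induction zs arbitrary: a)
  case (Cons z zs)
  have "X_tuple (a @ x # y # z # zs @ b) = - X_tuple ((a @ [x]) @ z # y # zs @ b)"
    using X_tuple_swap[of "a @ [x]" y z "zs @ b" n] Cons.prems by simp
  also have "\<dots> = X_tuple (a @ z # x # y # zs @ b)"
    using X_tuple_swap[of a x z "y # zs @ b" n] Cons.prems by simp
  also have "\<dots> = X_tuple (a @ (z # zs) @ x # y # b)"
    using Cons.IH[of "a @ [z]"] Cons.prems by simp
  finally show ?case by simp
qed simp

lemma insort_split: "\<exists>us vs. xs = us @ vs \<and> insort i xs = us @ i # vs"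
proof (induction xs)
  case (Cons x xs)
  then obtain us vs where "xs = us @ vs" "insort i xs = us @ i # vs" by blast
  then have "x # xs = (x # us) @ vs" "i \<le> x \<or> insort i (x # xs) = (x # us) @ i # vs" by auto
  moreover have "i \<le> x \<Longrightarrow> x # xs = [] @ x # xs \<and> insort i (x # xs) = [] @ i # x # xs" by simp
  ultimately show ?case by blast
qed simp

text \<open>Pairs commute in the alternating product, so it depends only on the set
  \<open>T\<close>; sorting merely selects a representative.\<close>

definition pair_tuple :: "int list \<Rightarrow> int set \<Rightarrow> int list cpoly" where
  "pair_tuple r T = X_tuple (r @ pair_list (sorted_list_of_set T))"

lemma pair_tuple_insert:
  assumes T: "finite T" "i \<notin> T" and N: "set r \<subseteq> N_set n" "T \<subseteq> {1..int n}" "i \<in> {1..int n}"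
  shows "X_tuple (r @ pair_list (sorted_list_of_set T) @ [i, - i]) = pair_tuple r (insert i T)"
proof -
  obtain us vs where s: "sorted_list_of_set T = us @ vs" "insort i (sorted_list_of_set T) = us @ i # vs"
    using insort_split by blast
  have "T = set us \<union> set vs" using s(1) T(1) by (metis set_append set_sorted_list_of_set)
  then have uv: "set us \<subseteq> {1..int n}" "set vs \<subseteq> {1..int n}" using N(2) by auto
  have pairs: "set (pair_list xs) \<subseteq> N_set n" if "set xs \<subseteq> {1..int n}" for xs
    using that by (auto simp: set_pair_list subset_iff)
  have "pair_tuple r (insert i T) = X_tuple ((r @ pair_list us) @ i # - i # pair_list vs @ [])"
    using T s(2) by (simp add: pair_tuple_def sorted_list_of_set_insert)
  also have "\<dots> = X_tuple ((r @ pair_list us) @ pair_list vs @ i # - i # [])"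
    using N pairs[OF uv(1)] pairs[OF uv(2)] by (intro X_tuple_move_pair[of _ _ _ _ _ n]) auto
  also have "\<dots> = X_tuple (r @ pair_list (sorted_list_of_set T) @ [i, - i])" by (simp add: s(1))
  finally show ?thesis by simp
qed

lemma sum_powers_less: "(\<Sum>i\<in>{1..int l}. 2 ^ nat i) < (2 :: nat) ^ Suc l"
proof (induction l)
  case (Suc l)
  have "{1..int (Suc l)} = insert (int (Suc l)) {1..int l}" by auto
  then have "(\<Sum>i\<in>{1..int (Suc l)}. (2 :: nat) ^ nat i) = 2 ^ Suc l + (\<Sum>i\<in>{1..int l}. 2 ^ nat i)"
    by (simp del: of_nat_Suc)
  then show ?case using Suc by simp
qed simp

text \<open>The coefficients that invert the inclusion matrix between the \<open>(p - 1)\<close>-subsets and the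
  \<open>p\<close>-subsets of a set with fewer than \<open>2 p\<close> elements.\<close>

fun inclusion_coeff :: "nat \<Rightarrow> nat \<Rightarrow> complex" where
  "inclusion_coeff p 0 = 1 / of_nat p"
| "inclusion_coeff p (Suc j) = - of_nat (Suc j) * inclusion_coeff p j / (of_nat p - of_nat (Suc j))"

text \<open>Removing an element of T in Q keeps \<open>card (T - Q)\<close>, and removing one
  outside Q lowers it by 1. With j = \<open>card (T - Q)\<close> the sum is (p - j) c_j + j c_(j -
  1). For j > 0 the recursion makes it 0, as j < p keeps the denominator nonzero; for j = 0 it is p
  times 1 / p.\<close>

lemma sum_inclusion_coeff:
  assumes T: "finite T" "card T = p" and j: "card (T - Q) < p"
  shows "(\<Sum>i\<in>T. inclusion_coeff p (card (T - {i} - Q))) = (if T \<subseteq> Q then 1 else 0)"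
proof -
  let ?c = "inclusion_coeff p" and ?j = "card (T - Q)"
  have "card (T \<inter> Q) + ?j = p"
    using card_Int_Diff[OF T(1), of Q] T(2) by simp
  then have int: "card (T \<inter> Q) = p - ?j" by simp
  have "(\<Sum>i\<in>T. ?c (card (T - {i} - Q))) =
      (\<Sum>i\<in>T \<inter> Q. ?c (card (T - {i} - Q))) + (\<Sum>i\<in>T - Q. ?c (card (T - {i} - Q)))"
    by (rule sum.Int_Diff[OF T(1)])
  also have "(\<Sum>i\<in>T \<inter> Q. ?c (card (T - {i} - Q))) = (\<Sum>i\<in>T \<inter> Q. ?c ?j)"
    by (intro sum.cong refl arg_cong[where f = ?c] arg_cong[where f = card]) blast
  also have "(\<Sum>i\<in>T - Q. ?c (card (T - {i} - Q))) = (\<Sum>i\<in>T - Q. ?c (?j - 1))"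
  proof (intro sum.cong refl)
    fix i assume i: "i \<in> T - Q"
    have "T - {i} - Q = T - Q - {i}" by blast
    then show "?c (card (T - {i} - Q)) = ?c (?j - 1)" using i T(1) by simp
  qed
  finally have s: "(\<Sum>i\<in>T. ?c (card (T - {i} - Q))) = of_nat (p - ?j) * ?c ?j + of_nat ?j * ?c (?j - 1)"
    by (simp add: int)
  show ?thesis
  proof (cases "T \<subseteq> Q")
    case True
    then have "?j = 0" by (simp add: Diff_eq_empty_iff[THEN iffD2])
    then show ?thesis using s True j by simp
  next
    case False
    then have "?j \<noteq> 0" using T(1) by (simp add: Diff_eq_empty_iff)
    then obtain d where d: "?j = Suc d" using not0_implies_Suc by blast
    have "of_nat (p - Suc d) = (of_nat p - of_nat (Suc d) :: complex)"
      using j d by (intro of_nat_diff) simp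
    moreover have "(of_nat p - of_nat (Suc d) :: complex) \<noteq> 0"
      using j d by (metis less_irrefl of_nat_eq_iff right_minus_eq)
    ultimately have "of_nat (p - Suc d) * ?c (Suc d) + of_nat (Suc d) * ?c d = 0"
      by (simp del: of_nat_Suc)
    then show ?thesis using s False unfolding d by simp
  qed
qed

text \<open>Among 1, ..., l let A collect the i in c and B those with -i in c. At a violated l the
  sizes of A and B add up to more than l, whereas the size of their union and the number of absent
  pairs add up to l. Inclusion-exclusion gives the comparison.\<close>

lemma nonadmissible_pairs:
  assumes c: "distinct c" "set c \<subseteq> N_set n" "\<not> admissible n c"
  obtains l where "l \<le> n"
    "card {i \<in> {1..int l}. i \<notin> set c \<and> - i \<notin> set c} < card {i \<in> {1..int l}. i \<in> set c \<and> - i \<in> set c}"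
proof -
  obtain l where l: "l \<in> {1..n}" "l < card {x \<in> set c. \<bar>x\<bar> \<le> int l}"
    using c(1,3) by (auto simp: admissible_def not_le)
  define A B where "A = {i \<in> {1..int l}. i \<in> set c}" and "B = {i \<in> {1..int l}. - i \<in> set c}"
  have fin: "finite A" "finite B"
    by (rule finite_subset[of _ "{1..int l}"]; auto simp: A_def B_def)+
  have "{x \<in> set c. \<bar>x\<bar> \<le> int l} = A \<union> uminus ` B"
  proof (intro equalityI subsetI)
    fix x assume x: "x \<in> {x \<in> set c. \<bar>x\<bar> \<le> int l}"
    then have "x \<noteq> 0" using c(2) by (auto simp: N_set_def)
    show "x \<in> A \<union> uminus ` B"
    proof (cases "0 < x")
      case True
      then show ?thesis using x by (simp add: A_def)
    next
      case False
      then have "- x \<in> B" using x \<open>x \<noteq> 0\<close> by (simp add: B_def)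
      then show ?thesis by (metis UnI2 image_eqI minus_minus)
    qed
  qed (auto simp: A_def B_def)
  moreover have "A \<inter> uminus ` B = {}" by (auto simp: A_def B_def)
  ultimately have "card {x \<in> set c. \<bar>x\<bar> \<le> int l} = card A + card B"
    using fin by (simp add: card_Un_disjoint card_image)
  then have "l < card (A \<union> B) + card (A \<inter> B)"
    using l(2) card_Un_Int[OF fin] by simp
  moreover have "card (A \<union> B) + card ({1..int l} - (A \<union> B)) = l"
  proof -
    have "A \<union> B \<subseteq> {1..int l}" by (auto simp: A_def B_def)
    then show ?thesis using card_Diff_subset[of "A \<union> B" "{1..int l}"] fin card_mono[of "{1..int l}" "A \<union> B"] by simp
  qed
  moreover have "A \<inter> B = {i \<in> {1..int l}. i \<in> set c \<and> - i \<in> set c}"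
    "{1..int l} - (A \<union> B) = {i \<in> {1..int l}. i \<notin> set c \<and> - i \<notin> set c}"
    by (auto simp: A_def B_def)
  ultimately show thesis using l(1) by (intro that[of l]) simp_all
qed

text \<open>Modulo the span of the \<^const>\<open>omega_sum\<close>s, the wedge of the \<open>p\<close> pairs in \<open>c\<close> with absolute value at
  most \<open>l\<close> can be rewritten in terms of heavier tuples, as fewer than \<open>p\<close> pairs below \<open>l\<close> are absent.\<close>

lemma nonadmissible_step:
  assumes c: "distinct c" "set c \<subseteq> N_set n" "length c \<le> n" "\<not> admissible n c"
  shows "X_tuple c \<in> cp.span (L_space n \<union>
    {X_tuple u | u. length u = length c \<and> set u \<subseteq> N_set n \<and> heft c < heft u})" (is "_ \<in> cp.span (_ \<union> ?H)")
proof -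
  from nonadmissible_pairs[OF c(1,2,4)] obtain l where l: "l \<le> n"
    "card {i \<in> {1..int l}. i \<notin> set c \<and> - i \<notin> set c} < card {i \<in> {1..int l}. i \<in> set c \<and> - i \<in> set c}" .
  define Q M where "Q = {i \<in> {1..int l}. i \<in> set c \<and> - i \<in> set c}"
    and "M = {i \<in> {1..int l}. i \<notin> set c \<and> - i \<notin> set c}"
  \<comment> \<open>\<open>r\<close> is what remains of \<open>c\<close> after removing its
    \<open>p\<close> complete pairs, and \<open>U\<close> collects the indices up to
    \<open>l\<close> at which a pair can be inserted into \<open>r\<close> without a
    repetition.\<close>
  define p U r where "p = card Q" and "U = Q \<union> M" and "r = filter (\<lambda>x. \<bar>x\<bar> \<notin> Q) c"
  have mp: "card M < p" using l(2) by (simp add: p_def Q_def M_def)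
  have fin: "finite Q" "finite M"
    by (rule finite_subset[of _ "{1..int l}"]; auto simp: Q_def M_def)+
  then have fin: "finite Q" "finite M" "finite U" by (simp_all add: U_def)
  have Ul: "U \<subseteq> {1..int l}" and Un: "U \<subseteq> {1..int n}" using l(1) by (auto simp: U_def Q_def M_def)
  have QU: "Q \<subseteq> U" by (simp add: U_def)
  have rN: "set r \<subseteq> N_set n" using c(2) by (auto simp: r_def)
  have ms: "mset c = mset (r @ pair_list (sorted_list_of_set Q))"
  proof -
    have "mset c = mset r + mset (filter (\<lambda>x. \<bar>x\<bar> \<in> Q) c)"
      unfolding r_def by (induction c) simp_all
    moreover have "mset (filter (\<lambda>x. \<bar>x\<bar> \<in> Q) c) = mset (pair_list (sorted_list_of_set Q))"
    proof (subst set_eq_iff_mset_eq_distinct[symmetric])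
      show "distinct (filter (\<lambda>x. \<bar>x\<bar> \<in> Q) c)" using c(1) by simp
      have "distinct (pair_list is)" if "distinct is" "\<forall>i\<in>set is. 0 < i" for "is" :: "int list"
        using that by (induction "is") (auto simp: set_pair_list)
      moreover have "\<forall>i\<in>set (sorted_list_of_set Q). 0 < i" using fin(1) by (simp add: Q_def)
      ultimately show "distinct (pair_list (sorted_list_of_set Q))" by simp
      show "set (filter (\<lambda>x. \<bar>x\<bar> \<in> Q) c) = set (pair_list (sorted_list_of_set Q))"
      proof (intro equalityI subsetI)
        fix x assume "x \<in> set (filter (\<lambda>x. \<bar>x\<bar> \<in> Q) c)"
        then show "x \<in> set (pair_list (sorted_list_of_set Q))"
          using fin(1) by (cases "0 \<le> x") (auto simp: set_pair_list image_iff intro!: bexI[of _ "- x"])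
      qed (use fin(1) in \<open>auto simp: set_pair_list Q_def\<close>)
    qed
    ultimately show ?thesis by simp
  qed
  have lenr: "length r + 2 * p = length c"
    using arg_cong[OF ms, of size] fin(1) by (simp add: p_def)
  let ?L = "\<lambda>T. r @ pair_list (sorted_list_of_set T)"
  define S S' where "S = {T. T \<subseteq> U \<and> card T = p}" and "S' = {T. T \<subseteq> U \<and> card T = p - 1}"
  have finS: "finite S" "finite S'" using fin(3) by (simp_all add: S_def S'_def)
  have finT: "finite T" if "T \<subseteq> U" for T using that fin(3) finite_subset by blast
  define cf :: "int set \<Rightarrow> int list cpoly" where "cf T = cconst (inclusion_coeff p (card (T - Q)))" for T
  let ?X = "\<lambda>T i. X_tuple (?L T @ [i, - i])"
  have LN: "set (?L T) \<subseteq> N_set n" if "T \<subseteq> U" for T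
    using that Un rN finT[OF that] by (auto simp: set_pair_list subset_iff)
  have lenL: "length (?L T) + 2 = length c" if "T \<in> S'" for T
    using that finT[of T] lenr mp by (auto simp: S'_def)
  have omega: "omega_sum n (?L T) = (\<Sum>i\<in>U - T. pair_tuple r (insert i T)) + (\<Sum>i\<in>{int l + 1..int n}. ?X T i)"
    if T: "T \<in> S'" for T
  proof -
    have TU: "T \<subseteq> U" using T by (simp add: S'_def)
    have "omega_sum n (?L T) = (\<Sum>i\<in>(U - T) \<union> {int l + 1..int n}. ?X T i)"
      unfolding omega_sum_def
    proof (rule sum.mono_neutral_right)
      show "U - T \<union> {int l + 1..int n} \<subseteq> {1..int n}" using Un l(1) by auto
      \<comment> \<open>Such an \<open>i\<close> repeats a pair of \<open>T\<close>, or one of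
        \<open>i\<close>, \<open>- i\<close> already occurs in \<open>r\<close>.\<close>
      show "\<forall>i\<in>{1..int n} - (U - T \<union> {int l + 1..int n}). ?X T i = 0"
      proof
        fix i assume i: "i \<in> {1..int n} - (U - T \<union> {int l + 1..int n})"
        have "i \<in> set (?L T) \<or> - i \<in> set (?L T)"
        proof (cases "i \<in> T")
          case True
          then show ?thesis using finT[OF TU] by (simp add: set_pair_list)
        next
          case False
          then have "i \<in> {1..int l}" "i \<notin> Q" "i \<notin> M" using i by (auto simp: U_def)
          then show ?thesis by (auto simp: r_def Q_def M_def)
        qed
        then have "\<not> distinct (?L T @ [i, - i])" by auto
        then show "?X T i = 0" by (simp only: X_tuple_def if_False)
      qed
    qed simp
    also have "\<dots> = (\<Sum>i\<in>U - T. ?X T i) + (\<Sum>i\<in>{int l + 1..int n}. ?X T i)"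
      using fin(3) Ul by (intro sum.union_disjoint) auto
    also have "(\<Sum>i\<in>U - T. ?X T i) = (\<Sum>i\<in>U - T. pair_tuple r (insert i T))"
    proof (intro sum.cong refl)
      fix i assume "i \<in> U - T"
      then have i: "i \<notin> T" "i \<in> {1..int n}" "T \<subseteq> {1..int n}" using TU Un by blast+
      show "?X T i = pair_tuple r (insert i T)"
        using pair_tuple_insert[OF finT[OF TU] i(1) rN i(3,2)] by simp
    qed
    finally show ?thesis .
  qed
  have main: "(\<Sum>T\<in>S'. cf T * (\<Sum>i\<in>U - T. pair_tuple r (insert i T))) = pair_tuple r Q"
  proof -
    have "(\<Sum>T\<in>S'. cf T * (\<Sum>i\<in>U - T. pair_tuple r (insert i T))) =
        (\<Sum>(T, i)\<in>Sigma S' (\<lambda>T. U - T). cf T * pair_tuple r (insert i T))"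
      unfolding sum_distrib_left using finS(2) fin(3) by (subst sum.Sigma) auto
    \<comment> \<open>Double counting: inserting i into a (p - 1)-subset and removing i from a
      p-subset are inverse operations on the pairs (T, i).\<close>
    also have "\<dots> = (\<Sum>(T, i)\<in>Sigma S (\<lambda>T. T). cf (T - {i}) * pair_tuple r T)"
    proof (rule sum.reindex_bij_witness[of _ "\<lambda>(T, i). (T - {i}, i)" "\<lambda>(T, i). (insert i T, i)"])
      fix x assume x: "x \<in> Sigma S' (\<lambda>T. U - T)"
      then obtain T i where [simp]: "x = (T, i)" and T: "T \<subseteq> U" "card T = p - 1" "i \<in> U" "i \<notin> T"
        by (auto simp: S'_def)
      show "(case case x of (T, i) \<Rightarrow> (insert i T, i) of (T, i) \<Rightarrow> (T - {i}, i)) = x"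
        using T by simp
      show "(case x of (T, i) \<Rightarrow> (insert i T, i)) \<in> Sigma S (\<lambda>T. T)"
        using T mp finT[OF T(1)] by (simp add: S_def)
      show "(case case x of (T, i) \<Rightarrow> (insert i T, i) of (T, i) \<Rightarrow> cf (T - {i}) * pair_tuple r T) =
          (case x of (T, i) \<Rightarrow> cf T * pair_tuple r (insert i T))"
        using T by simp
    next
      fix x assume x: "x \<in> Sigma S (\<lambda>T. T)"
      then obtain T i where [simp]: "x = (T, i)" and T: "T \<subseteq> U" "card T = p" "i \<in> T"
        by (auto simp: S_def)
      show "(case case x of (T, i) \<Rightarrow> (T - {i}, i) of (T, i) \<Rightarrow> (insert i T, i)) = x"
        using T by (simp add: insert_absorb)
      show "(case x of (T, i) \<Rightarrow> (T - {i}, i)) \<in> Sigma S' (\<lambda>T. U - T)"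
        using T finT[OF T(1)] by (auto simp: S'_def)
    qed
    also have "\<dots> = (\<Sum>T\<in>S. \<Sum>i\<in>T. cf (T - {i}) * pair_tuple r T)"
      using finS(1) finT by (subst sum.Sigma) (auto simp: S_def)
    also have "\<dots> = (\<Sum>T\<in>S. if T = Q then pair_tuple r T else 0)"
    proof (intro sum.cong refl)
      fix T assume "T \<in> S"
      then have T: "T \<subseteq> U" "card T = p" "finite T" using finT by (auto simp: S_def)
      have "card (T - Q) \<le> card M" using T(1) fin(2) by (intro card_mono) (auto simp: U_def)
      then have "(\<Sum>i\<in>T. inclusion_coeff p (card (T - {i} - Q))) = (if T \<subseteq> Q then 1 else 0)"
        using mp T by (intro sum_inclusion_coeff) simp_all
      moreover have "T \<subseteq> Q \<longleftrightarrow> T = Q"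
        using card_subset_eq[OF fin(1), of T] T(2) by (auto simp: p_def)
      moreover have "(\<Sum>i\<in>T. cf (T - {i})) = cconst (\<Sum>i\<in>T. inclusion_coeff p (card (T - {i} - Q)))"
        unfolding cf_def by (rule cconst_sum[symmetric])
      ultimately show "(\<Sum>i\<in>T. cf (T - {i}) * pair_tuple r T) = (if T = Q then pair_tuple r T else 0)"
        by (simp add: cconst_one flip: sum_distrib_right)
    qed
    also have "\<dots> = pair_tuple r Q"
      using finS(1) QU by (simp add: S_def p_def)
    finally show ?thesis .
  qed
  have "(\<Sum>T\<in>S'. cf T * omega_sum n (?L T)) =
      pair_tuple r Q + (\<Sum>T\<in>S'. cf T * (\<Sum>i\<in>{int l + 1..int n}. ?X T i))"
    by (simp add: omega distrib_left sum.distrib main)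
  then have "pair_tuple r Q = (\<Sum>T\<in>S'. cf T * omega_sum n (?L T)) -
      (\<Sum>T\<in>S'. cf T * (\<Sum>i\<in>{int l + 1..int n}. ?X T i))"
    by simp
  also have "\<dots> \<in> cp.span (L_space n \<union> ?H)"
  proof (rule cp.span_diff; rule cp.span_sum)
    fix T assume T: "T \<in> S'"
    then have TU: "T \<subseteq> U" by (simp add: S'_def)
    have "omega_sum n (?L T) \<in> L_space n"
      using LN[OF TU] lenL[OF T] c(3) by (intro omega_sum_in_L_space) simp_all
    then show "cf T * omega_sum n (?L T) \<in> cp.span (L_space n \<union> ?H)"
      unfolding cf_def by (intro cp.span_scale cp.span_base UnI1)
    show "cf T * (\<Sum>i\<in>{int l + 1..int n}. ?X T i) \<in> cp.span (L_space n \<union> ?H)"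
      unfolding cf_def
    proof (intro cp.span_scale cp.span_sum cp.span_base UnI2 CollectI exI conjI)
      fix i assume i: "i \<in> {int l + 1..int n}"
      show "?X T i = X_tuple (?L T @ [i, - i])" ..
      show "length (?L T @ [i, - i]) = length c" using lenL[OF T] by simp
      show "set (?L T @ [i, - i]) \<subseteq> N_set n" using LN[OF TU] i by simp
      \<comment> \<open>The \<open>p\<close> removed pairs together weigh less than twice
        \<open>2 ^ Suc l\<close>, while the single pair of an \<open>i > l\<close> weighs at least
        that much; the pairs of \<open>T\<close> can only add to it.\<close>
      have "heft c = heft r + 2 * (\<Sum>i\<in>Q. 2 ^ nat i)"
      proof -
        have "heft c = heft r + heft (pair_list (sorted_list_of_set Q))"
          using heft_mset[OF ms] by simp
        also have "heft (pair_list (sorted_list_of_set Q)) = 2 * (\<Sum>i\<leftarrow>sorted_list_of_set Q. 2 ^ nat i)"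
          using fin(1) by (intro heft_pair_list) (auto simp: Q_def)
        also have "(\<Sum>i\<leftarrow>sorted_list_of_set Q. (2 :: nat) ^ nat i) = (\<Sum>i\<in>Q. 2 ^ nat i)"
          using fin(1) by (simp add: sum_list_distinct_conv_sum_set)
        finally show ?thesis .
      qed
      moreover have "(\<Sum>i\<in>Q. (2 :: nat) ^ nat i) \<le> (\<Sum>i\<in>{1..int l}. 2 ^ nat i)"
        by (intro sum_mono2) (auto simp: Q_def)
      moreover have "(\<Sum>i\<in>{1..int l}. (2 :: nat) ^ nat i) < 2 ^ Suc l" by (rule sum_powers_less)
      moreover have "(2 :: nat) ^ Suc l \<le> 2 ^ nat i" using i by (intro power_increasing) auto
      moreover have "heft [i, - i] = 2 * 2 ^ nat i" using i by (simp add: heft_def)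
      ultimately show "heft c < heft (?L T @ [i, - i])" by simp
    qed
  qed
  finally have Y: "pair_tuple r Q \<in> cp.span (L_space n \<union> ?H)" .
  have "set [] \<union> set c \<subseteq> N_set n" "set [] \<subseteq> N_set n" using c(2) by simp_all
  with X_tuple_mset_middle[OF ms, of "[]" n] obtain e
    where "X_tuple ([] @ c @ []) = of_int e * X_tuple ([] @ ?L Q @ [])" by blast
  then have "X_tuple c = of_int e * pair_tuple r Q" by (simp add: pair_tuple_def)
  then show ?thesis using of_int_mult_in_span[OF Y] by simp
qed

section \<open>Straightening of tableaux\<close>

definition tableau :: "int list list \<Rightarrow> int list cpoly" where
  "tableau cs = prod_list (map X_tuple cs)"

lemma tableau_simps [simp]:
  "tableau [] = 1" "tableau (c # cs) = X_tuple c * tableau cs" "tableau (cs @ ds) = tableau cs * tableau ds"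
  by (simp_all add: tableau_def)

text \<open>The multidegree of the chain product: how many factors there are of each column length.
  Since it is preserved by straightening, dimensions can be compared one multidegree at a
  time.\<close>

definition chain_type :: "nat \<Rightarrow> (int \<times> int) set list \<Rightarrow> nat multiset" where
  "chain_type n Js = mset (map (\<lambda>J. card (J \<inter> A_set n)) Js)"

definition standard_products :: "nat \<Rightarrow> nat multiset \<Rightarrow> int list cpoly set" where
  "standard_products n d = {pipes.chain_product n (P_set n) Js | Js. Js \<in> ideal_chains n \<and> chain_type n Js = d}"

definition column_shape :: "nat \<Rightarrow> int list \<Rightarrow> bool" where
  "column_shape n c \<longleftrightarrow> 1 \<le> length c \<and> length c \<le> n \<and> set c \<subseteq> N_set n"

definition total_king :: "int list list \<Rightarrow> nat" where
  "total_king cs = sum_list (map king_sum cs)"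

definition total_heft :: "int list list \<Rightarrow> nat" where
  "total_heft cs = sum_list (map heft cs)"

text \<open>Each column is counted as often as there are columns before it. Shifting part of
  \<open>king_sum\<close> from one column to the next therefore increases the value.\<close>

fun weighted_king :: "int list list \<Rightarrow> nat" where
  "weighted_king [] = 0"
| "weighted_king (c # cs) = weighted_king cs + total_king cs"

lemma king_sum_mset: "mset xs = mset ys \<Longrightarrow> king_sum xs = king_sum ys"
  unfolding king_sum_def by (metis mset_map sum_mset_sum_list)

lemma king_sum_bound: "set c \<subseteq> N_set n \<Longrightarrow> king_sum c \<le> length c * (2 * n)"
  using king_bound[of _ n] by (induction c) (auto simp: king_sum_def add_mono)

lemma heft_bound: "set c \<subseteq> N_set n \<Longrightarrow> heft c \<le> length c * 2 ^ n"
proof (induction c)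
  case (Cons x c)
  have "nat \<bar>x\<bar> \<le> n" using Cons.prems by (auto simp: N_set_def)
  then have "(2 :: nat) ^ nat \<bar>x\<bar> \<le> 2 ^ n" by (intro power_increasing) auto
  then show ?case using Cons by (simp add: heft_def add_mono)
qed (simp add: heft_def)

lemma total_king_bound:
  "(\<And>c. c \<in> set cs \<Longrightarrow> set c \<subseteq> N_set n) \<Longrightarrow> total_king cs \<le> sum_list (map length cs) * (2 * n)"
proof (induction cs)
  case (Cons c cs)
  then have "king_sum c \<le> length c * (2 * n)" "total_king cs \<le> sum_list (map length cs) * (2 * n)"
    using king_sum_bound by simp_all
  then show ?case by (simp add: total_king_def distrib_right)
qed (simp add: total_king_def)

lemma total_heft_bound:
  "(\<And>c. c \<in> set cs \<Longrightarrow> set c \<subseteq> N_set n) \<Longrightarrow> total_heft cs \<le> sum_list (map length cs) * 2 ^ n"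
proof (induction cs)
  case (Cons c cs)
  then have "heft c \<le> length c * 2 ^ n" "total_heft cs \<le> sum_list (map length cs) * 2 ^ n"
    using heft_bound by simp_all
  then show ?case by (simp add: total_heft_def distrib_right)
qed (simp add: total_heft_def)

lemma weighted_king_bound: "weighted_king cs \<le> length cs * total_king cs"
proof (induction cs)
  case (Cons c cs)
  have "weighted_king cs + total_king cs \<le> Suc (length cs) * total_king cs" using Cons by simp
  also have "\<dots> \<le> Suc (length cs) * total_king (c # cs)"
    by (intro mult_left_mono) (simp_all add: total_king_def)
  finally show ?case by simp
qed simp

lemma weighted_king_append_less:
  "total_king xs = total_king ys \<Longrightarrow> weighted_king xs < weighted_king ys \<Longrightarrow>
    weighted_king (pre @ xs) < weighted_king (pre @ ys)"
  by (induction pre) (simp_all add: total_king_def)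

lemma weighted_king_map_sort: "weighted_king (map (sort_key f) cs) = weighted_king cs"
proof -
  have "king_sum (sort_key f c) = king_sum c" for c by (rule king_sum_mset) simp
  then have "total_king (map (sort_key f) cs) = total_king cs" for cs by (simp add: total_king_def o_def)
  then show ?thesis by (induction cs) simp_all
qed

text \<open>Replacing a nonadmissible column increases \<^const>\<open>total_heft\<close>; the exchange of entries between
  adjacent columns keeps it and increases \<^const>\<open>weighted_king\<close>. Both are bounded.\<close>

definition straighten_measure :: "nat \<Rightarrow> int list list \<Rightarrow> nat \<times> nat" where
  "straighten_measure n cs = (sum_list (map length cs) * 2 ^ n - total_heft cs,
    length cs * (sum_list (map length cs) * (2 * n)) - weighted_king cs)"

lemma straighten_measure_less:
  assumes len: "map length ds = map length cs" and ds: "\<And>d. d \<in> set ds \<Longrightarrow> set d \<subseteq> N_set n"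
    and less: "total_heft cs < total_heft ds \<or>
      total_heft cs = total_heft ds \<and> weighted_king cs < weighted_king ds"
  shows "(straighten_measure n ds, straighten_measure n cs) \<in> less_than <*lex*> less_than"
proof -
  have "total_heft ds \<le> sum_list (map length cs) * 2 ^ n"
    using total_heft_bound[of ds n] ds len by simp
  moreover have "weighted_king ds \<le> length cs * (sum_list (map length cs) * (2 * n))"
  proof -
    have "weighted_king ds \<le> length ds * total_king ds" by (rule weighted_king_bound)
    also have "\<dots> \<le> length ds * (sum_list (map length ds) * (2 * n))"
      using total_king_bound[of ds n] ds by (intro mult_left_mono) simp_all
    finally show ?thesis using len map_eq_imp_length_eq[OF len] by simp
  qed
  ultimately show ?thesis
    using less len map_eq_imp_length_eq[OF len] unfolding straighten_measure_def by auto
qed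

lemma tableau_carrier:
  "(\<And>c. c \<in> set cs \<Longrightarrow> column_shape n c) \<Longrightarrow> tableau cs \<in> carrier (cpoly_alg (S_vars n))"
  unfolding tableau_def by (rule cpoly_alg_prod_list) (simp add: column_shape_def X_tuple_carrier)

text \<open>Longer columns with smaller entries have larger ideals, so the ideals shrink from left
  to right and the chain is the reversed list.\<close>

lemma standard_tableau:
  assumes cols: "\<And>c. c \<in> set cs \<Longrightarrow> king_column n c"
    and len: "sorted_wrt (\<ge>) (map length cs)"
    and rows: "\<And>i r. Suc i < length cs \<Longrightarrow> r < length (cs ! Suc i) \<Longrightarrow> king (cs ! i ! r) \<le> king (cs ! Suc i ! r)"
  shows "tableau cs \<in> standard_products n (mset (map length cs))"
proof -
  interpret pipes n "P_set n" by (rule pipes_P)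
  let ?Js = "rev (map (column_ideal n) cs)"
  have "sorted_wrt (\<lambda>c d. column_ideal n d \<subseteq> column_ideal n c) cs"
  proof (subst sorted_wrt_iff_nth_Suc_transp)
    show "transp (\<lambda>c d. column_ideal n d \<subseteq> column_ideal n c)" by (rule transpI) blast
    show "\<forall>i. Suc i < length cs \<longrightarrow> column_ideal n (cs ! Suc i) \<subseteq> column_ideal n (cs ! i)"
    proof (intro allI impI)
      fix i assume i: "Suc i < length cs"
      have "length (cs ! Suc i) \<le> length (cs ! i)"
        using sorted_wrt_nth_less[OF len, of i "Suc i"] i by simp
      then show "column_ideal n (cs ! Suc i) \<subseteq> column_ideal n (cs ! i)"
        using rows[OF i] by (rule column_ideal_mono)
    qed
  qed
  then have "sorted_wrt (\<subseteq>) ?Js" by (simp add: sorted_wrt_rev sorted_wrt_map)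
  moreover have "column_ideal n c \<in> order_ideals n - {{}}" if "c \<in> set cs" for c
  proof -
    have "card (column_ideal n c \<inter> A_set n) \<noteq> 0"
      using card_column_ideal[OF cols[OF that]] cols[OF that] by (auto simp: king_column_def)
    then show ?thesis using column_ideal_order_ideal[OF cols[OF that]] by auto
  qed
  ultimately have "?Js \<in> ideal_chains n" by (auto simp: ideal_chains_def)
  moreover have "chain_type n ?Js = mset (map length cs)"
  proof -
    have "map (\<lambda>c. card (column_ideal n c \<inter> A_set n)) cs = map length cs"
      using cols card_column_ideal by (intro map_cong) simp_all
    then show ?thesis unfolding chain_type_def rev_map[symmetric] mset_rev map_map o_def by (rule arg_cong)
  qed
  moreover have "chain_product ?Js = tableau cs"
  proof -
    have "map (\<lambda>c. X_tuple (ideal_tuple (column_ideal n c))) cs = map X_tuple cs"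
      using cols ideal_tuple_column_ideal by (intro map_cong) simp_all
    then show ?thesis
      unfolding chain_product_def tableau_def rev_map[symmetric] map_map o_def prod_list.rev by (rule arg_cong)
  qed
  ultimately show ?thesis unfolding standard_products_def by (intro CollectI exI[of _ ?Js]) simp
qed

lemma tableau_sort:
  assumes "\<And>c. c \<in> set cs \<Longrightarrow> set c \<subseteq> N_set n"
  shows "\<exists>e. tableau cs = of_int e * tableau (map (sort_key f) cs)"
  using assms
proof (induction cs)
  case Nil
  show ?case by (rule exI[of _ 1]) simp
next
  case (Cons c cs)
  then obtain e where e: "tableau cs = of_int e * tableau (map (sort_key f) cs)" by auto
  have "mset c = mset (sort_key f c)" "set [] \<union> set c \<subseteq> N_set n" "set [] \<subseteq> N_set n" using Cons.prems by simp_all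
  then obtain e' where "X_tuple ([] @ c @ []) = of_int e' * X_tuple ([] @ sort_key f c @ [])"
    using X_tuple_mset_middle by blast
  then have "tableau (c # cs) = of_int (e' * e) * tableau (map (sort_key f) (c # cs))"
    using e by (simp add: ac_simps)
  then show ?case by blast
qed

text \<open>\<open>K\<close> collects what is discarded: a set that absorbs products and contains
  both kinds of relations. All replacements keep the column lengths, so only standard products of
  the multidegree of \<open>cs\<close> appear.\<close>

lemma straightening:
  assumes K: "\<And>p q. p \<in> K \<Longrightarrow> q \<in> carrier (cpoly_alg (S_vars n)) \<Longrightarrow> p * q \<in> K"
      "I_A n \<subseteq> K" "L_space n \<subseteq> K"
    and cs: "\<And>c. c \<in> set cs \<Longrightarrow> column_shape n c" "sorted_wrt (\<ge>) (map length cs)"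
  shows "tableau cs \<in> cp.span (standard_products n (mset (map length cs)) \<union> K)"
proof -
  have "wf (inv_image (less_than <*lex*> less_than) (straighten_measure n))" by auto
  then show ?thesis using cs
  proof (induction cs rule: wf_induct_rule)
    case (less cs)
    let ?S = "cp.span (standard_products n (mset (map length cs)) \<union> K)"
    \<comment> \<open>Sorting the columns in King's order costs a sign and changes neither
      \<open>total_heft\<close> nor \<open>weighted_king\<close>, so progress may be measured
      against \<open>ds\<close>.\<close>
    define ds where "ds = map (sort_key king) cs"
    have shape_ds: "column_shape n d" if d: "d \<in> set ds" for d
    proof -
      obtain c where "c \<in> set cs" "d = sort_key king c" using d by (auto simp: ds_def)
      then show ?thesis using less.prems(1)[of c] by (simp add: column_shape_def)
    qed
    have len_ds: "map length ds = map length cs" by (simp add: ds_def o_def)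
    have "heft (sort_key king c) = heft c" for c by (rule heft_mset) simp
    then have heft_ds: "total_heft ds = total_heft cs" by (simp add: total_heft_def ds_def o_def)
    have wk_ds: "weighted_king ds = weighted_king cs" unfolding ds_def by (rule weighted_king_map_sort)
    have IH: "tableau fs \<in> ?S"
      if "map length fs = map length ds" "\<And>c. c \<in> set fs \<Longrightarrow> set c \<subseteq> N_set n"
        and "total_heft ds < total_heft fs \<or> total_heft ds = total_heft fs \<and> weighted_king ds < weighted_king fs" for fs
    proof -
      have len: "map length fs = map length cs" using that(1) len_ds by simp
      have "(fs, cs) \<in> inv_image (less_than <*lex*> less_than) (straighten_measure n)"
        using straighten_measure_less[OF len that(2)] that(3) heft_ds wk_ds by simp
      moreover have "column_shape n c" if "c \<in> set fs" for c
      proof -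
        have "length c \<in> set (map length cs)" using that len by (metis image_eqI set_map)
        then show ?thesis using less.prems(1) \<open>\<And>c. c \<in> set fs \<Longrightarrow> set c \<subseteq> N_set n\<close>[OF that]
          by (auto simp: column_shape_def)
      qed
      ultimately have "tableau fs \<in> cp.span (standard_products n (mset (map length fs)) \<union> K)"
        using less.prems(2) len by (intro less.IH) simp_all
      then show ?thesis by (simp add: len)
    qed
    have "tableau ds \<in> ?S"
    proof (cases "\<exists>d\<in>set ds. \<not> distinct d")
      case True
      then obtain pre d post where "ds = pre @ d # post" "\<not> distinct d" by (metis split_list)
      then have "tableau ds = 0" by (simp add: X_tuple_def)
      then show ?thesis by (simp add: cp.span_zero)
    next
      case False
      then have dist: "distinct d" if "d \<in> set ds" for d using that by blast
      have king_sorted: "sorted_wrt (\<lambda>x y. king x < king y) d" if "d \<in> set ds" for d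
      proof -
        obtain c where "c \<in> set cs" "d = sort_key king c" using \<open>d \<in> set ds\<close> by (auto simp: ds_def)
        then show ?thesis
          using king_sort[of c n] dist[OF that] less.prems(1)[of c] by (simp add: column_shape_def)
      qed
      have carrier: "tableau pre * tableau post \<in> carrier (cpoly_alg (S_vars n))"
        if "set pre \<union> set post \<subseteq> set ds" for pre post
        using that shape_ds by (intro cpoly_alg_mult tableau_carrier) blast+
      consider (nonadm) d where "d \<in> set ds" "\<not> admissible n d"
        | (violation) i r where "Suc i < length ds" "r < length (ds ! Suc i)"
            "king (ds ! Suc i ! r) < king (ds ! i ! r)"
        | (standard) "\<And>d. d \<in> set ds \<Longrightarrow> admissible n d"
            "\<And>i r. Suc i < length ds \<Longrightarrow> r < length (ds ! Suc i) \<Longrightarrow> king (ds ! i ! r) \<le> king (ds ! Suc i ! r)"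
        by (metis not_le)
      then show ?thesis
      proof cases
        case nonadm
        then obtain pre post where ds: "ds = pre @ d # post" by (metis split_list)
        have d: "distinct d" "set d \<subseteq> N_set n" "length d \<le> n"
          using dist[OF nonadm(1)] shape_ds[OF nonadm(1)] by (simp_all add: column_shape_def)
        have "X_tuple d * (tableau pre * tableau post) \<in> ?S"
        proof (rule cp_span_mult_right[OF nonadmissible_step[OF d nonadm(2)]])
          fix g assume "g \<in> L_space n \<union> {X_tuple u | u. length u = length d \<and> set u \<subseteq> N_set n \<and> heft d < heft u}"
          then show "g * (tableau pre * tableau post) \<in> ?S"
          proof
            assume "g \<in> L_space n"
            then have "g * (tableau pre * tableau post) \<in> K"
              using K(3) carrier[of pre post] by (intro K(1)) (auto simp: ds)
            then show ?thesis by (intro cp.span_base UnI2)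
          next
            assume "g \<in> {X_tuple u | u. length u = length d \<and> set u \<subseteq> N_set n \<and> heft d < heft u}"
            then obtain u where u: "g = X_tuple u" "length u = length d" "set u \<subseteq> N_set n" "heft d < heft u"
              by blast
            have "tableau (pre @ u # post) \<in> ?S"
            proof (rule IH)
              show "set c \<subseteq> N_set n" if "c \<in> set (pre @ u # post)" for c
                using that u(3) shape_ds[of c] by (auto simp: ds column_shape_def)
              show "total_heft ds < total_heft (pre @ u # post) \<or>
                  total_heft ds = total_heft (pre @ u # post) \<and> weighted_king ds < weighted_king (pre @ u # post)"
                using u(4) by (simp add: ds total_heft_def)
            qed (simp add: ds u(2))
            then show ?thesis by (simp add: u(1) mult.left_commute)
          qed
        qed
        then show ?thesis by (simp add: ds mult.left_commute)
      next
        case violation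
        define pre a b post where "pre = take i ds" and "a = ds ! i" and "b = ds ! Suc i" and "post = drop (Suc (Suc i)) ds"
        have ds: "ds = pre @ a # b # post"
          unfolding pre_def a_def b_def post_def using violation(1)
          by (metis Cons_nth_drop_Suc Suc_lessD append_take_drop_id)
        have ab: "a \<in> set ds" "b \<in> set ds" by (simp_all add: ds)
        have N: "set a \<union> set b \<subseteq> N_set n" "length a \<le> n"
          using shape_ds[OF ab(1)] shape_ds[OF ab(2)] by (simp_all add: column_shape_def)
        have "sorted_wrt (\<ge>) (map length ds)" using less.prems(2) by (simp only: len_ds)
        then have lab: "length b \<le> length a" by (simp add: ds sorted_wrt_append)
        note ex = exchange_step[OF king_sorted[OF ab(1)] king_sorted[OF ab(2)] N(1) lab N(2)
            violation(2,3)[folded a_def b_def]]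
        have "X_tuple a * X_tuple b * (tableau pre * tableau post) \<in> ?S"
        proof (rule cp_span_mult_right[OF ex])
          fix g assume "g \<in> I_A n \<union> {X_tuple u * X_tuple v | u v. length u = length a \<and> length v = length b \<and>
            set u \<union> set v \<subseteq> N_set n \<and> mset u + mset v = mset a + mset b \<and> king_sum u < king_sum a}"
          then show "g * (tableau pre * tableau post) \<in> ?S"
          proof
            assume "g \<in> I_A n"
            then have "g * (tableau pre * tableau post) \<in> K"
              using K(2) carrier[of pre post] by (intro K(1)) (auto simp: ds)
            then show ?thesis by (intro cp.span_base UnI2)
          next
            assume "g \<in> {X_tuple u * X_tuple v | u v. length u = length a \<and> length v = length b \<and>
              set u \<union> set v \<subseteq> N_set n \<and> mset u + mset v = mset a + mset b \<and> king_sum u < king_sum a}"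
            then obtain u v where uv: "g = X_tuple u * X_tuple v" "length u = length a" "length v = length b"
              "set u \<union> set v \<subseteq> N_set n" "mset u + mset v = mset a + mset b" "king_sum u < king_sum a"
              by blast
            have "mset (u @ v) = mset (a @ b)" using uv(5) by simp
            from king_sum_mset[OF this] heft_mset[OF this]
            have sums: "king_sum u + king_sum v = king_sum a + king_sum b" "heft u + heft v = heft a + heft b"
              by (simp_all add: king_sum_def)
            have "tableau (pre @ u # v # post) \<in> ?S"
            proof (rule IH)
              show "set c \<subseteq> N_set n" if "c \<in> set (pre @ u # v # post)" for c
                using that uv(4) shape_ds[of c] by (auto simp: ds column_shape_def)
              \<comment> \<open>The right column gains exactly what the left one loses.\<close>
              have "weighted_king ds < weighted_king (pre @ u # v # post)"
                unfolding ds using sums(1) uv(6)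
                by (intro weighted_king_append_less) (simp_all add: total_king_def)
              moreover have "total_heft ds = total_heft (pre @ u # v # post)"
                using sums(2) by (simp add: ds total_heft_def)
              ultimately show "total_heft ds < total_heft (pre @ u # v # post) \<or>
                  total_heft ds = total_heft (pre @ u # v # post) \<and> weighted_king ds < weighted_king (pre @ u # v # post)"
                by simp
            qed (simp add: ds uv(2,3))
            then show ?thesis by (simp add: uv(1) ac_simps)
          qed
        qed
        then show ?thesis by (simp add: ds ac_simps)
      next
        case standard
        have "tableau ds \<in> standard_products n (mset (map length ds))"
        proof (rule standard_tableau)
          show "king_column n d" if "d \<in> set ds" for d
            using shape_ds[OF that] king_sorted[OF that] standard(1)[OF that]
            by (intro king_column_admissible) (simp_all add: column_shape_def)
          show "sorted_wrt (\<ge>) (map length ds)" using less.prems(2) by (simp only: len_ds)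
        qed (rule standard(2))
        then show ?thesis unfolding len_ds by (intro cp.span_base UnI1)
      qed
    qed
    moreover obtain e where "tableau cs = of_int e * tableau ds"
      using tableau_sort[of cs n king] less.prems(1) unfolding ds_def column_shape_def by blast
    ultimately show ?case by (simp only: of_int_mult_in_span)
  qed
qed

section \<open>The ideal of the symplectic Pluecker algebra\<close>

lemma admissible_mset: "mset s = mset t \<Longrightarrow> admissible n s \<longleftrightarrow> admissible n t"
  using mset_eq_imp_distinct_iff[of s t] mset_eq_setD[of s t] by (simp add: admissible_def)

lemma Theta_column_shape: "t \<in> S_vars n \<Longrightarrow> column_shape n t"
  by (simp add: S_vars_def column_shape_def)

lemma cvar_eq_X_tuple: "t \<in> S_vars n \<Longrightarrow> cvar t = X_tuple t"
  using X_tuple_sorted[of t n] by (simp add: S_vars_def)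

lemma Theta_sub: "Theta n \<subseteq> S_vars n"
  by (auto simp: Theta_def)

section \<open>Admissible variables and reduction modulo the linear relations\<close>

lemma X_tuple_Theta:
  assumes c: "column_shape n c" "admissible n c"
  shows "\<exists>e. \<exists>s\<in>Theta n. X_tuple c = of_int e * cvar s"
proof -
  have c': "set c \<subseteq> N_set n" "distinct c" using c by (simp_all add: column_shape_def admissible_def)
  from X_tuple_cases[OF c'] obtain s e where s: "sorted_wrt N_less s" "set s = set c"
    "length s = length c" "e = 1 \<or> e = -1" "X_tuple c = of_int e * cvar s" .
  have "distinct s" using sorted_N_less_iff[of s n] s(1,2) c' by simp
  then have "admissible n s" using c(2) s(2) by (simp add: admissible_def)
  then have "s \<in> Theta n" using s c(1) by (simp add: Theta_def S_vars_def column_shape_def)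
  then show ?thesis using s(5) by blast
qed

lemma span_L_space: "cp.span (L_space n) = L_space n"
  by (simp add: L_space_eq cp.span_span)

text \<open>Induction on the distance of \<open>heft\<close> from its upper bound:
  \<open>nonadmissible_step\<close> leaves only heavier tuples of the same length.\<close>

lemma X_tuple_mod_L_space:
  "column_shape n c \<Longrightarrow> X_tuple c \<in> cp.span (L_space n \<union> cvar ` Theta n)"
proof (induction "length c * 2 ^ n - heft c" arbitrary: c rule: less_induct)
  case less
  let ?S = "cp.span (L_space n \<union> cvar ` Theta n)"
  have c: "set c \<subseteq> N_set n" "length c \<le> n" "1 \<le> length c"
    using less.prems by (simp_all add: column_shape_def)
  show ?case
  proof (cases "distinct c")
    case False
    then show ?thesis by (simp add: X_tuple_def cp.span_zero)
  next
    case dist: True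
    show ?thesis
    proof (cases "admissible n c")
      case True
      then obtain e s where "s \<in> Theta n" "X_tuple c = of_int e * cvar s"
        using X_tuple_Theta[OF less.prems] by blast
      then show ?thesis by (simp add: of_int_mult_in_span cp.span_base)
    next
      case False
      have "X_tuple u \<in> ?S" if u: "length u = length c" "set u \<subseteq> N_set n" "heft c < heft u" for u
      proof (rule less.hyps)
        show "column_shape n u" using u c by (simp add: column_shape_def)
        show "length u * 2 ^ n - heft u < length c * 2 ^ n - heft c"
          using heft_bound[OF u(2)] u by simp
      qed
      then have "L_space n \<union> {X_tuple u | u. length u = length c \<and> set u \<subseteq> N_set n \<and> heft c < heft u} \<subseteq> ?S"
        by (auto intro: cp.span_base)
      with nonadmissible_step[OF dist c(1,2) False] show ?thesis by (rule cp_span_trans)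
    qed
  qed
qed

lemma rho1_exists:
  assumes "t \<in> S_vars n"
  shows "\<exists>R \<in> cp.span (cvar ` Theta n). cvar t - R \<in> L_space n"
proof -
  have "cvar t \<in> cp.span (L_space n \<union> cvar ` Theta n)"
    using X_tuple_mod_L_space[OF Theta_column_shape[OF assms]] by (simp add: cvar_eq_X_tuple[OF assms])
  then obtain x R where "cvar t = x + R" "x \<in> L_space n" "R \<in> cp.span (cvar ` Theta n)"
    unfolding cp.span_Un span_L_space by blast
  then show ?thesis by (intro bexI[of _ R]) simp_all
qed

lemma isotropic_eval_add: "isotropic_eval n (p + q) = isotropic_eval n p + isotropic_eval n q"
  by (simp add: isotropic_eval_def cpoly_hom_add)

lemma isotropic_eval_diff: "isotropic_eval n (p - q) = isotropic_eval n p - isotropic_eval n q"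
  unfolding isotropic_eval_def by (rule ph.hom_minus)

lemma isotropic_eval_sum_scaled:
  "isotropic_eval n (\<Sum>x\<in>A. cconst (a x) * f x) = (\<Sum>x\<in>A. cconst (a x) * isotropic_eval n (f x))"
  by (simp add: isotropic_eval_def cpoly_hom_sum cpoly_hom_mult cpoly_hom_cconst)

lemma span_image_finite:
  assumes "x \<in> cp.span (f ` A)" "inj_on f A"
  obtains F a where "finite F" "F \<subseteq> A" "x = (\<Sum>i\<in>F. cconst (a i) * f i)"
proof -
  from assms(1) obtain S u where S: "finite S" "S \<subseteq> f ` A" "x = (\<Sum>v\<in>S. cconst (u v) * v)"
    unfolding cp.span_explicit by blast
  from finite_subset_image[OF S(1,2)] obtain F where F: "F \<subseteq> A" "finite F" "S = f ` F" by blast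
  have "inj_on f F" using assms(2) F(1) inj_on_subset by blast
  then have "x = (\<Sum>i\<in>F. cconst (u (f i)) * f i)" unfolding S(3) F(3) by (simp add: sum.reindex o_def)
  then show thesis by (rule that[OF F(2,1)])
qed

context pipes
begin

lemma eval_chain_product_inj:
  assumes "1 \<le> n"
  shows "inj_on (\<lambda>Js. isotropic_eval n (chain_product Js)) (ideal_chains n)"
proof (rule inj_onI, rule ccontr)
  fix Js Js'
  assume *: "Js \<in> ideal_chains n" "Js' \<in> ideal_chains n"
    "isotropic_eval n (chain_product Js) = isotropic_eval n (chain_product Js')" "Js \<noteq> Js'"
  let ?a = "\<lambda>Ks. if Ks = Js then 1 else (-1 :: complex)"
  have m1: "cconst (-1) = (-1 :: 'b cpoly)" using cconst_of_int[of "-1"] by simp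
  have "(\<Sum>Ks\<in>{Js, Js'}. cconst (?a Ks) * isotropic_eval n (chain_product Ks)) = 0"
    using *(3,4) by (simp add: m1 cconst_one)
  then have "?a Js = 0"
    by (intro chain_products_independent[OF assms, where F = "{Js, Js'}" and a = ?a]) (use * in auto)
  then show False by simp
qed

lemma chain_product_inj: "1 \<le> n \<Longrightarrow> inj_on chain_product (ideal_chains n)"
  using eval_chain_product_inj by (rule inj_on_imageI2[unfolded o_def, of "isotropic_eval n"])

lemma eval_zero_imp_zero:
  assumes "1 \<le> n" "g \<in> cp.span (chain_product ` ideal_chains n)" "isotropic_eval n g = 0"
  shows "g = 0"
proof -
  from span_image_finite[OF assms(2) chain_product_inj[OF assms(1)]] obtain F a
    where F: "finite F" "F \<subseteq> ideal_chains n" "g = (\<Sum>Js\<in>F. cconst (a Js) * chain_product Js)" .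
  have "a Js = 0" if "Js \<in> F" for Js
    using chain_products_independent[OF assms(1) F(1,2) _ that, of a] assms(3)
    by (simp add: F(3) isotropic_eval_sum_scaled)
  then show ?thesis by (simp add: F(3))
qed

text \<open>\<open>rank_less\<close> separates the entries. Since the entry in row i has absolute
  value at least i, an entry of absolute value at most l stands among the first l.\<close>

lemma ideal_tuple_admissible:
  assumes J: "J \<in> order_ideals n"
  shows "admissible n (ideal_tuple J)"
proof -
  let ?t = "ideal_tuple J" and ?k = "card (J \<inter> A_set n)"
  have ne: "?t ! r \<noteq> ?t ! s" if "r < s" "s < ?k" for r s
  proof -
    have "rank (int r + 1) (w_ideal n Q J (int r + 1)) < rank (int r + 1) (w_ideal n Q J (int s + 1))"
      using ideal_tuple_P(1)[OF J that(2)] that(1) by (intro rank_less[OF J]) simp_all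
    then show ?thesis using that by (auto simp: ideal_tuple_nth)
  qed
  then have "distinct ?t" unfolding distinct_conv_nth by (metis length_ideal_tuple linorder_neqE_nat)
  moreover have "card {x \<in> set ?t. \<bar>x\<bar> \<le> int l} \<le> l" for l
  proof -
    have "{x \<in> set ?t. \<bar>x\<bar> \<le> int l} \<subseteq> (!) ?t ` {..<l}"
    proof
      fix x assume x: "x \<in> {x \<in> set ?t. \<bar>x\<bar> \<le> int l}"
      then obtain r where r: "r < ?k" "x = ?t ! r" by (auto simp: in_set_conv_nth)
      then have "int r + 1 \<le> \<bar>x\<bar>" using ideal_tuple_P(2)[OF J r(1)] by (simp add: P_set_iff)
      then show "x \<in> (!) ?t ` {..<l}" using x r(2) by auto
    qed
    then have "card {x \<in> set ?t. \<bar>x\<bar> \<le> int l} \<le> card ((!) ?t ` {..<l})" by (intro card_mono) simp_all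
    also have "\<dots> \<le> l" using card_image_le[of "{..<l}" "(!) ?t"] by simp
    finally show ?thesis .
  qed
  ultimately show ?thesis by (simp add: admissible_def)
qed

lemma ideal_tuple_shape:
  assumes "J \<in> order_ideals n" "J \<noteq> {}"
  shows "column_shape n (ideal_tuple J)"
  using order_ideal_nonempty(2)[OF assms] card_diag_le[OF order_ideal_P[OF assms(1)]] ideal_tuple_N[OF assms(1)]
  by (simp add: column_shape_def)

lemma chain_product_Theta:
  assumes "Js \<in> ideal_chains n"
  shows "chain_product Js \<in> carrier (cpoly_alg (Theta n))"
  unfolding chain_product_def
proof (rule cpoly_alg_prod_list)
  fix J assume "J \<in> set Js"
  then have J: "J \<in> order_ideals n" "J \<noteq> {}" using assms by (auto simp: ideal_chains_def)
  from X_tuple_Theta[OF ideal_tuple_shape[OF J] ideal_tuple_admissible[OF J(1)]]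
  obtain e s where s: "s \<in> Theta n" "X_tuple (ideal_tuple J) = of_int e * cvar s" by blast
  show "X_tuple (ideal_tuple J) \<in> carrier (cpoly_alg (Theta n))"
    unfolding s(2) by (rule cpoly_alg_mult[OF cpoly_alg_of_int cpoly_alg_cvar[OF s(1)]])
qed

end

text \<open>Up to sign an admissible variable is the product of a one-element chain for
  \<open>P_set n\<close>. Evaluation is injective on the span of such products and kills
  \<open>L_space n\<close>. This is the uniqueness of R in the definition of
  \<open>rho1\<close>.\<close>

lemma L_space_Theta_zero:
  assumes n: "1 \<le> n" and R: "R \<in> cp.span (cvar ` Theta n)" "R \<in> L_space n"
  shows "R = 0"
proof -
  interpret pipes n "P_set n" by (rule pipes_P)
  have "\<exists>c. cvar t = cconst c * chain_product [column_ideal n (sort_key king t)] \<and>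
      [column_ideal n (sort_key king t)] \<in> ideal_chains n" if t: "t \<in> Theta n" for t
  proof -
    let ?s = "sort_key king t"
    have ts: "t \<in> S_vars n" "admissible n t" using t by (simp_all add: Theta_def)
    then have N: "set t \<subseteq> N_set n" "1 \<le> length t" "length t \<le> n" "distinct t"
      by (simp_all add: S_vars_def admissible_def)
    have "admissible n ?s" using ts(2) admissible_mset[of ?s t n] by simp
    then have col: "king_column n ?s"
      using N king_sort[of t n] by (intro king_column_admissible) simp_all
    have "mset t = mset ?s" "set [] \<union> set t \<subseteq> N_set n" using N by simp_all
    from X_tuple_mset_middle[OF this] obtain e where
      e: "\<forall>b. set b \<subseteq> N_set n \<longrightarrow> X_tuple ([] @ t @ b) = of_int e * X_tuple ([] @ ?s @ b)" by blast
    from e[rule_format, of "[]"] have "cvar t = cconst (of_int e) * X_tuple ?s"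
      by (simp add: cvar_eq_X_tuple[OF ts(1)] cconst_of_int)
    moreover have "chain_product [column_ideal n ?s] = X_tuple ?s"
      by (simp add: chain_product_def ideal_tuple_column_ideal[OF col])
    moreover have "column_ideal n ?s \<noteq> {}" using card_column_ideal[OF col] N(2) by auto
    then have "[column_ideal n ?s] \<in> ideal_chains n"
      using column_ideal_order_ideal[OF col] by (simp add: ideal_chains_def)
    ultimately show ?thesis by (intro exI[of _ "of_int e"]) simp
  qed
  note * = this
  have "cvar ` Theta n \<subseteq> cp.span (chain_product ` ideal_chains n)"
  proof clarify
    fix t assume "t \<in> Theta n"
    from *[OF this] obtain c
      where c: "cvar t = cconst c * chain_product [column_ideal n (sort_key king t)]"
        "[column_ideal n (sort_key king t)] \<in> ideal_chains n" by blast
    show "cvar t \<in> cp.span (chain_product ` ideal_chains n)"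
      unfolding c(1) by (intro cp.span_scale cp.span_base imageI c(2))
  qed
  with R(1) have "R \<in> cp.span (chain_product ` ideal_chains n)" by (rule cp_span_trans)
  then show ?thesis using eval_zero_imp_zero[OF n] isotropic_eval_L_space[OF R(2)] by blast
qed

lemma rho1_cvar:
  assumes n: "1 \<le> n" and t: "t \<in> S_vars n"
  shows "rho1 n (cvar t) \<in> cp.span (cvar ` Theta n)" "cvar t - rho1 n (cvar t) \<in> L_space n"
proof -
  have span: "cspan (S_vars n) (cvar ` Theta n) = cp.span (cvar ` Theta n)"
    using Theta_sub[of n] by (intro cspan_eq_span) (auto intro: cpoly_alg_cvar)
  have L0: "0 \<in> L_space n" by (simp add: L_space_eq cp.span_zero)
  have "rho1 n (cvar t) \<in> cp.span (cvar ` Theta n) \<and> cvar t - rho1 n (cvar t) \<in> L_space n"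
  proof (cases "t \<in> Theta' n")
    case False
    then have "t \<in> Theta n" using t by (simp add: Theta_def Theta'_def)
    then show ?thesis using False L0 by (simp add: rho1_def cpoly_hom_cvar cp.span_base)
  next
    case True
    let ?P = "\<lambda>R. R \<in> cp.span (cvar ` Theta n) \<and> cvar t - R \<in> L_space n"
    have "\<exists>!R. ?P R"
    proof (rule ex_ex1I)
      show "\<exists>R. ?P R" using rho1_exists[OF t] by blast
      fix R R' assume "?P R" "?P R'"
      then have "R - R' \<in> cp.span (cvar ` Theta n)" "(cvar t - R') - (cvar t - R) \<in> L_space n"
        unfolding L_space_eq by (blast intro: cp.span_diff)+
      then have "R - R' = 0" by (intro L_space_Theta_zero[OF n]) simp_all
      then show "R = R'" by simp
    qed
    from theI'[OF this] show ?thesis using True by (simp add: rho1_def cpoly_hom_cvar span)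
  qed
  then show "rho1 n (cvar t) \<in> cp.span (cvar ` Theta n)" "cvar t - rho1 n (cvar t) \<in> L_space n" by auto
qed

lemma rho1_Theta: "p \<in> carrier (cpoly_alg (Theta n)) \<Longrightarrow> rho1 n p = p"
proof -
  assume p: "p \<in> carrier (cpoly_alg (Theta n))"
  have "rho1 n p = cpoly_hom cvar p"
    unfolding rho1_def by (rule cpoly_hom_cong[OF p]) (simp add: Theta_def Theta'_def)
  then show ?thesis by (simp add: cpoly_hom_cvar_id)
qed

lemma rho1_mult: "rho1 n (p * q) = rho1 n p * rho1 n q"
  by (simp add: rho1_def cpoly_hom_mult)

lemma rho1_add: "rho1 n (p + q) = rho1 n p + rho1 n q"
  by (simp add: rho1_def cpoly_hom_add)

lemma rho1_scale: "rho1 n (cconst c * p) = cconst c * rho1 n p"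
  by (simp add: rho1_def cpoly_hom_mult cpoly_hom_cconst)

lemma span_cvar_Theta: "cp.span (cvar ` Theta n) \<subseteq> carrier (cpoly_alg (Theta n))"
  by (rule cpoly_alg_span) (auto intro: cpoly_alg_cvar)

lemma rho1_carrier:
  assumes "1 \<le> n" "p \<in> carrier (cpoly_alg (S_vars n))"
  shows "rho1 n p \<in> carrier (cpoly_alg (Theta n))"
  unfolding rho1_def
proof (rule cpoly_hom_carrier[OF assms(2)])
  fix t assume "t \<in> S_vars n"
  then have "rho1 n (cvar t) \<in> carrier (cpoly_alg (Theta n))"
    using rho1_cvar(1)[OF assms(1)] span_cvar_Theta by blast
  then show "(if t \<in> Theta' n then THE R. R \<in> cspan (S_vars n) (cvar ` Theta n) \<and> cvar t - R \<in> L_space n else cvar t)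
      \<in> carrier (cpoly_alg (Theta n))"
    by (simp add: rho1_def cpoly_hom_cvar)
qed

text \<open>On a variable, \<open>rho1\<close> changes the argument by an element of
  \<open>L_space n\<close>, which evaluates to 0; both sides are homomorphisms.\<close>

lemma isotropic_eval_rho1:
  assumes "1 \<le> n" "p \<in> carrier (cpoly_alg (S_vars n))"
  shows "isotropic_eval n (rho1 n p) = isotropic_eval n p"
proof -
  have "isotropic_eval n (rho1 n p) = cpoly_hom (\<lambda>t. isotropic_eval n (rho1 n (cvar t))) p"
    unfolding isotropic_eval_def rho1_def cpoly_hom_comp cpoly_hom_cvar ..
  also have "\<dots> = cpoly_hom (minor (isotropic_matrix n)) p"
  proof (rule cpoly_hom_cong[OF assms(2)])
    fix t assume "t \<in> S_vars n"
    from isotropic_eval_L_space[OF rho1_cvar(2)[OF assms(1) this]]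
    show "isotropic_eval n (rho1 n (cvar t)) = minor (isotropic_matrix n) t"
      by (simp add: isotropic_eval_diff) (simp add: isotropic_eval_def cpoly_hom_cvar)
  qed
  finally show ?thesis by (simp add: isotropic_eval_def)
qed

text \<open>\<open>L_space n\<close> consists of linear forms, and on linear forms
  \<open>rho1\<close> is the identity modulo \<open>L_space n\<close>. Hence \<open>rho1 n p\<close>
  is a linear form in admissible variables that lies in \<open>L_space n\<close>, so it is
  0.\<close>

lemma rho1_L_space:
  assumes n: "1 \<le> n" and p: "p \<in> L_space n"
  shows "rho1 n p = 0"
proof -
  have "X_tuple t \<in> cp.span (cvar ` S_vars n)" if "column_shape n t" for t
  proof (cases "distinct t")
    case True
    have "set t \<subseteq> N_set n" using that by (simp add: column_shape_def)
    from X_tuple_cases[OF this True] obtain s e where s: "sorted_wrt N_less s" "set s = set t"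
      "length s = length t" "e = 1 \<or> e = -1" "X_tuple t = of_int e * cvar s" .
    then have "s \<in> S_vars n" using that by (simp add: S_vars_def column_shape_def)
    then show ?thesis unfolding s(5) by (intro of_int_mult_in_span cp.span_base) simp
  qed (simp add: X_tuple_def cp.span_zero)
  then have "omega_sum n t \<in> cp.span (cvar ` S_vars n)"
    if "length t + 2 \<le> n" "set t \<subseteq> N_set n" for t
    unfolding omega_sum_def using that by (intro cp.span_sum) (simp add: column_shape_def)
  then have "L_space n \<subseteq> cp.span (cvar ` S_vars n)"
    unfolding L_space_eq by (intro cp.span_minimal cp.subspace_span) blast
  then have "p \<in> cp.span (cvar ` S_vars n)" using p by blast
  then have "rho1 n p \<in> cp.span (cvar ` Theta n) \<and> p - rho1 n p \<in> L_space n"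
  proof (induction rule: cp.span_induct_alt)
    case base
    then show ?case by (simp add: rho1_def cpoly_hom_0 cp.span_zero L_space_eq)
  next
    case (step c x y)
    then obtain t where t: "t \<in> S_vars n" "x = cvar t" by blast
    have eq: "cconst c * x + y - rho1 n (cconst c * x + y) = cconst c * (x - rho1 n x) + (y - rho1 n y)"
      unfolding rho1_add rho1_scale by (simp add: algebra_simps)
    have "cconst c * (x - rho1 n x) + (y - rho1 n y) \<in> L_space n"
      using step(2) rho1_cvar(2)[OF n t(1)] unfolding t(2) L_space_eq
      by (intro cp.span_add cp.span_scale) simp_all
    moreover have "rho1 n (cconst c * x + y) \<in> cp.span (cvar ` Theta n)"
      using step(2) rho1_cvar(1)[OF n t(1)] unfolding t(2) rho1_add rho1_scale
      by (intro cp.span_add cp.span_scale) simp_all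
    ultimately show ?case unfolding eq by blast
  qed
  then have 1: "rho1 n p \<in> cp.span (cvar ` Theta n)" and "p - (p - rho1 n p) \<in> L_space n"
    using p unfolding L_space_eq by (blast intro: cp.span_diff)+
  then have "rho1 n p \<in> L_space n" by simp
  then show ?thesis using L_space_Theta_zero[OF n 1] by blast
qed

section \<open>The ideal I as the kernel of the evaluation\<close>

lemma I_A_mult:
  assumes "p \<in> I_A n" "q \<in> carrier (cpoly_alg (S_vars n))"
  shows "p * q \<in> I_A n"
  using assms by (simp add: I_A_def cpoly_alg_mult minor_map_eq cpoly_hom_mult)

lemma cpoly_alg_in_span_tableau:
  assumes "p \<in> carrier (cpoly_alg (S_vars n))"
  shows "p \<in> cp.span {tableau cs | cs. \<forall>c\<in>set cs. column_shape n c}"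
proof -
  let ?T = "{tableau cs | cs. \<forall>c\<in>set cs. column_shape n c}"
  have one: "1 \<in> ?T" by (intro CollectI exI[of _ "[]"]) simp
  have mult: "x * y \<in> ?T" if "x \<in> ?T" "y \<in> ?T" for x y
  proof -
    from that(1) obtain cs where cs: "x = tableau cs" "\<forall>c\<in>set cs. column_shape n c" by blast
    from that(2) obtain ds where ds: "y = tableau ds" "\<forall>c\<in>set ds. column_shape n c" by blast
    have "x * y = tableau (cs @ ds)" "\<forall>c\<in>set (cs @ ds). column_shape n c" using cs ds by auto
    then show ?thesis by blast
  qed
  have pow: "cvar v ^ k \<in> ?T" if "v \<in> S_vars n" for v k
  proof (induction k)
    case 0
    show ?case unfolding power_0 by (rule one)
  next
    case (Suc k)
    have "cvar v \<in> ?T" using that by (intro CollectI exI[of _ "[v]"]) (simp add: cvar_eq_X_tuple Theta_column_shape)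
    then show ?case unfolding power_Suc by (rule mult[OF _ Suc])
  qed
  have "mon_eval cvar m \<in> ?T" if "m \<in> Poly_Mapping.keys p" for m
  proof -
    have "Poly_Mapping.keys m \<subseteq> S_vars n" using assms that by (auto simp: cpoly_alg_def)
    moreover have "(\<Prod>v\<in>A. cvar v ^ Poly_Mapping.lookup m v) \<in> ?T" if "finite A" "A \<subseteq> S_vars n" for A
      using that
    proof (induction A rule: finite_induct)
      case empty
      show ?case unfolding prod.empty by (rule one)
    next
      case (insert v A)
      then show ?case unfolding prod.insert[OF insert.hyps] by (intro mult pow) blast+
    qed
    ultimately show ?thesis unfolding mon_eval_def by simp
  qed
  then show ?thesis
    by (subst cpoly_eq_sum_mon_eval) (intro cp.span_sum cp.span_scale cp.span_base)
qed

text \<open>\<open>rho1\<close> fixes \<open>q\<close>, so the product is the image of a product in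
  \<open>I_A n\<close>.\<close>

lemma I_ideal_mult:
  assumes n: "1 \<le> n" and p: "p \<in> I_ideal n" and q: "q \<in> carrier (cpoly_alg (Theta n))"
  shows "p * q \<in> I_ideal n"
proof -
  from p obtain a where a: "a \<in> I_A n" "p = rho1 n a" by (auto simp: I_ideal_def)
  have "q \<in> carrier (cpoly_alg (S_vars n))" using q cpoly_alg_mono[OF Theta_sub] by blast
  then have aq: "a * q \<in> I_A n" by (rule I_A_mult[OF a(1)])
  have eq: "p * q = rho1 n (a * q)" by (simp add: rho1_mult rho1_Theta[OF q] a(2))
  show ?thesis unfolding I_ideal_def eq by (rule imageI[OF aq])
qed

lemma I_A_add: "p \<in> I_A n \<Longrightarrow> q \<in> I_A n \<Longrightarrow> p + q \<in> I_A n"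
  by (simp add: I_A_def cpoly_alg_add minor_map_eq cpoly_hom_add)

lemma I_ideal_add:
  assumes "p \<in> I_ideal n" "q \<in> I_ideal n"
  shows "p + q \<in> I_ideal n"
proof -
  from assms obtain a b where ab: "a \<in> I_A n" "b \<in> I_A n" "p = rho1 n a" "q = rho1 n b"
    by (auto simp: I_ideal_def)
  have eq: "p + q = rho1 n (a + b)" by (simp only: rho1_add ab(3,4))
  show ?thesis unfolding I_ideal_def eq by (rule imageI[OF I_A_add[OF ab(1,2)]])
qed

lemma zero_in_I_ideal: "0 \<in> I_ideal n"
proof -
  have "0 \<in> I_A n" by (simp add: I_A_def minor_map_eq cpoly_hom_0)
  moreover have "rho1 n 0 = 0" by (simp add: rho1_def cpoly_hom_0)
  ultimately show ?thesis unfolding I_ideal_def by (intro image_eqI[of _ _ 0]) simp_all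
qed

text \<open>The preimage of I under \<open>rho1\<close>. It absorbs products and contains
  \<open>I_A n\<close> and \<open>L_space n\<close>, so it can serve as \<open>K\<close> in
  \<open>straightening\<close>.\<close>

definition rho1_kernel :: "nat \<Rightarrow> int list cpoly set" where
  "rho1_kernel n = {p \<in> carrier (cpoly_alg (S_vars n)). rho1 n p \<in> I_ideal n}"

lemma I_ideal_eval:
  assumes "1 \<le> n" "p \<in> I_ideal n"
  shows "p \<in> carrier (cpoly_alg (Theta n))" "isotropic_eval n p = 0"
proof -
  from assms(2) obtain a where a: "a \<in> I_A n" "p = rho1 n a" by (auto simp: I_ideal_def)
  have "a \<in> carrier (cpoly_alg (S_vars n))" using a(1) by (simp add: I_A_def)
  then show "p \<in> carrier (cpoly_alg (Theta n))" "isotropic_eval n p = 0"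
    using rho1_carrier isotropic_eval_rho1 isotropic_eval_I_A[OF a(1)] assms(1) a(2) by simp_all
qed

lemma rho1_kernel_eval:
  assumes "1 \<le> n" "p \<in> rho1_kernel n"
  shows "isotropic_eval n p = 0"
  using assms isotropic_eval_rho1[OF assms(1), of p] I_ideal_eval(2)[OF assms(1)]
  by (simp add: rho1_kernel_def)

lemma subspace_rho1_kernel:
  assumes "1 \<le> n"
  shows "cp.subspace (rho1_kernel n)"
proof (rule cp.subspaceI)
  show "0 \<in> rho1_kernel n"
    using zero_in_I_ideal by (simp add: rho1_kernel_def rho1_def cpoly_hom_0)
  show "x + y \<in> rho1_kernel n" if "x \<in> rho1_kernel n" "y \<in> rho1_kernel n" for x y
    using that by (simp add: rho1_kernel_def cpoly_alg_add rho1_add I_ideal_add)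
  show "cconst c * x \<in> rho1_kernel n" if "x \<in> rho1_kernel n" for c x
    using that I_ideal_mult[OF assms, of "rho1 n x" "cconst c"]
    by (simp add: rho1_kernel_def cpoly_alg_mult rho1_scale mult.commute[of "cconst c" "rho1 n x"])
qed

text \<open>The factors commute, so the columns may be arranged by decreasing length, as
  \<open>straightening\<close> expects.\<close>

lemma tableau_mod_kernel:
  assumes n: "1 \<le> n" and cs: "\<And>c. c \<in> set cs \<Longrightarrow> column_shape n c"
  obtains g k where "tableau cs = g + k" "g \<in> cp.span (standard_products n (mset (map length cs)))"
    "k \<in> rho1_kernel n"
proof -
  let ?ds = "rev (sort_key length cs)"
  have "prod_mset (mset (map X_tuple cs)) = prod_mset (mset (map X_tuple ?ds))"
    by (simp only: mset_map mset_rev mset_sort)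
  then have "tableau cs = tableau ?ds"
    unfolding tableau_def prod_mset_prod_list .
  moreover have "tableau ?ds \<in> cp.span (standard_products n (mset (map length ?ds)) \<union> rho1_kernel n)"
  proof (rule straightening)
    show "p * q \<in> rho1_kernel n"
      if "p \<in> rho1_kernel n" "q \<in> carrier (cpoly_alg (S_vars n))" for p q
      using that I_ideal_mult[OF n _ rho1_carrier[OF n]]
      by (simp add: rho1_kernel_def cpoly_alg_mult rho1_mult)
    show "I_A n \<subseteq> rho1_kernel n" by (auto simp: rho1_kernel_def I_A_def I_ideal_def)
    show "L_space n \<subseteq> rho1_kernel n"
      using L_space_carrier[of n] rho1_L_space[OF n] zero_in_I_ideal by (auto simp: rho1_kernel_def)
    show "column_shape n c" if "c \<in> set ?ds" for c using that cs by simp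
    have "sorted (map length (sort_key length cs))" by simp
    then show "sorted_wrt (\<ge>) (map length ?ds)" by (simp add: sorted_wrt_rev flip: rev_map)
  qed
  moreover have "cp.span (rho1_kernel n) = rho1_kernel n"
    using subspace_rho1_kernel[OF n] by simp
  ultimately have "tableau cs \<in> {g + k |g k. g \<in> cp.span (standard_products n (mset (map length cs))) \<and> k \<in> rho1_kernel n}"
    by (simp add: cp.span_Un)
  then show thesis using that by blast
qed

text \<open>For the harder inclusion, straightening writes p as g + k with g in the span of the
  standard products and k in \<open>rho1_kernel n\<close>. Evaluation kills p and k, hence g, and
  independence gives g = 0. Then p, which \<open>rho1\<close> fixes, lies in I.\<close>

lemma I_ideal_eq:
  assumes n: "1 \<le> n"
  shows "I_ideal n = {p \<in> carrier (cpoly_alg (Theta n)). isotropic_eval n p = 0}"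
proof (intro equalityI subsetI)
  fix p assume "p \<in> I_ideal n"
  then show "p \<in> {p \<in> carrier (cpoly_alg (Theta n)). isotropic_eval n p = 0}"
    using I_ideal_eval[OF n] by blast
next
  interpret pipes n "P_set n" by (rule pipes_P)
  fix p assume "p \<in> {p \<in> carrier (cpoly_alg (Theta n)). isotropic_eval n p = 0}"
  then have p: "p \<in> carrier (cpoly_alg (Theta n))" "isotropic_eval n p = 0" by auto
  let ?C = "chain_product ` ideal_chains n"
  have "p \<in> carrier (cpoly_alg (S_vars n))" using p(1) cpoly_alg_mono[OF Theta_sub] by blast
  then have "p \<in> cp.span {tableau cs | cs. \<forall>c\<in>set cs. column_shape n c}"
    by (rule cpoly_alg_in_span_tableau)
  moreover have "{tableau cs | cs. \<forall>c\<in>set cs. column_shape n c} \<subseteq> cp.span (?C \<union> rho1_kernel n)"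
  proof clarify
    fix cs assume "\<forall>c\<in>set cs. column_shape n c"
    then obtain g k where gk: "tableau cs = g + k" "k \<in> rho1_kernel n"
      "g \<in> cp.span (standard_products n (mset (map length cs)))"
      using tableau_mod_kernel[OF n, of cs] by blast
    have "standard_products n d \<subseteq> ?C" for d by (auto simp: standard_products_def)
    then have "standard_products n (mset (map length cs)) \<subseteq> ?C \<union> rho1_kernel n" by blast
    from cp.span_mono[OF this] show "tableau cs \<in> cp.span (?C \<union> rho1_kernel n)"
      unfolding gk(1) using gk(2,3) by (intro cp.span_add) (auto intro: cp.span_base)
  qed
  ultimately have "p \<in> cp.span (?C \<union> rho1_kernel n)" by (rule cp_span_trans)
  moreover have "cp.span (rho1_kernel n) = rho1_kernel n"
    using subspace_rho1_kernel[OF n] by simp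
  ultimately obtain g k where gk: "p = g + k" "g \<in> cp.span ?C" "k \<in> rho1_kernel n"
    unfolding cp.span_Un by blast
  have "isotropic_eval n g = 0"
    using p(2) rho1_kernel_eval[OF n gk(3)] by (simp add: gk(1) isotropic_eval_add)
  then have "g = 0" by (rule eval_zero_imp_zero[OF n gk(2)])
  then have "rho1 n p \<in> I_ideal n" using gk(1,3) by (simp add: rho1_kernel_def)
  then show "p \<in> I_ideal n" by (simp add: rho1_Theta[OF p(1)])
qed

section \<open>Comparison of dimensions\<close>

lemma finite_chains_of_type: "finite {Js \<in> ideal_chains n. chain_type n Js = d}"
proof (rule finite_subset)
  have "P_set n \<subseteq> {1..int n} \<times> N_set n" by (auto simp: P_set_iff)
  then have "finite (P_set n)" by (rule finite_subset) simp
  then show "finite {Js. set Js \<subseteq> Pow (P_set n) \<and> length Js = size d}"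
    by (intro finite_lists_length_eq) simp
  show "{Js \<in> ideal_chains n. chain_type n Js = d} \<subseteq> {Js. set Js \<subseteq> Pow (P_set n) \<and> length Js = size d}"
  proof clarify
    fix Js assume Js: "Js \<in> ideal_chains n"
    then have "set Js \<subseteq> Pow (P_set n)" using order_ideal_P unfolding ideal_chains_def by blast
    then show "set Js \<subseteq> Pow (P_set n) \<and> length Js = size (chain_type n Js)"
      by (simp add: chain_type_def)
  qed
qed

text \<open>A vector of T outside the span of S could be added to S, giving more independent vectors
  in the span of T than T has elements.\<close>

lemma independent_span_exchange:
  assumes "finite S" "finite T" "card S = card T" "cp.independent S" "S \<subseteq> cp.span T"
  shows "T \<subseteq> cp.span S"
proof (rule ccontr)
  assume "\<not> T \<subseteq> cp.span S"
  then obtain b where b: "b \<in> T" "b \<notin> cp.span S" by blast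
  then have "cp.independent (insert b S)" using assms(4) by (intro cp.independent_insertI)
  moreover have "insert b S \<subseteq> cp.span T" using b(1) assms(5) by (auto intro: cp.span_base)
  ultimately have "card (insert b S) \<le> card T" using cp.independent_span_bound[OF assms(2)] by blast
  moreover have "b \<notin> S" using b(2) cp.span_base by blast
  ultimately show False using assms(1,3) by simp
qed

context pipes
begin

lemma independent_chain_products:
  assumes n: "1 \<le> n" and D: "D \<subseteq> ideal_chains n"
  shows "cp.independent ((\<lambda>Js. isotropic_eval n (chain_product Js)) ` D)"
proof
  let ?f = "\<lambda>Js. isotropic_eval n (chain_product Js)"
  assume "cp.dependent (?f ` D)"
  then obtain S u v where S: "finite S" "S \<subseteq> ?f ` D" "(\<Sum>v\<in>S. cconst (u v) * v) = 0" "v \<in> S" "u v \<noteq> 0"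
    unfolding cp.dependent_explicit by blast
  from finite_subset_image[OF S(1,2)] obtain F where F: "F \<subseteq> D" "finite F" "S = ?f ` F" by blast
  have FC: "F \<subseteq> ideal_chains n" using F(1) D by blast
  have "inj_on ?f F" using eval_chain_product_inj[OF n] FC inj_on_subset by blast
  then have "(\<Sum>Js\<in>F. cconst (u (?f Js)) * ?f Js) = 0"
    using S(3) unfolding F(3) by (simp add: sum.reindex o_def)
  moreover obtain Js where "Js \<in> F" "v = ?f Js" using S(4) F(3) by blast
  ultimately have "u v = 0"
    using chain_products_independent[OF n F(2) FC, of "\<lambda>Js. u (?f Js)" Js] by simp
  then show False using S(5) by simp
qed

lemma chain_product_tableau: "chain_product Js = tableau (map ideal_tuple Js)"
  by (simp add: chain_product_def tableau_def o_def)

text \<open>The chain product for \<open>Q\<close> is itself a tableau, so it straightens into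
  standard products of its own multidegree.\<close>

lemma chain_product_eval_standard:
  assumes n: "1 \<le> n" and Js: "Js \<in> ideal_chains n"
  shows "isotropic_eval n (chain_product Js) \<in>
    cp.span (isotropic_eval n ` standard_products n (chain_type n Js))"
proof -
  have "column_shape n c" if "c \<in> set (map ideal_tuple Js)" for c
    using that Js ideal_tuple_shape by (auto simp: ideal_chains_def)
  from tableau_mod_kernel[OF n this] obtain g k
    where gk: "tableau (map ideal_tuple Js) = g + k"
      "g \<in> cp.span (standard_products n (mset (map length (map ideal_tuple Js))))" "k \<in> rho1_kernel n" .
  have "mset (map length (map ideal_tuple Js)) = chain_type n Js"
    by (simp add: chain_type_def multiset.map_comp o_def)
  then have "isotropic_eval n g \<in> cp.span (isotropic_eval n ` standard_products n (chain_type n Js))"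
    unfolding isotropic_eval_def using cpoly_hom_in_span[OF gk(2)] by simp
  then show ?thesis
    using gk(1) rho1_kernel_eval[OF n gk(3)] by (simp add: chain_product_tableau isotropic_eval_add)
qed

text \<open>Since the number of chains of a given type does not depend on \<open>Q\<close>, linear independence for \<open>Q\<close>
  and spanning for \<open>P_set n\<close> imply spanning for \<open>Q\<close>.\<close>

lemma standard_in_span:
  assumes n: "1 \<le> n"
  shows "isotropic_eval n ` standard_products n d \<subseteq>
    cp.span ((\<lambda>Js. isotropic_eval n (chain_product Js)) ` ideal_chains n)"
proof -
  interpret P: pipes n "P_set n" by (rule pipes_P)
  let ?D = "{Js \<in> ideal_chains n. chain_type n Js = d}"
  let ?f = "\<lambda>Js. isotropic_eval n (chain_product Js)" and ?g = "\<lambda>Js. isotropic_eval n (P.chain_product Js)"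
  have DC: "?D \<subseteq> ideal_chains n" by blast
  have "standard_products n d = P.chain_product ` ?D"
    unfolding standard_products_def by blast
  then have std: "isotropic_eval n ` standard_products n d = ?g ` ?D"
    by (simp only: image_image)
  have fin: "finite (?f ` ?D)" "finite (?g ` ?D)"
    by (rule finite_imageI[OF finite_chains_of_type])+
  have "card (?f ` ?D) = card ?D"
    by (rule card_image[OF inj_on_subset[OF eval_chain_product_inj[OF n] DC]])
  also have "\<dots> = card (?g ` ?D)"
    by (rule card_image[OF inj_on_subset[OF P.eval_chain_product_inj[OF n] DC], symmetric])
  finally have card: "card (?f ` ?D) = card (?g ` ?D)" .
  have sub: "?f ` ?D \<subseteq> cp.span (?g ` ?D)"
  proof (rule image_subsetI)
    fix Js assume "Js \<in> ?D"
    then show "?f Js \<in> cp.span (?g ` ?D)"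
      using chain_product_eval_standard[OF n, of Js] unfolding std[symmetric] by simp
  qed
  have "?g ` ?D \<subseteq> cp.span (?f ` ?D)"
    by (rule independent_span_exchange[OF fin card independent_chain_products[OF n DC] sub])
  also have "\<dots> \<subseteq> cp.span (?f ` ideal_chains n)" by (rule cp.span_mono) blast
  finally show ?thesis unfolding std .
qed

lemma eval_in_span:
  assumes n: "1 \<le> n" and p: "p \<in> carrier (cpoly_alg (Theta n))"
  shows "isotropic_eval n p \<in> cp.span ((\<lambda>Js. isotropic_eval n (chain_product Js)) ` ideal_chains n)"
    (is "_ \<in> ?S")
proof -
  let ?T = "{tableau cs | cs. \<forall>c\<in>set cs. column_shape n c}"
  have "p \<in> carrier (cpoly_alg (S_vars n))" using p cpoly_alg_mono[OF Theta_sub] by blast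
  then have "p \<in> cp.span ?T" by (rule cpoly_alg_in_span_tableau)
  then have "isotropic_eval n p \<in> cp.span (isotropic_eval n ` ?T)"
    unfolding isotropic_eval_def by (rule cpoly_hom_in_span)
  moreover have "isotropic_eval n ` ?T \<subseteq> ?S"
  proof clarify
    fix cs assume "\<forall>c\<in>set cs. column_shape n c"
    then obtain g k where gk: "tableau cs = g + k" "k \<in> rho1_kernel n"
      "g \<in> cp.span (standard_products n (mset (map length cs)))"
      using tableau_mod_kernel[OF n, of cs] by blast
    have "isotropic_eval n g \<in> cp.span (isotropic_eval n ` standard_products n (mset (map length cs)))"
      unfolding isotropic_eval_def by (rule cpoly_hom_in_span[OF gk(3)])
    then have "isotropic_eval n g \<in> ?S" using standard_in_span[OF n] by (rule cp_span_trans)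
    then show "isotropic_eval n (tableau cs) \<in> ?S"
      using rho1_kernel_eval[OF n gk(2)] by (simp add: gk(1) isotropic_eval_add)
  qed
  ultimately show ?thesis by (rule cp_span_trans)
qed

lemma chain_products_eq: "chain_products n Q = chain_product ` ideal_chains n"
proof -
  have "prod_list (map (\<lambda>J. psi n Q (cvar J)) Js) = chain_product Js" for Js
    by (simp add: chain_product_def psi_def cpoly_hom_cvar ideal_tuple_def)
  then show ?thesis unfolding chain_products_def ideal_chains_def by auto
qed

end

section \<open>The quotient algebra\<close>

lemma plucker_proj_eq: "plucker_proj n p = (\<lambda>h. h + p) ` I_ideal n"
  by (auto simp: plucker_proj_def a_r_coset_def r_coset_def cpoly_alg_def)

lemma ideal_I_ideal:
  assumes n: "1 \<le> n"
  shows "ideal (I_ideal n) (cpoly_alg (Theta n))"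
proof -
  interpret R: cring "cpoly_alg (Theta n)" by (rule cring_cpoly_alg)
  have sub: "I_ideal n \<subseteq> carrier (cpoly_alg (Theta n))" using I_ideal_eval(1)[OF n] by blast
  have minus: "\<ominus>\<^bsub>cpoly_alg (Theta n)\<^esub> p = - p" if "p \<in> carrier (cpoly_alg (Theta n))" for p
    by (rule R.minus_equality) (use that cpoly_alg_uminus in simp_all)
  show ?thesis
  proof (rule idealI)
    show "ring (cpoly_alg (Theta n))" by (rule R.ring_axioms)
    show "subgroup (I_ideal n) (add_monoid (cpoly_alg (Theta n)))"
    proof (rule R.add.subgroupI)
      show "I_ideal n \<subseteq> carrier (cpoly_alg (Theta n))" by (rule sub)
      show "I_ideal n \<noteq> {}" using zero_in_I_ideal by blast
      show "\<ominus>\<^bsub>cpoly_alg (Theta n)\<^esub> p \<in> I_ideal n" if "p \<in> I_ideal n" for p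
      proof -
        have "p * (- 1) \<in> I_ideal n" using that by (intro I_ideal_mult[OF n]) (simp_all add: cpoly_alg_uminus)
        then show ?thesis using minus[of p] sub that by auto
      qed
      show "p \<oplus>\<^bsub>cpoly_alg (Theta n)\<^esub> q \<in> I_ideal n" if "p \<in> I_ideal n" "q \<in> I_ideal n" for p q
        using that by (simp add: I_ideal_add)
    qed
    show "x \<otimes>\<^bsub>cpoly_alg (Theta n)\<^esub> a \<in> I_ideal n" "a \<otimes>\<^bsub>cpoly_alg (Theta n)\<^esub> x \<in> I_ideal n"
      if "a \<in> I_ideal n" "x \<in> carrier (cpoly_alg (Theta n))" for a x
      using I_ideal_mult[OF n that] by (simp_all add: mult.commute[of x a])
  qed
qed

text \<open>By \<open>I_ideal_eq\<close> the quotient embeds into a polynomial ring, where both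
  independence and spanning have been established.\<close>

lemma plucker_proj_eq_iff:
  assumes n: "1 \<le> n" and p: "p \<in> carrier (cpoly_alg (Theta n))" and q: "q \<in> carrier (cpoly_alg (Theta n))"
  shows "plucker_proj n p = plucker_proj n q \<longleftrightarrow> isotropic_eval n p = isotropic_eval n q"
proof
  assume "plucker_proj n p = plucker_proj n q"
  moreover have "p \<in> plucker_proj n p" using zero_in_I_ideal by (force simp: plucker_proj_eq)
  ultimately obtain h where "h \<in> I_ideal n" "p = h + q" by (auto simp: plucker_proj_eq)
  then show "isotropic_eval n p = isotropic_eval n q"
    using I_ideal_eval(2)[OF n] by (simp add: isotropic_eval_add)
next
  have sub: "plucker_proj n p \<subseteq> plucker_proj n q"
    if "p \<in> carrier (cpoly_alg (Theta n))" "q \<in> carrier (cpoly_alg (Theta n))"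
      "isotropic_eval n p = isotropic_eval n q" for p q
  proof
    fix x assume "x \<in> plucker_proj n p"
    then obtain h where h: "h \<in> I_ideal n" "x = h + p" by (auto simp: plucker_proj_eq)
    have "p - q \<in> I_ideal n"
      unfolding I_ideal_eq[OF n] using that by (simp add: cpoly_alg_diff isotropic_eval_diff)
    then have "h + (p - q) \<in> I_ideal n" by (rule I_ideal_add[OF h(1)])
    then show "x \<in> plucker_proj n q"
      unfolding plucker_proj_eq h(2) by (intro image_eqI[of _ _ "h + (p - q)"]) simp_all
  qed
  assume "isotropic_eval n p = isotropic_eval n q"
  then show "plucker_proj n p = plucker_proj n q" using sub[OF p q] sub[OF q p] by auto
qed

lemma plucker_alg_simps:
  assumes n: "1 \<le> n"
  shows "carrier (plucker_alg n) = plucker_proj n ` carrier (cpoly_alg (Theta n))"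
    and "\<zero>\<^bsub>plucker_alg n\<^esub> = plucker_proj n 0"
    and "\<And>p q. p \<in> carrier (cpoly_alg (Theta n)) \<Longrightarrow> q \<in> carrier (cpoly_alg (Theta n)) \<Longrightarrow>
      plucker_proj n p \<oplus>\<^bsub>plucker_alg n\<^esub> plucker_proj n q = plucker_proj n (p + q)"
    and "\<And>c p. p \<in> carrier (cpoly_alg (Theta n)) \<Longrightarrow>
      c \<odot>\<^bsub>plucker_alg n\<^esub> plucker_proj n p = plucker_proj n (cconst c * p)"
proof -
  interpret I: ideal "I_ideal n" "cpoly_alg (Theta n)" by (rule ideal_I_ideal[OF n])
  show "carrier (plucker_alg n) = plucker_proj n ` carrier (cpoly_alg (Theta n))"
    by (auto simp: plucker_alg_def quot_alg_def ring.defs FactRing_def A_RCOSETS_def' plucker_proj_def)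
  show "\<zero>\<^bsub>plucker_alg n\<^esub> = plucker_proj n 0"
    by (simp add: plucker_alg_def quot_alg_def ring.defs FactRing_def plucker_proj_eq)
  show "plucker_proj n p \<oplus>\<^bsub>plucker_alg n\<^esub> plucker_proj n q = plucker_proj n (p + q)"
    if "p \<in> carrier (cpoly_alg (Theta n))" "q \<in> carrier (cpoly_alg (Theta n))" for p q
    using I.a_rcos_sum[OF that]
    by (simp add: plucker_alg_def quot_alg_def ring.defs FactRing_def plucker_proj_def)
  show "c \<odot>\<^bsub>plucker_alg n\<^esub> plucker_proj n p = plucker_proj n (cconst c * p)"
    if "p \<in> carrier (cpoly_alg (Theta n))" for c p
    using I.rcoset_mult_add[OF cpoly_alg_cconst that]
    by (simp add: plucker_alg_def quot_alg_def ring.defs FactRing_def plucker_proj_def)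
qed

lemma vectorspace_plucker_alg:
  assumes n: "1 \<le> n"
  shows "vectorspace (class_ring :: complex ring) (plucker_alg n)"
proof -
  let ?A = "plucker_alg n" and ?C = "carrier (cpoly_alg (Theta n))"
  note simps = plucker_alg_simps[OF n]
  have closed: "p \<in> ?C \<Longrightarrow> q \<in> ?C \<Longrightarrow> p + q \<in> ?C" "p \<in> ?C \<Longrightarrow> cconst c * p \<in> ?C" for p q c
    by (simp_all add: cpoly_alg_add cpoly_alg_mult)
  have "abelian_group ?A"
  proof (rule abelian_groupI)
    fix x y z assume "x \<in> carrier ?A" "y \<in> carrier ?A" "z \<in> carrier ?A"
    then obtain p q r where [simp]: "x = plucker_proj n p" "y = plucker_proj n q" "z = plucker_proj n r"
      and "p \<in> ?C" "q \<in> ?C" "r \<in> ?C" unfolding simps(1) by blast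
    then show "x \<oplus>\<^bsub>?A\<^esub> y \<oplus>\<^bsub>?A\<^esub> z = x \<oplus>\<^bsub>?A\<^esub> (y \<oplus>\<^bsub>?A\<^esub> z)"
      by (simp add: simps(3) closed add.assoc)
  next
    fix x y assume "x \<in> carrier ?A" "y \<in> carrier ?A"
    then obtain p q where [simp]: "x = plucker_proj n p" "y = plucker_proj n q"
      and pq: "p \<in> ?C" "q \<in> ?C" unfolding simps(1) by blast
    show "x \<oplus>\<^bsub>?A\<^esub> y = y \<oplus>\<^bsub>?A\<^esub> x"
      using pq by (simp add: simps(3) add.commute[of p q])
    show "x \<oplus>\<^bsub>?A\<^esub> y \<in> carrier ?A"
      using pq by (simp add: simps(3)) (simp only: simps(1) imageI closed)
  next
    fix x assume "x \<in> carrier ?A"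
    then obtain p where x: "x = plucker_proj n p" and p: "p \<in> ?C" unfolding simps(1) by blast
    show "\<zero>\<^bsub>?A\<^esub> \<oplus>\<^bsub>?A\<^esub> x = x" using p by (simp add: x simps(2,3))
    show "\<exists>y\<in>carrier ?A. y \<oplus>\<^bsub>?A\<^esub> x = \<zero>\<^bsub>?A\<^esub>"
    proof (rule bexI)
      show "plucker_proj n (- p) \<oplus>\<^bsub>?A\<^esub> x = \<zero>\<^bsub>?A\<^esub>"
        using p by (simp add: x simps(2,3) cpoly_alg_uminus)
      show "plucker_proj n (- p) \<in> carrier ?A" using p by (simp add: simps(1) cpoly_alg_uminus)
    qed
  qed (simp add: simps(1,2))
  moreover have "cring (class_ring :: complex ring)" by (rule class_cring.is_cring)
  ultimately have "module (class_ring :: complex ring) ?A"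
  proof (intro moduleI)
    fix a b :: complex and x y
    assume "x \<in> carrier ?A" "y \<in> carrier ?A"
    then obtain p q where x: "x = plucker_proj n p" "y = plucker_proj n q"
      and pq: "p \<in> ?C" "q \<in> ?C" unfolding simps(1) by blast
    show "a \<odot>\<^bsub>?A\<^esub> (x \<oplus>\<^bsub>?A\<^esub> y) = a \<odot>\<^bsub>?A\<^esub> x \<oplus>\<^bsub>?A\<^esub> a \<odot>\<^bsub>?A\<^esub> y"
      using pq by (simp add: x simps(3,4) closed distrib_left)
  next
    fix a b :: complex and x
    assume "x \<in> carrier ?A"
    then obtain p where x: "x = plucker_proj n p" and p: "p \<in> ?C" unfolding simps(1) by blast
    show "a \<odot>\<^bsub>?A\<^esub> x \<in> carrier ?A" using p by (simp add: x simps(1,4) closed)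
    show "(a \<oplus>\<^bsub>class_ring\<^esub> b) \<odot>\<^bsub>?A\<^esub> x = a \<odot>\<^bsub>?A\<^esub> x \<oplus>\<^bsub>?A\<^esub> b \<odot>\<^bsub>?A\<^esub> x"
      using p by (simp add: x simps(3,4) closed cconst_add distrib_right)
    show "(a \<otimes>\<^bsub>class_ring\<^esub> b) \<odot>\<^bsub>?A\<^esub> x = a \<odot>\<^bsub>?A\<^esub> (b \<odot>\<^bsub>?A\<^esub> x)"
    proof -
      have ab: "a \<otimes>\<^bsub>class_ring\<^esub> b = a * b" by simp
      show ?thesis
        unfolding ab x simps(4)[OF p] simps(4)[OF closed(2)[OF p]] cconst_mult mult.assoc ..
    qed
    show "\<one>\<^bsub>class_ring\<^esub> \<odot>\<^bsub>?A\<^esub> x = x"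
      using p by (simp add: x simps(4) cconst_one)
  qed
  then show ?thesis by (intro vectorspace.intro class_field.field_axioms)
qed

theorem corollary1p7p9:
  fixes n :: nat and Q :: "(int \<times> int) set"
  assumes "n \<ge> 1" and "A_set n \<subseteq> Q" and "Q \<subseteq> P_set n"
  shows "inj_on (plucker_proj n) (chain_products n Q) \<and>
    vectorspace.basis (class_ring :: complex ring) (plucker_alg n)
      (plucker_proj n ` chain_products n Q)"
proof -
  interpret pipes n Q using assms(2,3) by unfold_locales
  note n = assms(1)
  let ?A = "plucker_alg n" and ?C = "carrier (cpoly_alg (Theta n))"
  let ?b = "\<lambda>Js. plucker_proj n (chain_product Js)" and ?f = "\<lambda>Js. isotropic_eval n (chain_product Js)"
  interpret V: vectorspace "class_ring :: complex ring" ?A by (rule vectorspace_plucker_alg[OF n])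
  note simps = plucker_alg_simps[OF n]
  have inj: "inj_on (plucker_proj n) (chain_products n Q)"
  proof (rule inj_onI)
    fix x y assume "x \<in> chain_products n Q" "y \<in> chain_products n Q" and eq: "plucker_proj n x = plucker_proj n y"
    then obtain Js Js' where Js: "x = chain_product Js" "y = chain_product Js'" "Js \<in> ideal_chains n" "Js' \<in> ideal_chains n"
      unfolding chain_products_eq by blast
    have "?f Js = ?f Js'"
      using eq plucker_proj_eq_iff[OF n chain_product_Theta[OF Js(3)] chain_product_Theta[OF Js(4)]]
      by (simp add: Js(1,2))
    then have "Js = Js'" using inj_onD[OF eval_chain_product_inj[OF n] _ Js(3,4)] by simp
    then show "x = y" by (simp add: Js)
  qed
  have binj: "inj_on ?b (ideal_chains n)"
    using comp_inj_on[OF chain_product_inj[OF n], of "plucker_proj n"] inj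
    unfolding chain_products_eq by (simp add: o_def)
  have B: "plucker_proj n ` chain_products n Q = ?b ` ideal_chains n"
    unfolding chain_products_eq image_image ..
  \<comment> \<open>Coefficients of \<open>V.lincomb\<close> are indexed by vectors of the quotient;
    injectivity of \<open>?b\<close> lets the sum run over chains without merging terms.\<close>
  have lincomb: "V.lincomb a (?b ` F) = plucker_proj n (\<Sum>Js\<in>F. cconst (a (?b Js)) * chain_product Js)"
    if "finite F" "F \<subseteq> ideal_chains n" for a F
    using that
  proof (induction F rule: finite_induct)
    case empty
    show ?case unfolding V.lincomb_def by (simp add: simps(2))
  next
    case (insert Js F)
    have C: "chain_product Ks \<in> ?C" if "Ks \<in> insert Js F" for Ks
      using that insert.prems chain_product_Theta by blast
    have trm: "a (?b Ks) \<odot>\<^bsub>?A\<^esub> ?b Ks = plucker_proj n (cconst (a (?b Ks)) * chain_product Ks)"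
      "cconst (a (?b Ks)) * chain_product Ks \<in> ?C" if "Ks \<in> insert Js F" for Ks
      using C[OF that] simps(4) by (simp_all add: cpoly_alg_mult)
    have car: "a v \<odot>\<^bsub>?A\<^esub> v \<in> carrier ?A" if v: "v \<in> ?b ` insert Js F" for v
    proof -
      obtain Ks where Ks: "Ks \<in> insert Js F" "v = ?b Ks" using v by blast
      show ?thesis unfolding Ks(2) trm(1)[OF Ks(1)] simps(1) by (rule imageI[OF trm(2)[OF Ks(1)]])
    qed
    have "?b Js \<notin> ?b ` F"
    proof
      assume "?b Js \<in> ?b ` F"
      then obtain Ks where Ks: "Ks \<in> F" "?b Js = ?b Ks" by blast
      then have "Js = Ks" using inj_onD[OF binj Ks(2)] insert.prems by blast
      then show False using Ks(1) insert.hyps by simp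
    qed
    then have "V.lincomb a (?b ` insert Js F) = a (?b Js) \<odot>\<^bsub>?A\<^esub> ?b Js \<oplus>\<^bsub>?A\<^esub> V.lincomb a (?b ` F)"
      unfolding V.lincomb_def image_insert using car insert.hyps(1)
      by (intro V.finsum_insert) auto
    also have "V.lincomb a (?b ` F) = plucker_proj n (\<Sum>Js\<in>F. cconst (a (?b Js)) * chain_product Js)"
      using insert by simp
    also have "a (?b Js) \<odot>\<^bsub>?A\<^esub> ?b Js \<oplus>\<^bsub>?A\<^esub> \<dots> = plucker_proj n (cconst (a (?b Js)) * chain_product Js +
        (\<Sum>Js\<in>F. cconst (a (?b Js)) * chain_product Js))"
      unfolding trm(1)[OF insertI1] by (rule simps(3)) (use trm(2) in \<open>auto intro!: cpoly_alg_sum\<close>)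
    finally show ?case using insert.hyps by simp
  qed
  have sumC: "(\<Sum>Js\<in>F. cconst (a Js) * chain_product Js) \<in> ?C" if "F \<subseteq> ideal_chains n" for a F
    using that chain_product_Theta by (intro cpoly_alg_sum cpoly_alg_mult cpoly_alg_cconst) blast
  have "\<not> V.lin_dep (?b ` ideal_chains n)"
  proof
    assume "V.lin_dep (?b ` ideal_chains n)"
    then obtain S a v where S: "finite S" "S \<subseteq> ?b ` ideal_chains n" "V.lincomb a S = \<zero>\<^bsub>?A\<^esub>" "v \<in> S" "a v \<noteq> 0"
      unfolding V.lin_dep_def by (auto simp: class_ring_simps)
    from finite_subset_image[OF S(1,2)] obtain F where F: "F \<subseteq> ideal_chains n" "finite F" "S = ?b ` F" by blast
    have "plucker_proj n (\<Sum>Js\<in>F. cconst (a (?b Js)) * chain_product Js) = plucker_proj n 0"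
      using S(3) lincomb[OF F(2,1)] F(3) by (simp add: simps(2))
    then have "isotropic_eval n (\<Sum>Js\<in>F. cconst (a (?b Js)) * chain_product Js) = isotropic_eval n 0"
      by (rule plucker_proj_eq_iff[OF n sumC[OF F(1)] cpoly_alg_0, THEN iffD1])
    then have zero: "(\<Sum>Js\<in>F. cconst (a (?b Js)) * ?f Js) = 0"
      by (simp add: isotropic_eval_sum_scaled) (simp add: isotropic_eval_def cpoly_hom_0)
    obtain Js where "Js \<in> F" "v = ?b Js" using S(4) F(3) by blast
    then show False
      using chain_products_independent[OF n F(2,1) zero, of Js] S(5) by simp
  qed
  moreover have BC: "?b ` ideal_chains n \<subseteq> carrier ?A"
    using chain_product_Theta unfolding simps(1) by blast
  moreover have "V.span (?b ` ideal_chains n) = carrier ?A"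
  proof
    show "V.span (?b ` ideal_chains n) \<subseteq> carrier ?A" by (rule V.span_is_subset2[OF BC])
    show "carrier ?A \<subseteq> V.span (?b ` ideal_chains n)"
    proof
      fix x assume "x \<in> carrier ?A"
      then obtain p where p: "p \<in> ?C" "x = plucker_proj n p" unfolding simps(1) by blast
      from span_image_finite[OF eval_in_span[OF n p(1)] eval_chain_product_inj[OF n]]
      obtain F a where F: "finite F" "F \<subseteq> ideal_chains n" "isotropic_eval n p = (\<Sum>Js\<in>F. cconst (a Js) * ?f Js)" .
      \<comment> \<open>Coefficients indexed by chains are carried over to the basis vectors through
        the inverse of \<open>?b\<close>.\<close>
      define a' where "a' = (\<lambda>v. a (the_inv_into (ideal_chains n) ?b v))"
      have a': "a' (?b Js) = a Js" if "Js \<in> F" for Js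
        using that F(2) the_inv_into_f_f[OF binj] by (auto simp: a'_def)
      have "isotropic_eval n p = isotropic_eval n (\<Sum>Js\<in>F. cconst (a Js) * chain_product Js)"
        by (simp add: F(3) isotropic_eval_sum_scaled)
      then have "x = plucker_proj n (\<Sum>Js\<in>F. cconst (a Js) * chain_product Js)"
        using plucker_proj_eq_iff[OF n p(1) sumC[OF F(2)]] by (simp add: p(2))
      also have "\<dots> = V.lincomb a' (?b ` F)"
        unfolding lincomb[OF F(1,2)] using a' by (intro arg_cong[where f = "plucker_proj n"] sum.cong) simp_all
      finally have "x = V.lincomb a' (?b ` F)" .
      moreover have "a' \<in> ?b ` F \<rightarrow> carrier class_ring" by simp
      moreover have "finite (?b ` F)" "?b ` F \<subseteq> ?b ` ideal_chains n" using F(1,2) by blast+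
      ultimately show "x \<in> V.span (?b ` ideal_chains n)" unfolding V.span_def by blast
    qed
  qed
  ultimately have "V.basis (?b ` ideal_chains n)" by (simp add: V.basis_def)
  then show ?thesis using inj unfolding B by blast
qed

end
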